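(* Let $\omega>0$, let $l\geq0$ be an integer, set $B=l\omega$, and let $A\in\mathbb{R}$, $A\neq0$. Then the point $(B,A)\in\mathbb{R}^2$ is an adjacency point of the family of equations $$\frac{d\phi}{dt}=-\sin\phi+B+A\cos\omega t$$ (with $\omega$ fixed and $(B,A)$ as parameters) if and only if the numbers $$\mu=\frac{A}{2\omega},\qquad \lambda=\Big(\frac1{2\omega}\Big)^2-\mu^2$$ satisfy $\xi_l(\lambda,\mu)=0$, where adjacency points and the function $\xi_l$ are defined in the context.
   Context: Rotation number. Fix $\omega>0$. After the change $\tau=\omega t$ the equation becomes $\frac{d\phi}{d\tau}=-\frac{\sin\phi}{\omega}+\frac{B}{\omega}+\frac{A}{\omega}\cos\tau$, which defines the vector field $\dot\phi=-\frac{\sin\phi}{\omega}+\frac B\omega+\frac A\omega\cos\tau$, $\dot\tau=1$ on the torus $\mathbb{R}^2/2\pi\mathbb{Z}^2$ with coordinates $(\phi,\tau)$. The rotation number of the equation is the rotation number of the flow of this field, normalized so that the rotation number of a circle rotation is the rotation angle divided by $2\pi$; that is, $\rho(B,A)=\lim_{\tau\to+\infty}\phi(\tau)/\tau$ for any solution $\phi(\tau)$ lifted to $\mathbb{R}$ (the limit does not depend on the solution). Phase-lock areas and adjacency points. The $r$-th phase-lock area is the level set $\{(B,A)\in\mathbb{R}^2 : \rho(B,A)=r\}$, provided it has non-empty interior. The following facts are known: phase-lock areas exist only for integers $r$; the boundary of the $r$-th phase-lock area consists of two analytic curves, which are the graphs $\{B=g_{r,-}(A)\}$ and $\{B=g_{r,+}(A)\}$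 of two functions of $A\in\mathbb{R}$; and each phase-lock area is an infinite chain of bounded domains going to infinity in the vertical ($A$) direction, each two subsequent domains being separated by one point. The adjacency points (adjacencies) are the separation points of phase-lock areas (over all integers $r$) lying outside the horizontal axis $A=0$; that is, the points $(B,A)$ with $A\neq0$ such that $B=g_{r,-}(A)=g_{r,+}(A)$ for some integer $r$. The function $\xi_l$. For an integer $l\geq0$ and $\lambda,\mu\in\mathbb{R}$, set for integers $j\geq l+1$ $$M_j=\begin{pmatrix}1+\frac{\lambda}{j(j-l)} & \frac{\mu^2}{j(j-l)}\\ 1&0\end{pmatrix},\qquad R_{l+1}=\prod_{j=l+1}^{\infty}M_j=\lim_{N\to\infty}M_{l+1}M_{l+2}\cdots M_N,$$ where factors with bigger indices are placed to the right of those with smaller indices (this infinite product is known to converge). Then $$\xi_l(\lambda,\mu)=\begin{pmatrix}\lambda & \mu^2\end{pmatrix}R_{l+1}\begin{pmatrix}1\\0\end{pmatrix}.$$ *)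

theory Defs
  imports "HOL-Analysis.Analysis"
begin

section \<open>Rotation number\<close>

text \<open>The field on the torus is obtained from \<open>d\<phi>/dt = - sin \<phi> + B + A cos (\<omega> t)\<close> by
  the change of time \<open>\<tau> = \<omega> t\<close>. Its solutions are lifted to the universal cover, i.e. they
  take values in the reals.\<close>

definition torus_field :: "real \<Rightarrow> real \<Rightarrow> real \<Rightarrow> real \<Rightarrow> real \<Rightarrow> real" where
  "torus_field \<omega> B A \<tau> \<phi> = - sin \<phi> / \<omega> + B / \<omega> + A / \<omega> * cos \<tau>"

definition lifted_solution :: "real \<Rightarrow> real \<Rightarrow> real \<Rightarrow> (real \<Rightarrow> real) \<Rightarrow> bool" where
  "lifted_solution \<omega> B A \<phi> \<longleftrightarrow>
     (\<forall>\<tau>. (\<phi> has_real_derivative torus_field \<omega> B A \<tau> (\<phi> \<tau>)) (at \<tau>))"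

definition rotation_number :: "real \<Rightarrow> real \<Rightarrow> real \<Rightarrow> real" where
  "rotation_number \<omega> B A =
     (THE \<rho>. \<forall>\<phi>. lifted_solution \<omega> B A \<phi> \<longrightarrow> ((\<lambda>\<tau>. \<phi> \<tau> / \<tau>) \<longlongrightarrow> \<rho>) at_top)"

section \<open>Phase-lock areas and adjacencies\<close>

text \<open>Points of the parameter plane are pairs \<open>(B, A)\<close>, with the abscissa \<open>B\<close> first.\<close>

definition level_set :: "real \<Rightarrow> real \<Rightarrow> (real \<times> real) set" where
  "level_set \<omega> r = {(B, A). rotation_number \<omega> B A = r}"

definition is_phase_lock_area :: "real \<Rightarrow> real \<Rightarrow> (real \<times> real) set \<Rightarrow> bool" where
  "is_phase_lock_area \<omega> r L \<longleftrightarrow> L = level_set \<omega> r \<and> interior L \<noteq> {}"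

text \<open>The boundary of a phase-lock area is the union of the graphs of two functions
  \<open>B = g A\<close> and \<open>B = h A\<close> of the ordinate. The two functions are only determined up to
  exchanging their values at individual ordinates (and the analytic choice does exchange the
  left and the right one when it crosses), but whether they agree at a given ordinate does not
  depend on the choice, see \<open>boundary_functions_meet_iff\<close>. Hence analyticity need not be
  imposed on them.\<close>

definition boundary_functions ::
  "(real \<times> real) set \<Rightarrow> (real \<Rightarrow> real) \<Rightarrow> (real \<Rightarrow> real) \<Rightarrow> bool" where
  "boundary_functions L g h \<longleftrightarrow> frontier L = {(B, A). B = g A} \<union> {(B, A). B = h A}"

lemma boundary_functions_meet_iff:
  assumes "boundary_functions L g h" and "boundary_functions L g' h'"
  shows "B = g A \<and> B = h A \<longleftrightarrow> B = g' A \<and> B = h' A"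
proof -
  have "{(B, A). B = g A} \<union> {(B, A). B = h A} = {(B, A). B = g' A} \<union> {(B, A). B = h' A}"
    using assms by (simp add: boundary_functions_def)
  then have "b = g A \<or> b = h A \<longleftrightarrow> b = g' A \<or> b = h' A" for b
    by (auto simp: set_eq_iff)
  then show ?thesis by metis
qed

definition adjacency_point :: "real \<Rightarrow> real \<times> real \<Rightarrow> bool" where
  "adjacency_point \<omega> p \<longleftrightarrow>
     (case p of (B, A) \<Rightarrow> A \<noteq> 0 \<and>
        (\<exists>(r::int) L g h. is_phase_lock_area \<omega> (of_int r) L \<and> boundary_functions L g h \<and>
            B = g A \<and> B = h A))"

section \<open>The function \<open>\<xi>\<close>\<close>

definition M_mat :: "nat \<Rightarrow> real \<Rightarrow> real \<Rightarrow> nat \<Rightarrow> real^2^2" where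
  "M_mat l lam \<mu> j =
     vector [vector [1 + lam / (real j * (real j - real l)), \<mu>\<^sup>2 / (real j * (real j - real l))],
             vector [1, 0]]"

text \<open>\<open>M_prod l lam \<mu> n\<close> is the product of the \<open>n\<close> factors with indices \<open>l + 1, \<dots>, l + n\<close>,
  factors with bigger indices being placed to the right.\<close>

primrec M_prod :: "nat \<Rightarrow> real \<Rightarrow> real \<Rightarrow> nat \<Rightarrow> real^2^2" where
  "M_prod l lam \<mu> 0 = mat 1"
| "M_prod l lam \<mu> (Suc n) = M_prod l lam \<mu> n ** M_mat l lam \<mu> (l + Suc n)"

definition R_mat :: "nat \<Rightarrow> real \<Rightarrow> real \<Rightarrow> real^2^2" where
  "R_mat l lam \<mu> = lim (M_prod l lam \<mu>)"

definition \<xi> :: "nat \<Rightarrow> real \<Rightarrow> real \<Rightarrow> real" where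
  "\<xi> l lam \<mu> = (vector [lam, \<mu>\<^sup>2] v* R_mat l lam \<mu>) \<bullet> (vector [1, 0] :: real^2)"

end

theory Submission
  imports Defs
begin

text \<open>Write \<open>P\<close> for the time \<open>2\<pi>\<close> map of the lifted equation and \<open>D x = P x - x\<close> for its advance,
a continuous \<open>2\<pi>\<close>-periodic function of \<open>x\<close>. The proof has a dynamical half and a linear half.

\<^bold>\<open>Dynamics.\<close> For an integer \<open>r\<close> the rotation number is \<open>r\<close> exactly when \<open>D\<close> takes the value
\<open>2\<pi>r\<close>. As \<open>D\<close> is strictly increasing in \<open>B\<close>, the level set of \<open>r\<close> meets every horizontal line
in a segment; at its left end the maximum of \<open>D\<close> is \<open>2\<pi>r\<close>, at its right end the minimum is. The two
boundary curves therefore meet at a point exactly when \<open>D\<close> is identically \<open>2\<pi>r\<close> there, i.e. when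
\<open>P\<close> is the identity modulo \<open>2\<pi>\<close> (\<open>adjacency_point_iff\<close>).

\<^bold>\<open>Linearization.\<close> With \<open>\<Phi> = exp (i\<phi>)\<close> the equation is the Riccati equation of the linear system
\<open>u' = v / (2\<omega>)\<close>, \<open>v' = i (q + 2\<mu> cos t) v + u / (2\<omega>)\<close>, \<open>q = B / \<omega>\<close>, through \<open>\<Phi> = v / u\<close>. The map \<open>P\<close> is the
identity modulo \<open>2\<pi>\<close> iff the monodromy of this system is a scalar \<open>c\<close>. In the variable \<open>w = exp (-i t)\<close> the
system is a double confluent Heun equation, and \<open>\<xi> = 0\<close> says that it has a solution analytic at \<open>w = 0\<close>:
after the gauge factor \<open>exp (\<mu> w)\<close>, and after rescaling by \<open>\<mu>\<^sup>n / n!\<close>, the three-term recurrence of the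
Taylor coefficients becomes the backward recurrence given by the matrices \<open>M\<^sub>j\<close>. The limits of the
products of these matrices form its non-growing solution \<open>tail_limit\<close>, and \<open>\<xi> = 0\<close> is the equation of the
recurrence at \<open>w\<^sup>0\<close>.

\<^bold>\<open>From a constant advance to \<open>\<xi> = 0\<close>.\<close> If the monodromy is scalar, all solutions have Fourier expansions
with respect to one multiplier. The Fourier coefficients of \<open>v\<close> satisfy a regular three-term recurrence unless
the index hits \<open>0\<close>, and a regular recurrence has, up to a factor, only one solution that decays at infinity,
whereas there are two independent ones here. So the multiplier is \<open>1\<close>, \<open>q\<close> is an integer, and the
recurrence decouples at the index \<open>0\<close>; a linear combination then has no Fourier modes of positive index
and is analytic at \<open>w = 0\<close>. Its bounded Taylor coefficients must be those of \<open>tail_limit\<close>, whence \<open>\<xi> = 0\<close>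
(\<open>advance_const_imp_xi_zero\<close>).

\<^bold>\<open>From \<open>\<xi> = 0\<close> to a constant advance.\<close> The non-growing solution now yields a periodic solution of the linear
system. The symmetry of the system that reflects in the unit circle gives a second one. They are
independent, because otherwise a series in nonpositive powers of \<open>exp (i t)\<close> would equal
\<open>exp (i (l + 1) t)\<close> times a series in nonnegative powers, which forces both to vanish; here \<open>l \<ge> 0\<close> is essential. Two independent
periodic solutions make \<open>P\<close> the identity (\<open>xi_zero_imp_advance_const\<close>).

\<^bold>\<open>Non-empty interior.\<close> If the level set had empty interior, \<open>D\<close> would be constant along a curve over the whole
\<open>A\<close>-axis, and \<open>B / \<omega>\<close> would be an integer on it away from \<open>A = 0\<close>; by continuity the curve would stay on \<open>B = l\<omega>\<close> up to
small \<open>A\<close>. But there \<open>\<lambda> > 0\<close>, hence \<open>\<xi> > 0\<close> (\<open>interior_level_set_nonempty\<close>).\<close>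

section \<open>Differential inequalities and global solutions of scalar equations\<close>

text \<open>Where \<open>d\<close> is nonnegative the hypothesis bounds the derivative of \<open>d exp (K t)\<close> from below; where it is
negative it makes \<open>d exp (- K t)\<close> nondecreasing, so \<open>d\<close> can never become negative. With the
source term \<open>\<delta>\<close> this one statement yields uniqueness, preservation of order and strict monotonicity in \<open>B\<close>.\<close>

lemma comparison_lower_bound:
  fixes d :: "real \<Rightarrow> real"
  assumes der: "\<And>s. s \<ge> 0 \<Longrightarrow> (d has_real_derivative d' s) (at s)"
    and ineq: "\<And>s. s \<ge> 0 \<Longrightarrow> d' s \<ge> \<delta> - K * \<bar>d s\<bar>"
    and K: "K \<ge> 0" and \<delta>: "\<delta> \<ge> 0" and d0: "d 0 \<ge> 0" and t: "t \<ge> 0"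
  shows "d t \<ge> exp (- K * t) * (d 0 + \<delta> * t)"
proof -
  have cont: "continuous_on {0..a} d" for a
    using der by (intro DERIV_continuous_on[where D = d']) (auto intro: has_field_derivative_at_within)
  have nonneg: "d a \<ge> 0" if a: "a \<ge> 0" for a
  proof (rule ccontr)
    assume neg: "\<not> d a \<ge> 0"
    \<comment> \<open>The last time up to \<open>a\<close> at which \<open>d\<close> is nonnegative; from then on \<open>\<bar>d\<bar> = - d\<close>.\<close>
    define Z where "Z = {0..a} \<inter> d -` {0..}"
    have "closed Z" unfolding Z_def
      by (intro continuous_closed_preimage cont) auto
    moreover have "bounded Z" unfolding Z_def by (rule bounded_subset[of "{0..a}"]) auto
    ultimately have "compact Z" by (simp add: compact_eq_bounded_closed)
    moreover have "0 \<in> Z" using a d0 by (auto simp: Z_def)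
    ultimately obtain s where s: "s \<in> Z" "\<And>r. r \<in> Z \<Longrightarrow> r \<le> s"
      using compact_attains_sup[of Z] by blast
    have "s < a" using s(1) neg by (cases "s = a") (auto simp: Z_def)
    have "s \<ge> 0" using s(1) by (auto simp: Z_def)
    have neg': "d r < 0" if "s < r" "r \<le> a" for r
      using s(2)[of r] that \<open>s \<ge> 0\<close> by (force simp: Z_def)
    have "\<exists>r>s. r < a \<and> d a * exp (- K * a) - d s * exp (- K * s)
        = (a - s) * ((d' r - K * d r) * exp (- K * r))"
      using \<open>s < a\<close> \<open>s \<ge> 0\<close>
      by (intro MVT2) (auto intro!: derivative_eq_intros der simp: algebra_simps)
    then obtain r where r: "s < r" "r < a" "d a * exp (- K * a) - d s * exp (- K * s)
        = (a - s) * ((d' r - K * d r) * exp (- K * r))" by blast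
    have "d' r - K * d r \<ge> 0" using ineq[of r] neg'[of r] r \<open>s \<ge> 0\<close> \<delta> by simp
    then have "d a * exp (- K * a) - d s * exp (- K * s) \<ge> 0" using r(3) \<open>s < a\<close> by simp
    moreover have "d s * exp (- K * s) \<ge> 0" using s(1) by (simp add: Z_def)
    moreover have "d a * exp (- K * a) < 0" using neg by (simp add: mult_neg_pos)
    ultimately show False by linarith
  qed
  have "d 0 * exp (K * 0) - \<delta> * 0 \<le> d t * exp (K * t) - \<delta> * t"
  proof (rule DERIV_nonneg_imp_nondecreasing[OF t])
    fix s assume s: "0 \<le> s" "s \<le> t"
    have "((\<lambda>s. d s * exp (K * s) - \<delta> * s) has_real_derivative
        ((d' s + K * d s) * exp (K * s) - \<delta>)) (at s)"
      using s by (auto intro!: derivative_eq_intros der simp: algebra_simps)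
    moreover have "\<delta> * 1 \<le> (d' s + K * d s) * exp (K * s)"
      using ineq[of s] nonneg[of s] s K \<delta> by (intro mult_mono) auto
    ultimately show "\<exists>y. ((\<lambda>s. d s * exp (K * s) - \<delta> * s) has_real_derivative y) (at s) \<and> 0 \<le> y"
      by (intro exI conjI) auto
  qed
  then have "exp (- K * t) * (d 0 + \<delta> * t) \<le> exp (- K * t) * (d t * exp (K * t))"
    by (intro mult_left_mono) auto
  also have "\<dots> = d t" by (simp add: exp_minus field_simps)
  finally show ?thesis .
qed

text \<open>The difference between the claimed bound and \<open>\<plusminus>d\<close> satisfies the hypotheses of
\<open>comparison_lower_bound\<close> with \<open>\<delta> = 0\<close>.\<close>

lemma gronwall_bound:
  fixes d :: "real \<Rightarrow> real"
  assumes der: "\<And>s. s \<ge> 0 \<Longrightarrow> (d has_real_derivative d' s) (at s)"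
    and ineq: "\<And>s. s \<ge> 0 \<Longrightarrow> \<bar>d' s\<bar> \<le> K * \<bar>d s\<bar> + \<eta>"
    and K: "K \<ge> 0" and \<eta>: "\<eta> \<ge> 0" and t: "t \<ge> 0"
  shows "\<bar>d t\<bar> \<le> (\<bar>d 0\<bar> + \<eta> * t) * exp (K * t)"
proof -
  have one_sided: "\<sigma> * d t \<le> (\<bar>d 0\<bar> + \<eta> * t) * exp (K * t)" if \<sigma>: "\<bar>\<sigma>\<bar> = 1" for \<sigma> :: real
  proof -
    let ?h = "\<lambda>s. (\<bar>d 0\<bar> + \<eta> * s) * exp (K * s)"
    let ?e' = "\<lambda>s. K * ?h s + \<eta> * exp (K * s) - \<sigma> * d' s"
    have "?h t - \<sigma> * d t \<ge> exp (- K * t) * ((?h 0 - \<sigma> * d 0) + 0 * t)"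
    proof (rule comparison_lower_bound[where d' = ?e'])
      fix s :: real assume s: "s \<ge> 0"
      show "((\<lambda>s. ?h s - \<sigma> * d s) has_real_derivative ?e' s) (at s)"
        using s by (auto intro!: derivative_eq_intros der simp: algebra_simps)
      have h: "?h s \<ge> 0" using s \<eta> by simp
      have "\<eta> * 1 \<le> \<eta> * exp (K * s)" using \<eta> K s by (intro mult_left_mono) auto
      moreover have "\<sigma> * d' s \<le> K * \<bar>\<sigma> * d s\<bar> + \<eta>"
        using ineq[OF s] \<sigma> abs_ge_self[of "\<sigma> * d' s"] by (simp add: abs_mult)
      moreover have "K * (\<bar>\<sigma> * d s\<bar> - ?h s) \<le> K * \<bar>?h s - \<sigma> * d s\<bar>"
        using K h by (intro mult_left_mono) auto
      ultimately show "0 - K * \<bar>?h s - \<sigma> * d s\<bar> \<le> ?e' s" by (simp add: algebra_simps)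
    next
      show "0 \<le> ?h 0 - \<sigma> * d 0" using \<sigma> abs_ge_self[of "\<sigma> * d 0"] by (simp add: abs_mult)
    qed (use K t in auto)
    moreover have "0 \<le> exp (- K * t) * ((?h 0 - \<sigma> * d 0) + 0 * t)"
      using \<sigma> abs_ge_self[of "\<sigma> * d 0"] by (simp add: abs_mult)
    ultimately show ?thesis by linarith
  qed
  show ?thesis using one_sided[of 1] one_sided[of "-1"] by simp
qed

lemma global_antiderivative_exists:
  fixes g :: "real \<Rightarrow> real"
  assumes "continuous_on UNIV g"
  shows "\<exists>G. G 0 = 0 \<and> (\<forall>t. (G has_real_derivative g t) (at t))"
proof -
  define G where "G t = integral {0..t} g - integral {t..0} g" for t
  have "(G has_real_derivative g t) (at t)" for t
  proof -
    define a where "a = \<bar>t\<bar> + 1"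
    have int: "g integrable_on {x..y}" for x y
      by (intro integrable_continuous_real continuous_on_subset[OF assms]) auto
    have G: "G s = integral {-a..s} g - integral {-a..0} g" if "s \<in> {-a<..<a}" for s
    proof (cases "s \<ge> 0")
      case True
      then have "integral {-a..0} g + integral {0..s} g = integral {-a..s} g"
        using that int by (intro Henstock_Kurzweil_Integration.integral_combine) auto
      then show ?thesis using True by (cases "s = 0") (auto simp: G_def)
    next
      case False
      then have "integral {-a..s} g + integral {s..0} g = integral {-a..0} g"
        using that int by (intro Henstock_Kurzweil_Integration.integral_combine) auto
      then show ?thesis using False by (simp add: G_def)
    qed
    have t: "t \<in> {-a<..<a}" by (auto simp: a_def)
    have "((\<lambda>s. integral {-a..s} g) has_real_derivative g t) (at t within {-a..a})"
      using t by (intro integral_has_real_derivative continuous_on_subset[OF assms]) auto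
    then have "((\<lambda>s. integral {-a..s} g) has_real_derivative g t) (at t)"
      using t by (metis at_within_Icc_at greaterThanLessThan_iff)
    then have "((\<lambda>s. integral {-a..s} g - integral {-a..0} g) has_real_derivative g t) (at t)"
      by (auto intro!: derivative_eq_intros)
    then show ?thesis
      by (rule has_field_derivative_transform_within_open[where S = "{-a<..<a}"])
        (use t G in auto)
  qed
  moreover have "G 0 = 0" by (simp add: G_def)
  ultimately show ?thesis by blast
qed

text \<open>This estimate makes the Picard operator contract in the weighted norm.\<close>

lemma antiderivative_exp_bound:
  fixes G :: "real \<Rightarrow> real"
  assumes G: "G 0 = 0" "\<And>t. (G has_real_derivative g t) (at t)"
    and g: "\<And>t. \<bar>g t\<bar> \<le> c * exp (a * \<bar>t\<bar>)" and a: "a > 0" and c: "c \<ge> 0"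
  shows "\<bar>G t\<bar> \<le> c / a * exp (a * \<bar>t\<bar>)"
proof -
  have one_sided: "\<sigma> * G (\<tau> * t) \<le> c / a * exp (a * t)"
    if \<sigma>: "\<bar>\<sigma>\<bar> = 1" and \<tau>: "\<bar>\<tau>\<bar> = 1" and t: "t \<ge> 0" for \<sigma> \<tau> t
  proof -
    have "c / a * exp (a * 0) - \<sigma> * G (\<tau> * 0) \<le> c / a * exp (a * t) - \<sigma> * G (\<tau> * t)"
    proof (rule DERIV_nonneg_imp_nondecreasing[OF t])
      fix s assume s: "0 \<le> s" "s \<le> t"
      have "\<bar>\<sigma> * (g (\<tau> * s) * \<tau>)\<bar> \<le> c * exp (a * s)"
        using g[of "\<tau> * s"] \<sigma> \<tau> s by (simp add: abs_mult)
      moreover have "((\<lambda>s. c / a * exp (a * s) - \<sigma> * G (\<tau> * s)) has_real_derivative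
          c * exp (a * s) - \<sigma> * (g (\<tau> * s) * \<tau>)) (at s)"
        using a by (auto intro!: derivative_eq_intros DERIV_chain2[OF G(2)])
      ultimately show "\<exists>y. ((\<lambda>s. c / a * exp (a * s) - \<sigma> * G (\<tau> * s)) has_real_derivative y) (at s) \<and> 0 \<le> y"
        by (intro exI conjI) auto
    qed
    then show ?thesis using divide_nonneg_pos[OF c a] G(1) by simp
  qed
  define \<tau> :: real where "\<tau> = (if t \<ge> 0 then 1 else -1)"
  have "\<tau> * \<bar>t\<bar> = t" "\<bar>\<tau>\<bar> = 1" by (simp_all add: \<tau>_def)
  then show ?thesis using one_sided[of 1 \<tau> "\<bar>t\<bar>"] one_sided[of "-1" \<tau> "\<bar>t\<bar>"] by simp
qed

text \<open>Picard iteration for functions on the whole line at once: weighting by \<open>exp (2 K \<bar>t\<bar>)\<close> turns the Picard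
operator into a contraction with factor \<open>1 / 2\<close> on bounded continuous functions.\<close>

lemma bounded_lipschitz_ode_solution_exists:
  fixes f :: "real \<Rightarrow> real \<Rightarrow> real"
  assumes cont: "\<And>y. continuous_on UNIV y \<Longrightarrow> continuous_on UNIV (\<lambda>s. f s (y s))"
    and bound: "\<And>s x. \<bar>f s x\<bar> \<le> M"
    and lip: "\<And>s x y. \<bar>f s x - f s y\<bar> \<le> K * \<bar>x - y\<bar>" and K: "K > 0"
  shows "\<exists>\<phi>. \<phi> 0 = x0 \<and> (\<forall>t. (\<phi> has_real_derivative f t (\<phi> t)) (at t))"
proof -
  define w where "w t = exp (2 * K * \<bar>t\<bar>)" for t :: real
  have w: "continuous_on UNIV w" "w t > 0" "w t \<ge> 1" for t
    using K by (auto simp: w_def intro!: continuous_intros)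
  \<comment> \<open>The unknown is \<open>y = (\<phi> - x0) / w\<close>.\<close>
  define F where "F y s = f s (x0 + w s * apply_bcontfun y s)" for y :: "real \<Rightarrow>\<^sub>C real" and s
  have contF: "continuous_on UNIV (F y)" for y unfolding F_def
    by (intro cont continuous_intros w) (use continuous_on_apply_bcontfun in blast)
  define G where "G y = (SOME G. G 0 = 0 \<and> (\<forall>t. (G has_real_derivative F y t) (at t)))" for y
  have G: "G y 0 = 0" "(G y has_real_derivative F y t) (at t)" for y t
    using someI_ex[OF global_antiderivative_exists[OF contF[of y]], folded G_def] by auto
  have contG: "continuous_on UNIV (G y)" for y
    using G(2) by (meson DERIV_isCont continuous_at_imp_continuous_on)
  have M: "M \<ge> 0" using bound[of 0 0] by linarith
  have wG: "\<bar>G y t\<bar> \<le> M / (2 * K) * w t" for y t unfolding w_def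
  proof (rule antiderivative_exp_bound[OF G])
    fix s
    have "\<bar>F y s\<bar> \<le> M * 1" using bound by (simp add: F_def)
    also have "\<dots> \<le> M * w s" using M w by (intro mult_left_mono) auto
    finally show "\<bar>F y s\<bar> \<le> M * exp (2 * K * \<bar>s\<bar>)" by (simp add: w_def)
  qed (use K M in auto)
  define T where "T y = Bcontfun (\<lambda>t. G y t / w t)" for y
  have "(\<lambda>t. G y t / w t) \<in> bcontfun" for y
  proof (rule bcontfun_normI)
    show "continuous_on UNIV (\<lambda>t. G y t / w t)"
      by (intro continuous_intros contG w) (metis less_irrefl w(2))
    show "norm (G y t / w t) \<le> M / (2 * K)" for t
      using wG[of y t] w(2)[of t] by (simp add: field_simps abs_mult)
  qed
  then have T: "apply_bcontfun (T y) t = G y t / w t" for y t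
    by (simp add: T_def Bcontfun_inverse)
  have "dist (T y) (T z) \<le> 1 / 2 * dist y z" for y z
  proof (rule dist_bound)
    fix t
    have "\<bar>G y t - G z t\<bar> \<le> (K * dist y z) / (2 * K) * exp (2 * K * \<bar>t\<bar>)"
    proof (rule antiderivative_exp_bound[where g = "\<lambda>s. F y s - F z s"])
      show "G y 0 - G z 0 = 0" by (simp add: G)
      show "((\<lambda>t. G y t - G z t) has_real_derivative F y s - F z s) (at s)" for s
        by (intro derivative_intros G)
      show "\<bar>F y s - F z s\<bar> \<le> K * dist y z * exp (2 * K * \<bar>s\<bar>)" for s
      proof -
        have "\<bar>F y s - F z s\<bar> \<le> K * \<bar>w s * (apply_bcontfun y s - apply_bcontfun z s)\<bar>"
          using lip[of s "x0 + w s * apply_bcontfun y s" "x0 + w s * apply_bcontfun z s"]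
          by (simp add: F_def algebra_simps)
        also have "\<dots> = K * w s * dist (apply_bcontfun y s) (apply_bcontfun z s)"
          using w(2)[of s] by (simp add: abs_mult dist_real_def)
        also have "\<dots> \<le> K * w s * dist y z"
          using K w(2)[of s] by (intro mult_left_mono dist_bounded) auto
        finally show ?thesis by (simp add: w_def mult_ac)
      qed
    qed (use K in auto)
    then have "\<bar>G y t - G z t\<bar> \<le> 1 / 2 * dist y z * w t" using K by (simp add: w_def)
    then have "\<bar>G y t - G z t\<bar> / w t \<le> 1 / 2 * dist y z * w t / w t"
      using w(2)[of t] by (intro divide_right_mono) auto
    moreover have "dist (T y t) (T z t) = \<bar>G y t - G z t\<bar> / w t"
      using w(2)[of t] by (simp add: T dist_real_def flip: diff_divide_distrib)
    ultimately show "dist (T y t) (T z t) \<le> 1 / 2 * dist y z"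
      using w(2)[of t] by simp
  qed
  then have "\<exists>!y. T y = y" by (intro banach_fix_type[of "1 / 2"]) auto
  then obtain y where y: "T y = y" by auto
  define \<phi> where "\<phi> t = x0 + G y t" for t
  have "\<phi> t = x0 + w t * apply_bcontfun y t" for t
    using T[of y t] w(2)[of t] by (simp add: y \<phi>_def)
  then have "F y t = f t (\<phi> t)" for t by (simp add: F_def)
  then have "(\<phi> has_real_derivative f t (\<phi> t)) (at t)" for t
    using G(2)[of y t] unfolding \<phi>_def by (auto intro!: derivative_eq_intros)
  moreover have "\<phi> 0 = x0" by (simp add: \<phi>_def G)
  ultimately show ?thesis by blast
qed

section \<open>Quasi-additive sequences\<close>

text \<open>Comparing \<open>a (m n)\<close> with \<open>m a n\<close> and with \<open>n a m\<close> shows that every interval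
\<open>[(a n - C) / n, (a n + C) / n]\<close> meets every other one, so all of them have a common point \<open>\<rho>\<close>.\<close>

lemma quasi_additive_linear:
  fixes a :: "nat \<Rightarrow> real"
  assumes qa: "\<And>m n. \<bar>a (m + n) - a m - a n\<bar> \<le> C"
  shows "\<exists>\<rho>. \<forall>n. \<bar>a n - real n * \<rho>\<bar> \<le> C"
proof -
  have C: "C \<ge> 0" using qa[of 0 0] by linarith
  have mult: "\<bar>a (Suc m * n) - real (Suc m) * a n\<bar> \<le> real (Suc m) * C" for m n
  proof (induction m)
    case 0
    show ?case using C by simp
  next
    case (Suc m)
    have "a (Suc (Suc m) * n) - real (Suc (Suc m)) * a n
        = (a (n + Suc m * n) - a n - a (Suc m * n)) + (a (Suc m * n) - real (Suc m) * a n)"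
      by (simp add: algebra_simps)
    moreover have "real (Suc (Suc m)) * C = C + real (Suc m) * C" by (simp add: algebra_simps)
    ultimately show ?case using qa[of n "Suc m * n"] Suc by linarith
  qed
  define L U where "L n = (a (Suc n) - C) / real (Suc n)" and "U n = (a (Suc n) + C) / real (Suc n)" for n
  have LU: "L m \<le> U n" for m n
  proof -
    have "real (Suc n) * (a (Suc m) - C) \<le> real (Suc m) * (a (Suc n) + C)"
      using mult[of m "Suc n"] mult[of n "Suc m"] unfolding mult.commute[of "Suc n" "Suc m"]
      by (simp add: algebra_simps abs_le_iff del: of_nat_Suc mult_Suc mult_Suc_right)
    then show ?thesis unfolding L_def U_def
      by (simp add: pos_divide_le_eq pos_le_divide_eq mult.commute del: of_nat_Suc)
  qed
  define \<rho> where "\<rho> = (SUP n. L n)"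
  have \<rho>: "L n \<le> \<rho>" "\<rho> \<le> U n" for n
    unfolding \<rho>_def using LU by (auto intro!: cSUP_upper cSUP_least bdd_aboveI2[of _ _ "U 0"])
  have "\<bar>a n - real n * \<rho>\<bar> \<le> C" for n
  proof (cases n)
    case 0
    then show ?thesis using qa[of 0 0] by simp
  next
    case (Suc k)
    have "a n - C \<le> \<rho> * real n" "\<rho> * real n \<le> a n + C"
      using \<rho>[of k] by (simp_all add: L_def U_def Suc pos_divide_le_eq pos_le_divide_eq del: of_nat_Suc)
    then show ?thesis by (simp add: abs_le_iff mult.commute)
  qed
  then show ?thesis by blast
qed

lemma linear_le_bounded_imp_nonpos:
  fixes c K :: real
  assumes "\<And>n. real n * c \<le> K"
  shows "c \<le> 0"
proof (rule ccontr)
  assume "\<not> c \<le> 0"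
  then have "c > 0" by simp
  then obtain n :: nat where "K < real n * c" using reals_Archimedean3 by blast
  then show False using assms[of n] by simp
qed

section \<open>The time-\<open>2\<pi>\<close> advance\<close>

lemma abs_sin_diff_le: "\<bar>sin x - sin y\<bar> \<le> \<bar>x - y\<bar>" for x y :: real
proof -
  have "\<bar>sin x - sin y\<bar> = 2 * \<bar>sin ((x - y) / 2)\<bar> * \<bar>cos ((x + y) / 2)\<bar>"
    by (simp add: sin_diff_sin abs_mult)
  also have "\<dots> \<le> 2 * \<bar>(x - y) / 2\<bar> * 1"
    by (intro mult_mono mult_left_mono abs_sin_x_le_abs_x) auto
  finally show ?thesis by simp
qed

text \<open>Two solutions with the same initial value agree for nonnegative times (\<open>lifted_solution_unique\<close>), and
only such times matter below, so the choice is harmless.\<close>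

definition solution_from :: "real \<Rightarrow> real \<Rightarrow> real \<Rightarrow> real \<Rightarrow> real \<Rightarrow> real" where
  "solution_from \<omega> B A x = (SOME \<phi>. \<phi> 0 = x \<and> lifted_solution \<omega> B A \<phi>)"

definition advance :: "real \<Rightarrow> real \<times> real \<Rightarrow> real \<Rightarrow> real" where
  "advance \<omega> p x = solution_from \<omega> (fst p) (snd p) x (2 * pi) - x"

lemma lifted_solution_deriv:
  "lifted_solution \<omega> B A \<phi> \<Longrightarrow> (\<phi> has_real_derivative torus_field \<omega> B A t (\<phi> t)) (at t)"
  by (simp add: lifted_solution_def)

lemma lifted_solution_shift_angle:
  assumes "lifted_solution \<omega> B A \<phi>"
  shows "lifted_solution \<omega> B A (\<lambda>t. \<phi> t + 2 * pi * of_int k)"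
proof -
  have "sin (\<phi> t + 2 * pi * of_int k) = sin (\<phi> t)" for t
    by (simp add: sin_add)
  then show ?thesis using assms
    unfolding lifted_solution_def torus_field_def by (auto intro!: derivative_eq_intros)
qed

lemma lifted_solution_shift_time:
  assumes "lifted_solution \<omega> B A \<phi>"
  shows "lifted_solution \<omega> B A (\<lambda>t. \<phi> (t + 2 * pi * real n))"
  unfolding lifted_solution_def
proof
  fix t
  have "cos (t + 2 * pi * real n) = cos t" using cos_int_2pin[of "int n"] sin_int_2pin[of "int n"] by (simp add: cos_add)
  moreover have "((\<lambda>t. \<phi> (t + 2 * pi * real n)) has_real_derivative
      torus_field \<omega> B A (t + 2 * pi * real n) (\<phi> (t + 2 * pi * real n))) (at t)"
    using lifted_solution_deriv[OF assms] by (rule DERIV_shift[THEN iffD1])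
  ultimately show "((\<lambda>t. \<phi> (t + 2 * pi * real n)) has_real_derivative
      torus_field \<omega> B A t (\<phi> (t + 2 * pi * real n))) (at t)"
    by (simp add: torus_field_def)
qed

definition min_advance :: "real \<Rightarrow> real \<times> real \<Rightarrow> real" where
  "min_advance \<omega> p = (INF x. advance \<omega> p x)"

definition max_advance :: "real \<Rightarrow> real \<times> real \<Rightarrow> real" where
  "max_advance \<omega> p = (SUP x. advance \<omega> p x)"

lemma representative_mod_2pi: "\<exists>k::int. x + 2 * pi * of_int k \<in> {0..2 * pi}"
proof
  define k where "k = \<lfloor>x / (2 * pi)\<rfloor>"
  have "of_int k \<le> x / (2 * pi)" "x / (2 * pi) < of_int k + 1" unfolding k_def by linarith+
  then show "x + 2 * pi * of_int (- k) \<in> {0..2 * pi}" by (simp add: field_simps)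
qed

context
  fixes \<omega> :: real
  assumes \<omega>: "\<omega> > 0"
begin

lemma torus_field_lipschitz:
  shows "\<bar>torus_field \<omega> B A s x - torus_field \<omega> B A s y\<bar> \<le> 1 / \<omega> * \<bar>x - y\<bar>"
proof -
  have "torus_field \<omega> B A s x - torus_field \<omega> B A s y = - ((sin x - sin y) / \<omega>)"
    by (simp add: torus_field_def diff_divide_distrib)
  also have "\<bar>\<dots>\<bar> \<le> \<bar>x - y\<bar> / \<omega>"
    using \<omega> abs_sin_diff_le[of x y] by (simp add: divide_right_mono)
  finally show ?thesis by simp
qed

lemma lifted_solution_exists:
  shows "\<exists>\<phi>. \<phi> 0 = x \<and> lifted_solution \<omega> B A \<phi>"
  unfolding lifted_solution_def
proof (rule bounded_lipschitz_ode_solution_exists[where K = "1 / \<omega>"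
      and M = "1 / \<omega> + \<bar>B / \<omega>\<bar> + \<bar>A / \<omega>\<bar>"])
  show "continuous_on UNIV (\<lambda>s. torus_field \<omega> B A s (y s))" if "continuous_on UNIV y" for y
    unfolding torus_field_def using \<omega> by (intro continuous_intros that) auto
  fix s x
  have "\<bar>torus_field \<omega> B A s x\<bar> \<le> \<bar>- sin x / \<omega>\<bar> + \<bar>B / \<omega>\<bar> + \<bar>A / \<omega> * cos s\<bar>"
    unfolding torus_field_def by linarith
  also have "\<dots> \<le> 1 / \<omega> + \<bar>B / \<omega>\<bar> + \<bar>A / \<omega>\<bar>"
    using \<omega> by (intro add_mono) (auto simp: abs_mult divide_right_mono mult_left_le)
  finally show "\<bar>torus_field \<omega> B A s x\<bar> \<le> 1 / \<omega> + \<bar>B / \<omega>\<bar> + \<bar>A / \<omega>\<bar>" .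
qed (use \<omega> torus_field_lipschitz in auto)

lemma solution_from:
  shows "solution_from \<omega> B A x 0 = x" "lifted_solution \<omega> B A (solution_from \<omega> B A x)"
  using someI_ex[OF lifted_solution_exists] unfolding solution_from_def by blast+

text \<open>Taken with \<open>B = B'\<close> this says that solutions keep their order; taken with equal initial values,
that solutions increase strictly with \<open>B\<close>.\<close>

lemma lifted_solution_comparison:
  assumes sols: "lifted_solution \<omega> B A \<phi>" "lifted_solution \<omega> B' A \<psi>"
    and le: "B \<le> B'" "\<phi> 0 \<le> \<psi> 0" and t: "t \<ge> 0"
  shows "exp (- t / \<omega>) * ((\<psi> 0 - \<phi> 0) + (B' - B) / \<omega> * t) \<le> \<psi> t - \<phi> t"
proof -
  have "exp (- (1 / \<omega>) * t) * ((\<psi> 0 - \<phi> 0) + (B' - B) / \<omega> * t) \<le> \<psi> t - \<phi> t"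
  proof (rule comparison_lower_bound[where
        d' = "\<lambda>s. torus_field \<omega> B' A s (\<psi> s) - torus_field \<omega> B A s (\<phi> s)"])
    fix s :: real
    show "((\<lambda>s. \<psi> s - \<phi> s) has_real_derivative
        torus_field \<omega> B' A s (\<psi> s) - torus_field \<omega> B A s (\<phi> s)) (at s)"
      by (intro derivative_intros lifted_solution_deriv sols)
    have "torus_field \<omega> B' A s (\<psi> s) - torus_field \<omega> B A s (\<phi> s)
        = torus_field \<omega> B A s (\<psi> s) - torus_field \<omega> B A s (\<phi> s) + (B' - B) / \<omega>"
      by (simp add: torus_field_def diff_divide_distrib)
    then show "(B' - B) / \<omega> - 1 / \<omega> * \<bar>\<psi> s - \<phi> s\<bar>
        \<le> torus_field \<omega> B' A s (\<psi> s) - torus_field \<omega> B A s (\<phi> s)"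
      using torus_field_lipschitz[of B A s "\<psi> s" "\<phi> s"] by linarith
  qed (use \<omega> le t in auto)
  then show ?thesis by simp
qed

lemma lifted_solution_unique:
  assumes "lifted_solution \<omega> B A \<phi>" "lifted_solution \<omega> B A \<psi>" "\<phi> 0 = \<psi> 0" "t \<ge> 0"
  shows "\<phi> t = \<psi> t"
  using lifted_solution_comparison[of B A \<phi> B \<psi> t] lifted_solution_comparison[of B A \<psi> B \<phi> t] assms
  by simp

lemma lifted_solution_lipschitz:
  assumes sols: "lifted_solution \<omega> B A \<phi>" "lifted_solution \<omega> B' A' \<psi>" and t: "t \<ge> 0"
  shows "\<bar>\<phi> t - \<psi> t\<bar> \<le> (\<bar>\<phi> 0 - \<psi> 0\<bar> + (\<bar>B - B'\<bar> + \<bar>A - A'\<bar>) / \<omega> * t) * exp (t / \<omega>)"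
proof -
  have "\<bar>\<phi> t - \<psi> t\<bar> \<le> (\<bar>\<phi> 0 - \<psi> 0\<bar> + (\<bar>B - B'\<bar> + \<bar>A - A'\<bar>) / \<omega> * t) * exp (1 / \<omega> * t)"
  proof (rule gronwall_bound[where
        d' = "\<lambda>s. torus_field \<omega> B A s (\<phi> s) - torus_field \<omega> B' A' s (\<psi> s)"])
    fix s :: real
    show "((\<lambda>s. \<phi> s - \<psi> s) has_real_derivative
        torus_field \<omega> B A s (\<phi> s) - torus_field \<omega> B' A' s (\<psi> s)) (at s)"
      by (intro derivative_intros lifted_solution_deriv sols)
    have "torus_field \<omega> B A s (\<phi> s) - torus_field \<omega> B' A' s (\<psi> s)
        = torus_field \<omega> B A s (\<phi> s) - torus_field \<omega> B A s (\<psi> s) + (B - B') / \<omega> + (A - A') / \<omega> * cos s"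
      by (simp add: torus_field_def diff_divide_distrib left_diff_distrib)
    moreover have "\<bar>(A - A') / \<omega> * cos s\<bar> \<le> \<bar>A - A'\<bar> / \<omega>"
      using \<omega> by (simp add: abs_mult mult_left_le divide_right_mono)
    moreover have "\<bar>(B - B') / \<omega>\<bar> = \<bar>B - B'\<bar> / \<omega>" using \<omega> by simp
    ultimately show "\<bar>torus_field \<omega> B A s (\<phi> s) - torus_field \<omega> B' A' s (\<psi> s)\<bar>
        \<le> 1 / \<omega> * \<bar>\<phi> s - \<psi> s\<bar> + (\<bar>B - B'\<bar> + \<bar>A - A'\<bar>) / \<omega>"
      using torus_field_lipschitz[of B A s "\<phi> s" "\<psi> s"] unfolding add_divide_distrib by linarith
  qed (use \<omega> t in auto)
  then show ?thesis by simp
qed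

text \<open>The term \<open>(B t + A sin t) / \<omega>\<close> absorbs the whole field except \<open>- sin \<phi> / \<omega>\<close>.\<close>

lemma lifted_solution_drift:
  assumes sol: "lifted_solution \<omega> B A \<phi>" and t: "t \<ge> 0"
  shows "\<bar>\<phi> t - \<phi> 0 - (B * t + A * sin t) / \<omega>\<bar> \<le> t / \<omega>"
proof -
  have "\<bar>(\<phi> t - (B * t + A * sin t) / \<omega>) - (\<phi> 0 - (B * 0 + A * sin 0) / \<omega>)\<bar> \<le> (0 + 1 / \<omega> * t) * exp (0 * t)"
    using gronwall_bound[where d = "\<lambda>s. (\<phi> s - (B * s + A * sin s) / \<omega>) - \<phi> 0"
        and d' = "\<lambda>s. - sin (\<phi> s) / \<omega>" and K = 0 and \<eta> = "1 / \<omega>" and t = t]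
    using \<omega> t by (force intro!: derivative_eq_intros lifted_solution_deriv[OF sol]
        simp: torus_field_def field_simps divide_right_mono)
  then show ?thesis by (simp add: algebra_simps)
qed

lemma advance_eq:
  assumes "lifted_solution \<omega> B A \<phi>"
  shows "advance \<omega> (B, A) (\<phi> 0) = \<phi> (2 * pi) - \<phi> 0"
  using lifted_solution_unique[OF solution_from(2) assms, of "\<phi> 0" "2 * pi"]
    solution_from(1) by (simp add: advance_def)

lemma advance_periodic:
  shows "advance \<omega> p (x + 2 * pi * of_int k) = advance \<omega> p x"
proof (cases p)
  case (Pair B A)
  have "lifted_solution \<omega> B A (\<lambda>t. solution_from \<omega> B A x t + 2 * pi * of_int k)"
    by (intro lifted_solution_shift_angle solution_from)
  from advance_eq[OF this] show ?thesis
    by (simp add: Pair advance_def solution_from)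
qed

lemma advance_continuous:
  shows "continuous_on UNIV (advance \<omega> p)"
proof -
  let ?P = "\<lambda>x. solution_from \<omega> (fst p) (snd p) x (2 * pi)"
  have "lipschitz_on (exp (2 * pi / \<omega>)) UNIV ?P"
  proof (rule lipschitz_onI)
    fix x y show "dist (?P x) (?P y) \<le> exp (2 * pi / \<omega>) * dist x y"
      using lifted_solution_lipschitz[OF solution_from(2) solution_from(2),
          of "2 * pi" "fst p" "snd p" x "fst p" "snd p" y]
      by (simp add: solution_from dist_real_def mult.commute)
  qed auto
  then have "continuous_on UNIV ?P" by (rule lipschitz_on_continuous_on)
  then show ?thesis unfolding advance_def by (intro continuous_intros)
qed

lemma advance_lipschitz:
  shows "\<bar>advance \<omega> p x - advance \<omega> p' x\<bar>
      \<le> 4 * pi / \<omega> * exp (2 * pi / \<omega>) * dist p p'"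
proof -
  have "\<bar>advance \<omega> p x - advance \<omega> p' x\<bar>
      \<le> (\<bar>fst p - fst p'\<bar> + \<bar>snd p - snd p'\<bar>) / \<omega> * (2 * pi) * exp (2 * pi / \<omega>)"
    using lifted_solution_lipschitz[OF solution_from(2) solution_from(2),
          of "2 * pi" "fst p" "snd p" x "fst p'" "snd p'" x]
    by (simp add: solution_from advance_def)
  also have "\<dots> \<le> (2 * dist p p') / \<omega> * (2 * pi) * exp (2 * pi / \<omega>)"
    using \<omega> dist_fst_le[of p p'] dist_snd_le[of p p']
    by (intro mult_right_mono divide_right_mono) (auto simp: dist_real_def)
  finally show ?thesis by (simp add: algebra_simps)
qed

lemma advance_strict_mono:
  assumes "B < B'"
  shows "advance \<omega> (B, A) x < advance \<omega> (B', A) x"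
proof -
  have "0 < exp (- (2 * pi) / \<omega>) * ((B' - B) / \<omega> * (2 * pi))" using \<omega> assms by simp
  also have "\<dots> \<le> advance \<omega> (B', A) x - advance \<omega> (B, A) x"
    using lifted_solution_comparison[OF solution_from(2) solution_from(2),
          of B B' A x x "2 * pi"] assms
    by (simp add: solution_from advance_def)
  finally show ?thesis by simp
qed

lemma advance_drift:
  shows "\<bar>advance \<omega> (B, A) x - 2 * pi / \<omega> * B\<bar> \<le> 2 * pi / \<omega>"
  using lifted_solution_drift[OF solution_from(2), of "2 * pi" B A x]
  by (simp add: solution_from advance_def algebra_simps)

section \<open>The rotation number\<close>

text \<open>A translate of \<open>\<psi>\<close> by a multiple of \<open>2\<pi>\<close> and the next translate enclose \<open>\<phi>\<close> initially, hence at all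
later times.\<close>

lemma lifted_solution_increments_close:
  assumes sols: "lifted_solution \<omega> B A \<phi>" "lifted_solution \<omega> B A \<psi>" and t: "t \<ge> 0"
  shows "\<bar>(\<phi> t - \<phi> 0) - (\<psi> t - \<psi> 0)\<bar> \<le> 2 * pi"
proof -
  define k where "k = \<lfloor>(\<phi> 0 - \<psi> 0) / (2 * pi)\<rfloor>"
  have "of_int k \<le> (\<phi> 0 - \<psi> 0) / (2 * pi)" "(\<phi> 0 - \<psi> 0) / (2 * pi) < of_int k + 1"
    unfolding k_def by linarith+
  then have k: "\<psi> 0 + 2 * pi * of_int k \<le> \<phi> 0" "\<phi> 0 \<le> \<psi> 0 + 2 * pi * of_int (k + 1)"
    by (simp_all add: field_simps)
  have ordered: "\<phi>' t \<le> \<psi>' t" if "lifted_solution \<omega> B A \<phi>'" "lifted_solution \<omega> B A \<psi>'" "\<phi>' 0 \<le> \<psi>' 0"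
    for \<phi>' \<psi>'
  proof -
    have "0 \<le> exp (- t / \<omega>) * ((\<psi>' 0 - \<phi>' 0) + (B - B) / \<omega> * t)" using that by simp
    also have "\<dots> \<le> \<psi>' t - \<phi>' t"
      by (rule lifted_solution_comparison[OF that(1,2) order_refl that(3) t])
    finally show ?thesis by simp
  qed
  have "\<psi> t + 2 * pi * of_int k \<le> \<phi> t"
    using ordered[OF lifted_solution_shift_angle[OF sols(2)] sols(1)] k(1) by blast
  moreover have "\<phi> t \<le> \<psi> t + 2 * pi * of_int (k + 1)"
    using ordered[OF sols(1) lifted_solution_shift_angle[OF sols(2)]] k(2) by blast
  ultimately show ?thesis using k by (simp add: algebra_simps abs_le_iff)
qed

text \<open>The values of one solution at multiples of \<open>2\<pi>\<close> are quasi-additive, because shifting the time by \<open>2\<pi> m\<close> gives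
another solution of the same equation.\<close>

lemma lifted_solution_linear_growth:
  shows "\<exists>\<rho> K. \<forall>\<phi>. lifted_solution \<omega> B A \<phi> \<longrightarrow> (\<forall>t\<ge>0. \<bar>\<phi> t - \<phi> 0 - \<rho> * t\<bar> \<le> K)"
proof -
  define \<delta> where "\<delta> = solution_from \<omega> B A 0"
  have \<delta>: "\<delta> 0 = 0" "lifted_solution \<omega> B A \<delta>" unfolding \<delta>_def by (rule solution_from)+
  define a where "a n = \<delta> (2 * pi * real n)" for n
  have "\<bar>a (m + n) - a m - a n\<bar> \<le> 2 * pi" for m n
    using lifted_solution_increments_close[OF lifted_solution_shift_time[OF \<delta>(2), of m] \<delta>(2),
        of "2 * pi * real n"] \<delta>(1)
    by (simp add: a_def algebra_simps)
  from quasi_additive_linear[OF this]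
  obtain \<rho> where \<rho>: "\<And>n. \<bar>a n - real n * \<rho>\<bar> \<le> 2 * pi" by blast
  define C where "C = (\<bar>B\<bar> * (2 * pi) + \<bar>A\<bar> + 2 * pi) / \<omega>"
  define K where "K = 2 * pi + C + 2 * pi + \<bar>\<rho>\<bar>"
  have "\<bar>\<phi> t - \<phi> 0 - \<rho> / (2 * pi) * t\<bar> \<le> K" if sol: "lifted_solution \<omega> B A \<phi>" and t: "t \<ge> 0" for \<phi> t
  proof -
    define n where "n = nat \<lfloor>t / (2 * pi)\<rfloor>"
    define s where "s = t - 2 * pi * real n"
    have "real n = of_int \<lfloor>t / (2 * pi)\<rfloor>" using t by (simp add: n_def)
    then have "real n \<le> t / (2 * pi)" "t / (2 * pi) < real n + 1" by linarith+
    then have s: "0 \<le> s" "s \<le> 2 * pi" by (simp_all add: s_def field_simps)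
    have "\<bar>\<delta> (s + 2 * pi * real n) - \<delta> (0 + 2 * pi * real n) - (B * s + A * sin s) / \<omega>\<bar> \<le> s / \<omega>"
      by (rule lifted_solution_drift[OF lifted_solution_shift_time[OF \<delta>(2)] s(1)])
    then have "\<bar>\<delta> t - a n - (B * s + A * sin s) / \<omega>\<bar> \<le> s / \<omega>" by (simp add: s_def a_def)
    moreover have "\<bar>(B * s + A * sin s) / \<omega>\<bar> + s / \<omega> \<le> C"
    proof -
      have "\<bar>B * s\<bar> \<le> \<bar>B\<bar> * (2 * pi)" using s by (simp add: abs_mult mult_left_mono)
      moreover have "\<bar>A * sin s\<bar> \<le> \<bar>A\<bar>" by (simp add: abs_mult mult_left_le)
      ultimately have "\<bar>B * s + A * sin s\<bar> + s \<le> \<bar>B\<bar> * (2 * pi) + \<bar>A\<bar> + 2 * pi"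
        using s(2) by linarith
      from divide_right_mono[OF this, of \<omega>] \<omega> show ?thesis unfolding C_def by (simp flip: add_divide_distrib)
    qed
    ultimately have 1: "\<bar>\<delta> t - a n\<bar> \<le> C" by linarith
    have "\<rho> / (2 * pi) * t - real n * \<rho> = \<rho> * (s / (2 * pi))"
      by (simp add: s_def field_simps)
    moreover have "\<bar>\<rho> * (s / (2 * pi))\<bar> \<le> \<bar>\<rho>\<bar>"
      unfolding abs_mult by (rule mult_left_le) (use s in auto)
    ultimately have 2: "\<bar>\<rho> / (2 * pi) * t - real n * \<rho>\<bar> \<le> \<bar>\<rho>\<bar>"
      by simp
    have 3: "\<bar>(\<phi> t - \<phi> 0) - \<delta> t\<bar> \<le> 2 * pi"
      using lifted_solution_increments_close[OF sol \<delta>(2) t] \<delta>(1) by simp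
    show ?thesis unfolding K_def using 1 2 3 \<rho>[of n] by linarith
  qed
  then show ?thesis by blast
qed

lemma rotation_number_linear_growth:
  shows "\<exists>K. \<forall>\<phi>. lifted_solution \<omega> B A \<phi> \<longrightarrow> (\<forall>t\<ge>0. \<bar>\<phi> t - \<phi> 0 - rotation_number \<omega> B A * t\<bar> \<le> K)"
proof -
  obtain \<rho> K where K: "\<And>\<phi> t. lifted_solution \<omega> B A \<phi> \<Longrightarrow> t \<ge> 0 \<Longrightarrow> \<bar>\<phi> t - \<phi> 0 - \<rho> * t\<bar> \<le> K"
    using lifted_solution_linear_growth[of B A] by blast
  have lim: "((\<lambda>t. \<phi> t / t) \<longlongrightarrow> \<rho>) at_top" if sol: "lifted_solution \<omega> B A \<phi>" for \<phi>
  proof -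
    have "((\<lambda>t. (K + \<bar>\<phi> 0\<bar>) * inverse t) \<longlongrightarrow> (K + \<bar>\<phi> 0\<bar>) * 0) at_top"
      by (intro tendsto_intros tendsto_inverse_0_at_top filterlim_ident)
    moreover have "\<forall>\<^sub>F t in at_top. norm (\<phi> t / t - \<rho>) \<le> (K + \<bar>\<phi> 0\<bar>) * inverse t"
      using eventually_gt_at_top[of 0]
    proof eventually_elim
      case (elim t)
      have "\<phi> t / t - \<rho> = (\<phi> t - \<rho> * t) / t" using elim by (simp add: diff_divide_distrib)
      then have "norm (\<phi> t / t - \<rho>) = \<bar>\<phi> t - \<rho> * t\<bar> / t" using elim by simp
      also have "\<dots> \<le> (K + \<bar>\<phi> 0\<bar>) / t"
        using K[OF sol, of t] elim by (intro divide_right_mono) linarith+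
      finally show ?case by (simp add: divide_inverse)
    qed
    ultimately have "((\<lambda>t. \<phi> t / t - \<rho>) \<longlongrightarrow> 0) at_top"
      unfolding mult_zero_right by (rule Lim_null_comparison[rotated])
    then show ?thesis by (simp add: LIM_zero_iff)
  qed
  have "rotation_number \<omega> B A = \<rho>" unfolding rotation_number_def
  proof (rule the_equality)
    fix \<rho>' assume *: "\<forall>\<phi>. lifted_solution \<omega> B A \<phi> \<longrightarrow> ((\<lambda>\<tau>. \<phi> \<tau> / \<tau>) \<longlongrightarrow> \<rho>') at_top"
    obtain \<phi> where "lifted_solution \<omega> B A \<phi>" using lifted_solution_exists by blast
    then show "\<rho>' = \<rho>" using * lim tendsto_unique[OF trivial_limit_at_top_linorder] by blast
  qed (use lim in blast)
  then show ?thesis using K by (intro exI[of _ K]) simp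
qed

lemma advance_iterate:
  assumes sol: "lifted_solution \<omega> B A \<phi>"
  shows "\<phi> (2 * pi * real (Suc n)) = \<phi> (2 * pi * real n) + advance \<omega> (B, A) (\<phi> (2 * pi * real n))"
  using advance_eq[OF lifted_solution_shift_time[OF sol, of n]]
  by (simp add: algebra_simps)

lemma rotation_number_between:
  assumes D: "\<And>x. a \<le> advance \<omega> (B, A) x" "\<And>x. advance \<omega> (B, A) x \<le> b"
  shows "a \<le> 2 * pi * rotation_number \<omega> B A" "2 * pi * rotation_number \<omega> B A \<le> b"
proof -
  obtain \<phi> where sol: "lifted_solution \<omega> B A \<phi>" using lifted_solution_exists by blast
  obtain K where K: "\<And>t. t \<ge> 0 \<Longrightarrow> \<bar>\<phi> t - \<phi> 0 - rotation_number \<omega> B A * t\<bar> \<le> K"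
    using rotation_number_linear_growth[of B A] sol by blast
  have it: "\<phi> 0 + real n * a \<le> \<phi> (2 * pi * real n) \<and> \<phi> (2 * pi * real n) \<le> \<phi> 0 + real n * b" for n
  proof (induction n)
    case (Suc n)
    moreover have "real (Suc n) * c = real n * c + c" for c by (simp add: algebra_simps)
    ultimately show ?case
      using advance_iterate[OF sol, of n] D[of "\<phi> (2 * pi * real n)"] by simp
  qed simp
  have "real n * (a - 2 * pi * rotation_number \<omega> B A) \<le> K"
    "real n * (2 * pi * rotation_number \<omega> B A - b) \<le> K" for n
    using it[of n] abs_le_D1[OF K[of "2 * pi * real n"]] abs_le_D2[OF K[of "2 * pi * real n"]]
    by (simp_all add: algebra_simps)
  from this[THEN linear_le_bounded_imp_nonpos]
  show "a \<le> 2 * pi * rotation_number \<omega> B A" "2 * pi * rotation_number \<omega> B A \<le> b" by simp_all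
qed

text \<open>Such an \<open>x\<close> is a fixed point of the circle map: the solution through it advances by exactly \<open>2\<pi>r\<close> in each period.\<close>

lemma rotation_number_eqI:
  fixes r :: int
  assumes D: "advance \<omega> (B, A) x = 2 * pi * of_int r"
  shows "rotation_number \<omega> B A = of_int r"
proof -
  define \<phi> where "\<phi> = solution_from \<omega> B A x"
  have sol: "lifted_solution \<omega> B A \<phi>" and \<phi>0: "\<phi> 0 = x"
    unfolding \<phi>_def by (rule solution_from)+
  obtain K where K: "\<And>t. t \<ge> 0 \<Longrightarrow> \<bar>\<phi> t - \<phi> 0 - rotation_number \<omega> B A * t\<bar> \<le> K"
    using rotation_number_linear_growth[of B A] sol by blast
  have it: "\<phi> (2 * pi * real n) = x + 2 * pi * of_int (int n * r)" for n
  proof (induction n)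
    case (Suc n)
    then show ?case using advance_iterate[OF sol, of n] advance_periodic[of "(B, A)" x "int n * r"] D
      by (simp add: algebra_simps)
  qed (simp add: \<phi>0)
  have "real n * (2 * pi * (rotation_number \<omega> B A - of_int r)) \<le> K"
      "real n * (2 * pi * (of_int r - rotation_number \<omega> B A)) \<le> K" for n
    using it[of n] \<phi>0 abs_le_D1[OF K[of "2 * pi * real n"]] abs_le_D2[OF K[of "2 * pi * real n"]]
    by (simp_all add: algebra_simps)
  from linear_le_bounded_imp_nonpos[OF this(1)] linear_le_bounded_imp_nonpos[OF this(2)]
  show ?thesis using pi_gt_zero by (auto simp: mult_le_0_iff)
qed

section \<open>Boundaries of the level sets of the rotation number\<close>

lemma min_advance:
  shows "min_advance \<omega> p \<le> advance \<omega> p x" "\<exists>x. advance \<omega> p x = min_advance \<omega> p"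
proof -
  obtain z where z: "\<And>y. y \<in> {0..2 * pi} \<Longrightarrow> advance \<omega> p z \<le> advance \<omega> p y"
    using continuous_attains_inf[OF compact_Icc[of 0 "2 * pi"] _
        continuous_on_subset[OF advance_continuous[of p] subset_UNIV]]
    by fastforce
  have z: "advance \<omega> p z \<le> advance \<omega> p y" for y
    using z representative_mod_2pi[of y] advance_periodic[of p y] by metis
  have "min_advance \<omega> p = advance \<omega> p z" unfolding min_advance_def
    by (rule cInf_eq_minimum) (use z in auto)
  then show "min_advance \<omega> p \<le> advance \<omega> p x" "\<exists>x. advance \<omega> p x = min_advance \<omega> p"
    using z by auto
qed

lemma max_advance:
  shows "advance \<omega> p x \<le> max_advance \<omega> p" "\<exists>x. advance \<omega> p x = max_advance \<omega> p"
proof -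
  obtain z where z: "\<And>y. y \<in> {0..2 * pi} \<Longrightarrow> advance \<omega> p y \<le> advance \<omega> p z"
    using continuous_attains_sup[OF compact_Icc[of 0 "2 * pi"] _
        continuous_on_subset[OF advance_continuous[of p] subset_UNIV]]
    by fastforce
  have z: "advance \<omega> p y \<le> advance \<omega> p z" for y
    using z representative_mod_2pi[of y] advance_periodic[of p y] by metis
  have "max_advance \<omega> p = advance \<omega> p z" unfolding max_advance_def
    by (rule cSup_eq_maximum) (use z in auto)
  then show "advance \<omega> p x \<le> max_advance \<omega> p" "\<exists>x. advance \<omega> p x = max_advance \<omega> p"
    using z by auto
qed

lemma extreme_advances_continuous:
  shows "continuous_on UNIV (min_advance \<omega>)" "continuous_on UNIV (max_advance \<omega>)"
proof -
  define C where "C = 4 * pi / \<omega> * exp (2 * pi / \<omega>)"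
  have C: "C \<ge> 0" using \<omega> by (simp add: C_def)
  have lip: "advance \<omega> p x \<le> advance \<omega> p' x + C * dist p p'" for p p' x
    using advance_lipschitz[of p x p'] unfolding C_def by linarith
  have min: "min_advance \<omega> p \<le> min_advance \<omega> p' + C * dist p p'" for p p'
    using min_advance(1)[of p] min_advance(2)[of p'] lip[of p _ p'] order_trans
    by metis
  have max: "max_advance \<omega> p \<le> max_advance \<omega> p' + C * dist p p'" for p p'
  proof -
    obtain x where "advance \<omega> p x = max_advance \<omega> p" using max_advance(2) by blast
    then show ?thesis using lip[of p x p'] max_advance(1)[of p' x] by linarith
  qed
  have "\<bar>min_advance \<omega> p - min_advance \<omega> p'\<bar> \<le> C * dist p p'" for p p'
    using min[of p p'] min[of p' p] by (simp add: dist_commute abs_le_iff)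
  then have "lipschitz_on C UNIV (min_advance \<omega>)"
    by (intro lipschitz_onI C) (auto simp: dist_real_def)
  then show "continuous_on UNIV (min_advance \<omega>)" by (rule lipschitz_on_continuous_on)
  have "\<bar>max_advance \<omega> p - max_advance \<omega> p'\<bar> \<le> C * dist p p'" for p p'
    using max[of p p'] max[of p' p] by (simp add: dist_commute abs_le_iff)
  then have "lipschitz_on C UNIV (max_advance \<omega>)"
    by (intro lipschitz_onI C) (auto simp: dist_real_def)
  then show "continuous_on UNIV (max_advance \<omega>)" by (rule lipschitz_on_continuous_on)
qed

lemma extreme_advances_strict_mono:
  assumes B: "B < B'"
  shows "min_advance \<omega> (B, A) < min_advance \<omega> (B', A)"
    "max_advance \<omega> (B, A) < max_advance \<omega> (B', A)"
proof -
  obtain x y where xy: "advance \<omega> (B', A) x = min_advance \<omega> (B', A)"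
    "advance \<omega> (B, A) y = max_advance \<omega> (B, A)"
    using min_advance(2) max_advance(2) by meson
  show "min_advance \<omega> (B, A) < min_advance \<omega> (B', A)"
    using min_advance(1)[of "(B, A)" x] advance_strict_mono[OF B, of A x] xy by simp
  show "max_advance \<omega> (B, A) < max_advance \<omega> (B', A)"
    using max_advance(1)[of "(B', A)" y] advance_strict_mono[OF B, of A y] xy by simp
qed

lemma extreme_advances_onto:
  shows "\<exists>B. min_advance \<omega> (B, A) = c" "\<exists>B. max_advance \<omega> (B, A) = c"
proof -
  \<comment> \<open>The advance differs from \<open>2\<pi> B / \<omega>\<close> by at most \<open>2\<pi> / \<omega>\<close>.\<close>
  define b where "b = c * \<omega> / (2 * pi)"
  have c: "c = 2 * pi / \<omega> * b" using \<omega> by (simp add: b_def)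
  have b: "2 * pi / \<omega> * (b - 1) + 2 * pi / \<omega> = c" "2 * pi / \<omega> * (b + 1) - 2 * pi / \<omega> = c"
    by (simp_all add: c algebra_simps add_divide_distrib diff_divide_distrib)
  have lo: "advance \<omega> (b - 1, A) x \<le> c" and hi: "c \<le> advance \<omega> (b + 1, A) x" for x
    using advance_drift[of "b - 1" A x] advance_drift[of "b + 1" A x] b
    unfolding abs_le_iff by argo+
  have cont: "continuous_on {b - 1..b + 1} (\<lambda>B. min_advance \<omega> (B, A))"
    "continuous_on {b - 1..b + 1} (\<lambda>B. max_advance \<omega> (B, A))"
    by (rule continuous_on_compose2[OF extreme_advances_continuous(1)]
        continuous_on_compose2[OF extreme_advances_continuous(2)];
        auto intro!: continuous_intros)+
  have "min_advance \<omega> (b - 1, A) \<le> c" "c \<le> min_advance \<omega> (b + 1, A)"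
    "max_advance \<omega> (b - 1, A) \<le> c" "c \<le> max_advance \<omega> (b + 1, A)"
    using min_advance(2)[of "(b - 1, A)"] min_advance(2)[of "(b + 1, A)"]
      max_advance(2)[of "(b - 1, A)"] max_advance(2)[of "(b + 1, A)"]
      lo[where x = x for x] hi[where x = x for x] by (metis, metis, metis, metis)
  then show "\<exists>B. min_advance \<omega> (B, A) = c" "\<exists>B. max_advance \<omega> (B, A) = c"
    using IVT'[of "\<lambda>B. min_advance \<omega> (B, A)" "b - 1" c "b + 1", OF _ _ _ cont(1)]
      IVT'[of "\<lambda>B. max_advance \<omega> (B, A)" "b - 1" c "b + 1", OF _ _ _ cont(2)]
    by auto
qed

text \<open>If \<open>D\<close> omits the value \<open>2\<pi>r\<close>, it stays on one side of it by connectedness and, being periodic, keeps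
a positive distance; the rotation number then differs from \<open>r\<close>.\<close>

lemma mem_level_set_iff:
  shows "p \<in> level_set \<omega> (of_int r) \<longleftrightarrow>
    min_advance \<omega> p \<le> 2 * pi * of_int r \<and> 2 * pi * of_int r \<le> max_advance \<omega> p"
proof (cases p)
  case (Pair B A)
  let ?c = "2 * pi * of_int r :: real" and ?D = "advance \<omega> (B, A)"
  obtain x y where x: "?D x = min_advance \<omega> p" and y: "?D y = max_advance \<omega> p"
    using min_advance(2)[of p] max_advance(2)[of p] Pair by blast
  show ?thesis
  proof
    assume "p \<in> level_set \<omega> (of_int r)"
    then have rot: "2 * pi * rotation_number \<omega> B A = ?c" by (simp add: level_set_def Pair)
    show "min_advance \<omega> p \<le> ?c \<and> ?c \<le> max_advance \<omega> p"
      using rotation_number_between[of "min_advance \<omega> p" B A "max_advance \<omega> p"]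
        min_advance(1)[of p] max_advance(1)[of p] unfolding rot Pair by blast
  next
    assume "min_advance \<omega> p \<le> ?c \<and> ?c \<le> max_advance \<omega> p"
    then have "?c \<in> {?D x..?D y}" using x y by simp
    moreover have "connected (range ?D)"
      by (intro connected_continuous_image advance_continuous connected_UNIV)
    ultimately have "?c \<in> range ?D" by (meson connected_contains_Icc rangeI subsetD)
    then show "p \<in> level_set \<omega> (of_int r)"
      using rotation_number_eqI[of B A] by (auto simp: level_set_def Pair)
  qed
qed

text \<open>Both extreme advances increase strictly with \<open>B\<close>, so a point with an equality leaves the level
set under an arbitrarily small horizontal shift.\<close>

lemma interior_level_set:
  shows "interior (level_set \<omega> (of_int r)) =
    {p. min_advance \<omega> p < 2 * pi * of_int r \<and> 2 * pi * of_int r < max_advance \<omega> p}"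
    (is "interior ?L = ?I")
proof (rule interior_unique)
  show "?I \<subseteq> ?L" using mem_level_set_iff by fastforce
  show "open ?I" unfolding Collect_conj_eq
    by (intro open_Int open_Collect_less extreme_advances_continuous continuous_intros)
  fix U assume U: "U \<subseteq> ?L" "open U"
  show "U \<subseteq> ?I"
  proof
    fix p assume p: "p \<in> U"
    obtain B A where BA: "p = (B, A)" by (cases p)
    obtain e where e: "e > 0" "ball p e \<subseteq> U" using U(2) p openE by blast
    have "(B + e / 2, A) \<in> ball p e" "(B - e / 2, A) \<in> ball p e"
      using e by (auto simp: BA dist_prod_def dist_real_def)
    then have "(B + e / 2, A) \<in> ?L" "(B - e / 2, A) \<in> ?L" using e U by blast+
    then have "min_advance \<omega> (B + e / 2, A) \<le> 2 * pi * of_int r"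
      "2 * pi * of_int r \<le> max_advance \<omega> (B - e / 2, A)"
      using mem_level_set_iff by blast+
    then show "p \<in> ?I"
      using extreme_advances_strict_mono(1)[of B "B + e / 2" A]
        extreme_advances_strict_mono(2)[of "B - e / 2" B A] e BA by auto
  qed
qed

lemma frontier_level_set:
  shows "frontier (level_set \<omega> (of_int r)) =
    {p. min_advance \<omega> p = 2 * pi * of_int r} \<union> {p. max_advance \<omega> p = 2 * pi * of_int r}"
proof -
  have "level_set \<omega> (of_int r) =
      {p. min_advance \<omega> p \<le> 2 * pi * of_int r} \<inter> {p. 2 * pi * of_int r \<le> max_advance \<omega> p}"
    using mem_level_set_iff by auto
  moreover have "closed \<dots>"
    by (intro closed_Int closed_Collect_le extreme_advances_continuous continuous_intros)
  moreover have "min_advance \<omega> p \<le> max_advance \<omega> p" for p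
    using min_advance(1)[of p 0] max_advance(1)[of p 0] by linarith
  ultimately show ?thesis
    unfolding frontier_def interior_level_set by (auto simp: closure_closed) (metis order_antisym)+
qed

lemma advance_const_iff:
  shows "(\<forall>x. advance \<omega> p x = c) \<longleftrightarrow> min_advance \<omega> p = c \<and> max_advance \<omega> p = c"
  using min_advance[of p] max_advance[of p] by (metis order_antisym)

text \<open>On a horizontal line each extreme advance takes the value \<open>2\<pi>r\<close> exactly once. These two values of
\<open>B\<close> are the boundary points of the level set on that line, and they coincide iff minimum and maximum of \<open>D\<close> agree.\<close>

lemma adjacency_point_iff:
  shows "adjacency_point \<omega> (B, A) \<longleftrightarrow> A \<noteq> 0 \<and> (\<exists>r::int. interior (level_set \<omega> (of_int r)) \<noteq> {} \<and>
     (\<forall>x. advance \<omega> (B, A) x = 2 * pi * of_int r))"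
proof
  assume "adjacency_point \<omega> (B, A)"
  then obtain r L g h where A: "A \<noteq> 0" and L: "is_phase_lock_area \<omega> (of_int r) L"
    and gh: "boundary_functions L g h" and B: "B = g A" "B = h A"
    unfolding adjacency_point_def by auto
  have L': "L = level_set \<omega> (of_int r)" "interior L \<noteq> {}" using L by (auto simp: is_phase_lock_area_def)
  obtain B1 B2 where *: "min_advance \<omega> (B1, A) = 2 * pi * of_int r"
      "max_advance \<omega> (B2, A) = 2 * pi * of_int r"
    using extreme_advances_onto by metis
  then have "(B1, A) \<in> frontier L" "(B2, A) \<in> frontier L" by (auto simp: L' frontier_level_set)
  then have "B1 = B" "B2 = B" using gh B by (auto simp: boundary_functions_def)
  then show "A \<noteq> 0 \<and> (\<exists>r::int. interior (level_set \<omega> (of_int r)) \<noteq> {} \<and>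
     (\<forall>x. advance \<omega> (B, A) x = 2 * pi * of_int r))"
    using A L' * advance_const_iff[of "(B, A)"] by blast
next
  assume "A \<noteq> 0 \<and> (\<exists>r::int. interior (level_set \<omega> (of_int r)) \<noteq> {} \<and>
     (\<forall>x. advance \<omega> (B, A) x = 2 * pi * of_int r))"
  then obtain r :: int where A: "A \<noteq> 0" and r: "interior (level_set \<omega> (of_int r)) \<noteq> {}"
    "\<forall>x. advance \<omega> (B, A) x = 2 * pi * of_int r" by blast
  obtain g where g: "\<And>A. min_advance \<omega> (g A, A) = 2 * pi * of_int r"
    using choice[of "\<lambda>A B. min_advance \<omega> (B, A) = 2 * pi * of_int r"]
      extreme_advances_onto(1) by blast
  obtain h where h: "\<And>A. max_advance \<omega> (h A, A) = 2 * pi * of_int r"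
    using choice[of "\<lambda>A B. max_advance \<omega> (B, A) = 2 * pi * of_int r"]
      extreme_advances_onto(2) by blast
  have inj: "min_advance \<omega> (b, a) = min_advance \<omega> (b', a) \<longleftrightarrow> b = b'"
    "max_advance \<omega> (b, a) = max_advance \<omega> (b', a) \<longleftrightarrow> b = b'" for a b b'
    using extreme_advances_strict_mono[of b b' a]
      extreme_advances_strict_mono[of b' b a] by (cases b b' rule: linorder_cases; simp)+
  have "min_advance \<omega> (b, a) = 2 * pi * of_int r \<longleftrightarrow> b = g a"
    "max_advance \<omega> (b, a) = 2 * pi * of_int r \<longleftrightarrow> b = h a" for a b
    using inj[of b a] g[of a] h[of a] by metis+
  then have "boundary_functions (level_set \<omega> (of_int r)) g h" and "B = g A" "B = h A"
    using r(2) advance_const_iff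
    by (auto simp: boundary_functions_def frontier_level_set)
  then show "adjacency_point \<omega> (B, A)"
    using A r(1) unfolding adjacency_point_def is_phase_lock_area_def by blast
qed

text \<open>Where the minimum of \<open>D\<close> is \<open>2\<pi>r\<close> and the maximum is larger, a small decrease of \<open>B\<close> would produce an interior
point.\<close>

lemma empty_interior_imp_advance_const:
  assumes empty: "interior (level_set \<omega> (of_int r)) = {}"
  shows "\<exists>B. \<forall>x. advance \<omega> (B, A) x = 2 * pi * of_int r"
proof -
  let ?c = "2 * pi * of_int r :: real"
  obtain B where B: "min_advance \<omega> (B, A) = ?c" using extreme_advances_onto by metis
  have "max_advance \<omega> (B, A) = ?c"
  proof (rule ccontr)
    assume "max_advance \<omega> (B, A) \<noteq> ?c"
    moreover have "(B, A) \<in> level_set \<omega> (of_int r)"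
      using B frontier_level_set[of r] mem_level_set_iff
        min_advance(1)[of "(B, A)"] max_advance(1)[of "(B, A)"] by (metis order_refl order_trans)
    ultimately have gt: "?c < max_advance \<omega> (B, A)" using mem_level_set_iff by force
    have "open {b. ?c < max_advance \<omega> (b, A)}"
      by (intro open_Collect_less continuous_on_const
          continuous_on_compose2[OF extreme_advances_continuous(2)]) (auto intro!: continuous_intros)
    then obtain e where e: "e > 0" "ball B e \<subseteq> {b. ?c < max_advance \<omega> (b, A)}"
      using gt openE by (metis mem_Collect_eq)
    then have "B - e / 2 \<in> ball B e" by (simp add: dist_real_def)
    then have "?c < max_advance \<omega> (B - e / 2, A)" using e by blast
    moreover have "min_advance \<omega> (B - e / 2, A) < ?c"
      using extreme_advances_strict_mono(1)[of "B - e / 2" B A] e B by simp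
    ultimately have "(B - e / 2, A) \<in> interior (level_set \<omega> (of_int r))"
      by (simp add: interior_level_set)
    then show False using empty by simp
  qed
  then show ?thesis using B advance_const_iff by metis
qed

end

section \<open>The linear system over the Riccati equation\<close>

lemma has_vector_derivative_exp:
  fixes f :: "real \<Rightarrow> complex"
  assumes "(f has_vector_derivative f') (at t)"
  shows "((\<lambda>t. exp (f t)) has_vector_derivative f' * exp (f t)) (at t)"
  using field_vector_diff_chain_at[OF assms DERIV_exp] by (simp add: o_def)

lemma has_vector_derivative_cis:
  assumes "(\<theta> has_real_derivative \<theta>') (at t)"
  shows "((\<lambda>t. cis (\<theta> t)) has_vector_derivative \<i> * of_real \<theta>' * cis (\<theta> t)) (at t)"
proof -
  have "((\<lambda>t. \<i> * of_real (\<theta> t)) has_vector_derivative \<i> * of_real \<theta>') (at t)"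
    by (intro has_vector_derivative_mult_right has_vector_derivative_of_real assms)
  from has_vector_derivative_exp[OF this] show ?thesis by (simp add: cis_conv_exp)
qed

lemma phase_equation_solution:
  fixes f :: "real \<Rightarrow> complex"
  assumes f: "\<And>t. (f has_vector_derivative \<i> * of_real (\<theta>' t) * f t) (at t)"
    and \<theta>: "\<And>t. (\<theta> has_real_derivative \<theta>' t) (at t)"
  shows "f t = f 0 * cis (\<theta> t - \<theta> 0)"
proof -
  have "((\<lambda>t. f t * cis (- \<theta> t)) has_vector_derivative 0) (at t within UNIV)" for t
  proof -
    have "((\<lambda>t. - \<theta> t) has_real_derivative - \<theta>' t) (at t)" by (intro derivative_intros \<theta>)
    from has_vector_derivative_mult[OF f has_vector_derivative_cis[OF this]]
    show ?thesis by (simp add: algebra_simps)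
  qed
  then obtain c where c: "\<And>t. f t * cis (- \<theta> t) = c"
    using has_vector_derivative_zero_constant[of UNIV "\<lambda>t. f t * cis (- \<theta> t)"] by auto
  have f_eq: "f t = c * cis (\<theta> t)" for t
    unfolding c[of t, symmetric] by (simp add: cis_mult mult.assoc)
  have "c = f 0 * cis (- \<theta> 0)" by (simp only: c)
  then show ?thesis unfolding f_eq[of t] by (simp add: cis_mult mult.assoc)
qed

text \<open>The quotient \<open>v / u\<close> satisfies the Riccati equation of \<open>exp (i \<phi>)\<close>; here \<open>q = B / \<omega>\<close> and \<open>2 \<mu> = A / \<omega>\<close>.\<close>

definition linear_solution ::
  "real \<Rightarrow> real \<Rightarrow> real \<Rightarrow> (real \<Rightarrow> complex) \<Rightarrow> (real \<Rightarrow> complex) \<Rightarrow> bool" where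
  "linear_solution \<omega> q \<mu> u v \<longleftrightarrow> (\<forall>t.
     (u has_vector_derivative v t / of_real (2 * \<omega>)) (at t) \<and>
     (v has_vector_derivative
        \<i> * of_real (q + 2 * \<mu> * cos t) * v t + u t / of_real (2 * \<omega>)) (at t))"

text \<open>The exponential of the integral of the trace of the linear system, i.e. its normalized Wronskian.\<close>

definition trace_phase :: "real \<Rightarrow> real \<Rightarrow> real \<Rightarrow> complex" where
  "trace_phase q \<mu> t = cis (q * t + 2 * \<mu> * sin t)"

lemma trace_phase_deriv:
  "(trace_phase q \<mu> has_vector_derivative \<i> * of_real (q + 2 * \<mu> * cos t) * trace_phase q \<mu> t) (at t)"
  unfolding trace_phase_def by (rule has_vector_derivative_cis) (auto intro!: derivative_eq_intros)

lemma linear_solution_deriv: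
  assumes "linear_solution \<omega> q \<mu> u v"
  shows "(u has_vector_derivative v t / of_real (2 * \<omega>)) (at t)"
    "(v has_vector_derivative \<i> * of_real (q + 2 * \<mu> * cos t) * v t + u t / of_real (2 * \<omega>)) (at t)"
  using assms by (auto simp: linear_solution_def)

definition floquet_solution ::
  "real \<Rightarrow> real \<Rightarrow> real \<Rightarrow> complex \<Rightarrow> (real \<Rightarrow> complex) \<Rightarrow> (real \<Rightarrow> complex) \<Rightarrow> bool" where
  "floquet_solution \<omega> q \<mu> c u v \<longleftrightarrow>
     linear_solution \<omega> q \<mu> u v \<and> u (2 * pi) = c * u 0 \<and> v (2 * pi) = c * v 0"

lemma linear_solution_combination:
  assumes "linear_solution \<omega> q \<mu> u1 v1" "linear_solution \<omega> q \<mu> u2 v2"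
  shows "linear_solution \<omega> q \<mu> (\<lambda>t. \<alpha> * u1 t + \<beta> * u2 t) (\<lambda>t. \<alpha> * v1 t + \<beta> * v2 t)"
  unfolding linear_solution_def
proof (intro allI conjI)
  fix t
  note d = linear_solution_deriv[OF assms(1), of t] linear_solution_deriv[OF assms(2), of t]
  note deriv = has_vector_derivative_add[OF has_vector_derivative_mult_right has_vector_derivative_mult_right]
  show "((\<lambda>t. \<alpha> * u1 t + \<beta> * u2 t) has_vector_derivative
      (\<alpha> * v1 t + \<beta> * v2 t) / of_real (2 * \<omega>)) (at t)"
    using deriv[OF d(1,3)] by (rule has_vector_derivative_eq_rhs) (simp add: add_divide_distrib)
  show "((\<lambda>t. \<alpha> * v1 t + \<beta> * v2 t) has_vector_derivative
      \<i> * of_real (q + 2 * \<mu> * cos t) * (\<alpha> * v1 t + \<beta> * v2 t) +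
      (\<alpha> * u1 t + \<beta> * u2 t) / of_real (2 * \<omega>)) (at t)"
    using deriv[OF d(2,4)] by (rule has_vector_derivative_eq_rhs) (simp add: add_divide_distrib algebra_simps)
qed

lemma floquet_solution_combination:
  assumes "floquet_solution \<omega> q \<mu> c u1 v1" "floquet_solution \<omega> q \<mu> c u2 v2"
  shows "floquet_solution \<omega> q \<mu> c (\<lambda>t. \<alpha> * u1 t + \<beta> * u2 t) (\<lambda>t. \<alpha> * v1 t + \<beta> * v2 t)"
  using assms by (auto simp: floquet_solution_def linear_solution_combination algebra_simps)

lemma linear_solution_wronskian:
  assumes "linear_solution \<omega> q \<mu> u1 v1" "linear_solution \<omega> q \<mu> u2 v2"
  shows "u1 t * v2 t - u2 t * v1 t = (u1 0 * v2 0 - u2 0 * v1 0) * trace_phase q \<mu> t"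
proof -
  let ?W = "\<lambda>t. u1 t * v2 t - u2 t * v1 t"
  have "?W t = ?W 0 * cis ((q * t + 2 * \<mu> * sin t) - (q * 0 + 2 * \<mu> * sin 0))"
  proof (rule phase_equation_solution)
    fix t
    note d1 = linear_solution_deriv[OF assms(1), of t] and d2 = linear_solution_deriv[OF assms(2), of t]
    show "(?W has_vector_derivative \<i> * of_real (q + 2 * \<mu> * cos t) * ?W t) (at t)"
      using has_vector_derivative_diff[OF has_vector_derivative_mult[OF d1(1) d2(2)]
          has_vector_derivative_mult[OF d2(1) d1(2)]]
      by (rule has_vector_derivative_eq_rhs) (simp add: algebra_simps)
    show "((\<lambda>t. q * t + 2 * \<mu> * sin t) has_real_derivative q + 2 * \<mu> * cos t) (at t)"
      by (auto intro!: derivative_eq_intros)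
  qed
  then show ?thesis by (simp add: trace_phase_def)
qed

lemma linear_solution_unique:
  assumes \<omega>: "\<omega> > 0" and sol: "linear_solution \<omega> q \<mu> u v" and zero: "u 0 = 0" "v 0 = 0" and t: "t \<ge> 0"
  shows "u t = 0 \<and> v t = 0"
proof -
  let ?N = "\<lambda>t. u t \<bullet> u t + v t \<bullet> v t"
  have inner_deriv: "((\<lambda>t. f t \<bullet> f t) has_real_derivative 2 * (f t \<bullet> f')) (at t)"
    if "(f has_vector_derivative f') (at t)" for f :: "real \<Rightarrow> complex" and f' t
  proof -
    have "(f has_derivative (\<lambda>h. h *\<^sub>R f')) (at t)" using that by (simp add: has_vector_derivative_def)
    from has_derivative_inner[OF this this] show ?thesis
      by (rule has_derivative_imp_has_field_derivative) (simp add: inner_commute)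
  qed
  have "\<bar>?N t\<bar> \<le> (\<bar>?N 0\<bar> + 0 * t) * exp (1 / \<omega> * t)"
  proof (rule gronwall_bound[where d' = "\<lambda>s. 2 * (u s \<bullet> v s) / \<omega>"])
    fix s :: real
    have orth: "z \<bullet> (\<i> * of_real a * z) = 0" for z :: complex and a :: real
      by (simp add: inner_complex_def)
    have scale: "z \<bullet> (w / of_real (2 * \<omega>)) = (z \<bullet> w) / (2 * \<omega>)" for z w :: complex
      using \<omega> by (simp add: inner_complex_def add_divide_distrib)
    show "(?N has_real_derivative 2 * (u s \<bullet> v s) / \<omega>) (at s)"
      using DERIV_add[OF inner_deriv[OF linear_solution_deriv(1)[OF sol]] inner_deriv[OF linear_solution_deriv(2)[OF sol]], of s]
      by (rule DERIV_cong) (simp add: orth scale inner_add_right inner_commute[of "v s" "u s"] del: of_real_add of_real_mult)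
    have "\<bar>2 * (u s \<bullet> v s)\<bar> \<le> ?N s"
      using inner_ge_zero[of "u s - v s"] inner_ge_zero[of "u s + v s"]
      by (auto simp: inner_add_left inner_add_right inner_diff_left inner_diff_right inner_commute[of "v s" "u s"] abs_le_iff)
    then have "\<bar>2 * (u s \<bullet> v s)\<bar> \<le> \<bar>?N s\<bar>" by linarith
    then show "\<bar>2 * (u s \<bullet> v s) / \<omega>\<bar> \<le> 1 / \<omega> * \<bar>?N s\<bar> + 0"
      using \<omega> by (simp add: divide_right_mono)
  qed (use \<omega> t in auto)
  then have "?N t \<le> 0" by (simp add: zero)
  then have "u t \<bullet> u t = 0" "v t \<bullet> v t = 0" using inner_ge_zero[of "u t"] inner_ge_zero[of "v t"] by linarith+
  then show ?thesis by simp
qed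

text \<open>The symmetry \<open>\<Phi> \<mapsto> 1 / cnj \<Phi>\<close> of the Riccati equation, which fixes the unit circle; the factor
\<open>trace_phase\<close> corrects the sign of the imaginary coefficient after conjugation.\<close>

lemma linear_solution_involution:
  assumes "linear_solution \<omega> q \<mu> u v"
  shows "linear_solution \<omega> q \<mu> (\<lambda>t. trace_phase q \<mu> t * cnj (v t)) (\<lambda>t. trace_phase q \<mu> t * cnj (u t))"
  unfolding linear_solution_def
proof (intro allI conjI)
  fix t
  note d = linear_solution_deriv[OF assms, of t] and g = trace_phase_deriv[of q \<mu> t]
  show "((\<lambda>t. trace_phase q \<mu> t * cnj (v t)) has_vector_derivative
      trace_phase q \<mu> t * cnj (u t) / of_real (2 * \<omega>)) (at t)"
    using has_vector_derivative_mult[OF g has_vector_derivative_cnj[OF d(2)]]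
    by (rule has_vector_derivative_eq_rhs) (simp add: algebra_simps)
  show "((\<lambda>t. trace_phase q \<mu> t * cnj (u t)) has_vector_derivative
      \<i> * of_real (q + 2 * \<mu> * cos t) * (trace_phase q \<mu> t * cnj (u t)) +
      trace_phase q \<mu> t * cnj (v t) / of_real (2 * \<omega>)) (at t)"
    using has_vector_derivative_mult[OF g has_vector_derivative_cnj[OF d(1)]]
    by (rule has_vector_derivative_eq_rhs) (simp add: algebra_simps)
qed

text \<open>With \<open>v = exp (i \<phi>) u\<close> prescribed, the first equation becomes a scalar linear equation, solved by
\<open>u = exp (\<integral> exp (i \<phi>) / (2\<omega>))\<close>; the second one is then the equation for \<open>\<phi>\<close>.\<close>

lemma linear_solution_over_lifted_solution:
  assumes \<omega>: "\<omega> > 0" and sol: "lifted_solution \<omega> B A \<phi>"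
  shows "\<exists>u. u 0 = 1 \<and> (\<forall>t. u t \<noteq> 0) \<and>
    linear_solution \<omega> (B / \<omega>) (A / (2 * \<omega>)) u (\<lambda>t. cis (\<phi> t) * u t)"
proof -
  have cont: "continuous_on UNIV \<phi>"
    using sol by (meson DERIV_isCont continuous_at_imp_continuous_on lifted_solution_deriv)
  obtain G1 where G1: "G1 0 = 0" "\<And>t. (G1 has_real_derivative cos (\<phi> t)) (at t)"
    using global_antiderivative_exists[of "\<lambda>t. cos (\<phi> t)"] cont by (auto intro!: continuous_intros)
  obtain G2 where G2: "G2 0 = 0" "\<And>t. (G2 has_real_derivative sin (\<phi> t)) (at t)"
    using global_antiderivative_exists[of "\<lambda>t. sin (\<phi> t)"] cont by (auto intro!: continuous_intros)
  define E where "E t = (of_real (G1 t) + \<i> * of_real (G2 t)) / of_real (2 * \<omega>)" for t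
  have "(E has_vector_derivative (of_real (cos (\<phi> t)) + \<i> * of_real (sin (\<phi> t))) / of_real (2 * \<omega>)) (at t)" for t
    unfolding E_def
    by (intro has_vector_derivative_divide has_vector_derivative_add has_vector_derivative_mult_right
        has_vector_derivative_of_real G1 G2)
  then have E: "(E has_vector_derivative cis (\<phi> t) / of_real (2 * \<omega>)) (at t)" for t
    by (simp add: cis_conv_exp exp_Euler cos_of_real sin_of_real)
  define u where "u t = exp (E t)" for t
  have u: "(u has_vector_derivative cis (\<phi> t) * u t / of_real (2 * \<omega>)) (at t)" for t
    unfolding u_def using has_vector_derivative_exp[OF E] by simp
  have "((\<lambda>t. cis (\<phi> t) * u t) has_vector_derivative
      \<i> * of_real (B / \<omega> + 2 * (A / (2 * \<omega>)) * cos t) * (cis (\<phi> t) * u t) + u t / of_real (2 * \<omega>)) (at t)" for t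
  proof (rule has_vector_derivative_eq_rhs)
    show "((\<lambda>t. cis (\<phi> t) * u t) has_vector_derivative
        cis (\<phi> t) * (cis (\<phi> t) * u t / of_real (2 * \<omega>)) +
        \<i> * of_real (torus_field \<omega> B A t (\<phi> t)) * cis (\<phi> t) * u t) (at t)"
      by (intro has_vector_derivative_mult has_vector_derivative_cis lifted_solution_deriv[OF sol] u)
    \<comment> \<open>Here \<open>- sin \<phi>\<close> becomes the quadratic term of the Riccati equation.\<close>
    have sq: "\<i> * of_real (sin (\<phi> t)) * cis (\<phi> t) = (cis (\<phi> t) * cis (\<phi> t) - 1) / 2"
    proof -
      have "cis (- \<phi> t) * cis (\<phi> t) = 1" by (simp add: cis_mult)
      moreover have "\<i> * of_real (sin (\<phi> t)) * cis (\<phi> t) = (cis (\<phi> t) - cis (- \<phi> t)) / 2 * cis (\<phi> t)"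
        by (rule arg_cong[where f = "\<lambda>z. z * cis (\<phi> t)"]) (simp add: complex_eq_iff)
      ultimately show ?thesis by (simp add: diff_divide_distrib left_diff_distrib)
    qed
    have "\<i> * of_real (torus_field \<omega> B A t (\<phi> t)) * cis (\<phi> t) =
        - (\<i> * of_real (sin (\<phi> t)) * cis (\<phi> t)) / of_real \<omega> +
        \<i> * of_real (B / \<omega> + A / \<omega> * cos t) * cis (\<phi> t)"
      by (simp add: torus_field_def algebra_simps)
    also have "\<dots> = - ((cis (\<phi> t) * cis (\<phi> t) - 1) / of_real (2 * \<omega>)) +
        \<i> * of_real (B / \<omega> + A / \<omega> * cos t) * cis (\<phi> t)"
      unfolding sq by simp
    finally have *: "\<i> * of_real (torus_field \<omega> B A t (\<phi> t)) * cis (\<phi> t) = \<dots>" .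
    show "cis (\<phi> t) * (cis (\<phi> t) * u t / of_real (2 * \<omega>)) +
        \<i> * of_real (torus_field \<omega> B A t (\<phi> t)) * cis (\<phi> t) * u t =
        \<i> * of_real (B / \<omega> + 2 * (A / (2 * \<omega>)) * cos t) * (cis (\<phi> t) * u t) + u t / of_real (2 * \<omega>)"
      unfolding * by (simp add: algebra_simps diff_divide_distrib)
  qed
  then have "linear_solution \<omega> (B / \<omega>) (A / (2 * \<omega>)) u (\<lambda>t. cis (\<phi> t) * u t)"
    unfolding linear_solution_def using u by blast
  moreover have "u 0 = 1" by (simp add: u_def E_def G1 G2)
  moreover have "u t \<noteq> 0" for t by (simp add: u_def)
  ultimately show ?thesis by blast
qed

text \<open>If all solutions \<open>\<phi>\<close> close up modulo \<open>2\<pi>\<close>, each solution \<open>(u, v)\<close> over one of them is multiplied by some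
factor after one period. The Wronskian shows that the factors of any two of three pairwise independent solutions
have the same product, so the three factors are equal.\<close>

lemma advance_const_imp_common_multiplier:
  assumes \<omega>: "\<omega> > 0" and D: "\<And>x. advance \<omega> (B, A) x = 2 * pi * of_int r"
  shows "\<exists>c u1 v1 u2 v2. c * c = cis (2 * pi * (B / \<omega>)) \<and>
    floquet_solution \<omega> (B / \<omega>) (A / (2 * \<omega>)) c u1 v1 \<and>
    floquet_solution \<omega> (B / \<omega>) (A / (2 * \<omega>)) c u2 v2 \<and>
    u1 0 * v2 0 \<noteq> u2 0 * v1 0"
proof -
  let ?lin = "linear_solution \<omega> (B / \<omega>) (A / (2 * \<omega>))"
  have ex: "\<exists>u v. ?lin u v \<and> u 0 = 1 \<and> v 0 = cis x \<and> v (2 * pi) = cis x * u (2 * pi)" for x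
  proof -
    let ?\<phi> = "solution_from \<omega> B A x"
    note sol = solution_from[OF \<omega>, of B A x]
    obtain u where u: "u 0 = 1" "?lin u (\<lambda>t. cis (?\<phi> t) * u t)"
      using linear_solution_over_lifted_solution[OF \<omega> sol(2)] by blast
    have "?\<phi> (2 * pi) = x + 2 * pi * of_int r" using D[of x] by (simp add: advance_def)
    then have "cis (?\<phi> (2 * pi)) = cis x" by (simp flip: cis_mult add: cis_multiple_2pi)
    then show ?thesis using u sol(1) by (intro exI[of _ u] exI[of _ "\<lambda>t. cis (?\<phi> t) * u t"]) simp
  qed
  have prod: "u (2 * pi) * u' (2 * pi) = cis (2 * pi * (B / \<omega>))"
    if "?lin u v" "u 0 = 1" "v 0 = cis x" "v (2 * pi) = cis x * u (2 * pi)"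
      "?lin u' v'" "u' 0 = 1" "v' 0 = cis x'" "v' (2 * pi) = cis x' * u' (2 * pi)" "cis x \<noteq> cis x'"
    for u v u' v' x x'
  proof -
    have "u (2 * pi) * u' (2 * pi) * (cis x' - cis x) = (cis x' - cis x) * cis (2 * pi * (B / \<omega>))"
      using linear_solution_wronskian[OF that(1) that(5), of "2 * pi"] that
      by (simp add: trace_phase_def algebra_simps)
    then show ?thesis using that(9) by (simp add: mult.commute)
  qed
  \<comment> \<open>Any three distinct points of the circle would do as initial values of \<open>v / u\<close>.\<close>
  obtain u1 v1 where 1: "?lin u1 v1" "u1 0 = 1" "v1 0 = cis 0" "v1 (2 * pi) = cis 0 * u1 (2 * pi)"
    using ex by blast
  obtain u2 v2 where 2: "?lin u2 v2" "u2 0 = 1" "v2 0 = cis (pi / 2)" "v2 (2 * pi) = cis (pi / 2) * u2 (2 * pi)"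
    using ex by blast
  obtain u3 v3 where 3: "?lin u3 v3" "u3 0 = 1" "v3 0 = cis pi" "v3 (2 * pi) = cis pi * u3 (2 * pi)"
    using ex by blast
  have ne: "cis 0 \<noteq> cis (pi / 2)" "cis 0 \<noteq> cis pi" "cis (pi / 2) \<noteq> cis pi"
    by (simp_all add: complex_eq_iff)
  have eqs: "u1 (2 * pi) * u2 (2 * pi) = cis (2 * pi * (B / \<omega>))" "u1 (2 * pi) * u3 (2 * pi) = cis (2 * pi * (B / \<omega>))"
    "u2 (2 * pi) * u3 (2 * pi) = cis (2 * pi * (B / \<omega>))"
    using prod[OF 1 2 ne(1)] prod[OF 1 3 ne(2)] prod[OF 2 3 ne(3)] .
  have "u3 (2 * pi) \<noteq> 0" using eqs(3) by auto
  moreover have "u1 (2 * pi) * u3 (2 * pi) = u2 (2 * pi) * u3 (2 * pi)" using eqs by simp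
  ultimately have c: "u1 (2 * pi) = u2 (2 * pi)" by simp
  show ?thesis
    using 1 2 ne(1) eqs(1) c
    by (intro exI[of _ "u1 (2 * pi)"] exI[of _ u1] exI[of _ v1] exI[of _ u2] exI[of _ v2])
      (auto simp: floquet_solution_def mult.commute)
qed

text \<open>The two solutions span the system, so every solution is \<open>2\<pi>\<close>-periodic and every \<open>D x\<close> is a multiple of \<open>2\<pi>\<close>; a
continuous function with discrete values is constant.\<close>

lemma periodic_pair_imp_advance_const:
  assumes \<omega>: "\<omega> > 0"
    and 1: "floquet_solution \<omega> (B / \<omega>) (A / (2 * \<omega>)) 1 u1 v1"
    and 2: "floquet_solution \<omega> (B / \<omega>) (A / (2 * \<omega>)) 1 u2 v2"
    and indep: "u1 0 * v2 0 \<noteq> u2 0 * v1 0"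
  shows "\<exists>r::int. \<forall>x. advance \<omega> (B, A) x = 2 * pi * of_int r"
proof -
  let ?lin = "linear_solution \<omega> (B / \<omega>) (A / (2 * \<omega>))" and ?D = "advance \<omega> (B, A)"
  have lin: "?lin u1 v1" "?lin u2 v2" using 1 2 by (simp_all add: floquet_solution_def)
  have int: "\<exists>r::int. ?D x = 2 * pi * of_int r" for x
  proof -
    let ?\<phi> = "solution_from \<omega> B A x"
    note sol = solution_from[OF \<omega>, of B A x]
    obtain u where u: "u 0 = 1" "u (2 * pi) \<noteq> 0" "?lin u (\<lambda>t. cis (?\<phi> t) * u t)"
      using linear_solution_over_lifted_solution[OF \<omega> sol(2)] by blast
    define d where "d = u1 0 * v2 0 - u2 0 * v1 0"
    have d: "d \<noteq> 0" using indep by (simp add: d_def)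
    \<comment> \<open>Cramer's rule for the initial value \<open>(1, cis x)\<close>.\<close>
    define \<alpha> \<beta> where "\<alpha> = (v2 0 - u2 0 * cis x) / d" and "\<beta> = (u1 0 * cis x - v1 0) / d"
    have start: "\<alpha> * u1 0 + \<beta> * u2 0 = 1" "\<alpha> * v1 0 + \<beta> * v2 0 = cis x"
    proof -
      have "(\<alpha> * u1 0 + \<beta> * u2 0) * d = d" "(\<alpha> * v1 0 + \<beta> * v2 0) * d = cis x * d"
        using d unfolding \<alpha>_def \<beta>_def by (simp_all add: distrib_right) (simp_all add: d_def algebra_simps)
      then show "\<alpha> * u1 0 + \<beta> * u2 0 = 1" "\<alpha> * v1 0 + \<beta> * v2 0 = cis x" using d by simp_all
    qed
    note diff = linear_solution_combination[OF linear_solution_combination[OF lin, of \<alpha> \<beta>] u(3), of 1 "- 1"]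
    have "1 * (\<alpha> * u1 (2 * pi) + \<beta> * u2 (2 * pi)) + - 1 * u (2 * pi) = 0 \<and>
        1 * (\<alpha> * v1 (2 * pi) + \<beta> * v2 (2 * pi)) + - 1 * (cis (?\<phi> (2 * pi)) * u (2 * pi)) = 0"
      by (rule linear_solution_unique[OF \<omega> diff]) (use start sol(1) u(1) in simp_all)
    then have "cis (?\<phi> (2 * pi)) = cis x" using start 1 2 by (simp add: floquet_solution_def)
    then have "cis (?D x) = 1" by (simp add: advance_def flip: cis_divide)
    then have "sin (?D x) = 0" "cos (?D x) = 1" by (simp_all add: complex_eq_iff)
    then show ?thesis using cos_one_2pi_int[of "?D x"] by (auto simp: mult_ac)
  qed
  have "?D constant_on UNIV"
  proof (rule continuous_discrete_range_constant[OF connected_UNIV advance_continuous[OF \<omega>]])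
    fix x
    have "2 * pi \<le> norm (?D y - ?D x)" if ne: "?D y \<noteq> ?D x" for y
    proof -
      obtain r s :: int where rs: "?D x = 2 * pi * of_int r" "?D y = 2 * pi * of_int s" using int by metis
      then have "s \<noteq> r" using ne by auto
      then have "1 \<le> \<bar>real_of_int (s - r)\<bar>" by linarith
      then have "2 * pi * 1 \<le> 2 * pi * \<bar>real_of_int (s - r)\<bar>" by (intro mult_left_mono) auto
      also have "\<dots> = norm (?D y - ?D x)" by (simp add: rs abs_mult flip: right_diff_distrib)
      finally show ?thesis by simp
    qed
    then show "\<exists>e>0. \<forall>y. y \<in> UNIV \<and> ?D y \<noteq> ?D x \<longrightarrow> e \<le> norm (?D y - ?D x)"
      by (intro exI[of _ "2 * pi"]) auto
  qed
  then show ?thesis using int[of 0] unfolding constant_on_def by (metis UNIV_I)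
qed

section \<open>Fourier coefficients with a multiplier\<close>

text \<open>Multiplying by the restriction of a linear function to the circle only shifts the index \<open>n\<close> by one in
both directions, so the property of having no moments is stable under multiplication by polynomials. Quantifying
over \<open>h\<close> makes the induction step for products immediate.\<close>

lemma trig_polynomial_annihilates:
  fixes p :: "complex \<Rightarrow> real" and h :: "real \<Rightarrow> complex"
  assumes "real_polynomial_function p" "continuous_on {0..2 * pi} h"
    and "\<And>n::int. integral {0..2 * pi} (\<lambda>t. h t * cis (of_int n * t)) = 0"
  shows "integral {0..2 * pi} (\<lambda>t. of_real (p (cis t)) * h t * cis (of_int n * t)) = 0"
  using assms
proof (induction p arbitrary: h n rule: real_polynomial_function.induct)
  case (linear f)
  let ?\<alpha> = "(of_real (f 1) - \<i> * of_real (f \<i>)) / 2" and ?\<beta> = "(of_real (f 1) + \<i> * of_real (f \<i>)) / 2"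
  have f: "of_real (f (cis t)) = ?\<alpha> * cis t + ?\<beta> * cis (- t)" for t
  proof -
    have "cis t = cos t *\<^sub>R 1 + sin t *\<^sub>R \<i>" by (simp add: complex_eq_iff)
    then have "f (cis t) = f (cos t *\<^sub>R 1) + f (sin t *\<^sub>R \<i>)"
      by (simp only: linear_add[OF bounded_linear.linear[OF linear(1)]])
    also have "\<dots> = cos t * f 1 + sin t * f \<i>"
      by (simp only: linear_cmul[OF bounded_linear.linear[OF linear(1)]] real_scaleR_def)
    finally have "f (cis t) = cos t * f 1 + sin t * f \<i>" .
    then show ?thesis by (simp add: complex_eq_iff field_simps)
  qed
  have "of_real (f (cis t)) * h t * cis (of_int n * t) =
      ?\<alpha> * (h t * cis (of_int (n + 1) * t)) + ?\<beta> * (h t * cis (of_int (n - 1) * t))" for t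
  proof -
    have "cis (of_int (n + 1) * t) = cis t * cis (of_int n * t)"
      "cis (of_int (n - 1) * t) = cis (- t) * cis (of_int n * t)"
      by (simp_all add: cis_mult algebra_simps)
    then show ?thesis unfolding f by (simp only: ring_distribs mult_ac)
  qed
  moreover have "(\<lambda>t. c * (h t * cis (of_int m * t))) integrable_on {0..2 * pi}" for m :: int and c
    by (intro integrable_continuous_real continuous_intros linear(2))
  ultimately show ?case
    by (simp add: Henstock_Kurzweil_Integration.integral_add linear(3) del: of_int_add of_int_diff)
next
  case (const c)
  then show ?case by (simp add: mult.assoc)
next
  case (add f g)
  have int: "(\<lambda>t. of_real (p (cis t)) * h t * cis (of_int n * t)) integrable_on {0..2 * pi}"
    if "real_polynomial_function p" for p
    by (intro integrable_continuous_real continuous_intros add.prems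
        continuous_on_compose2[OF continuous_on_polymonial_function[OF that[unfolded real_polynomial_function_eq], of UNIV]]) auto
  have "integral {0..2 * pi} (\<lambda>t. of_real (f (cis t) + g (cis t)) * h t * cis (of_int n * t)) =
      integral {0..2 * pi} (\<lambda>t. of_real (f (cis t)) * h t * cis (of_int n * t)) +
      integral {0..2 * pi} (\<lambda>t. of_real (g (cis t)) * h t * cis (of_int n * t))"
    using int[OF add.hyps(1)] int[OF add.hyps(2)]
    by (simp add: distrib_right Henstock_Kurzweil_Integration.integral_add)
  then show ?case using add.IH add.prems by simp
next
  case (mult f g)
  have "continuous_on {0..2 * pi} (\<lambda>t. of_real (g (cis t)) * h t)"
    by (intro continuous_intros mult.prems
        continuous_on_compose2[OF continuous_on_polymonial_function[OF mult.hyps(2)[unfolded real_polynomial_function_eq], of UNIV]]) auto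
  from mult.IH(1)[OF this mult.IH(2)[OF mult.prems], of n]
  show ?case by (simp add: mult.assoc)
qed

text \<open>The circle is a compact quotient of the interval.\<close>

lemma continuous_function_on_circle:
  fixes h :: "real \<Rightarrow> 'a::topological_space"
  assumes cont: "continuous_on {0..2 * pi} h" and per: "h (2 * pi) = h 0"
  shows "\<exists>H. continuous_on (sphere 0 1) H \<and> (\<forall>t\<in>{0..2 * pi}. H (cis t) = h t)"
proof -
  define T where "T z = (SOME t. t \<in> {0..2 * pi} \<and> cis t = z)" for z
  have onto: "\<exists>t. t \<in> {0..2 * pi} \<and> cis t = z" if "z \<in> sphere 0 1" for z
  proof -
    have "cis (Arg2pi z) = z" using that Arg2pi_eq[of z] by (simp add: cis_conv_exp)
    then show ?thesis using Arg2pi[of z] by (intro exI[of _ "Arg2pi z"]) auto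
  qed
  have T: "T z \<in> {0..2 * pi}" "cis (T z) = z" if "z \<in> sphere 0 1" for z
    using someI_ex[OF onto[OF that]] unfolding T_def by blast+
  have hT: "h (T (cis t)) = h t" if t: "t \<in> {0..2 * pi}" for t
  proof -
    let ?s = "T (cis t)"
    have s: "?s \<in> {0..2 * pi}" "cis ?s = cis t" using T[of "cis t"] by simp_all
    then have "cis (?s - t) = 1" by (simp flip: cis_divide)
    then have "cos (?s - t) = 1" by (simp add: complex_eq_iff)
    then obtain k :: int where k: "?s - t = of_int k * 2 * pi" using cos_one_2pi_int by blast
    have "\<bar>?s - t\<bar> \<le> 1 * (2 * pi)" using s(1) t by auto
    moreover have "\<bar>?s - t\<bar> = \<bar>real_of_int k\<bar> * (2 * pi)" unfolding k by (simp add: abs_mult)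
    ultimately have "\<bar>real_of_int k\<bar> \<le> 1"
      using mult_right_le_imp_le[of "\<bar>real_of_int k\<bar>" "2 * pi" 1] by simp
    then have "k = 0 \<or> k = 1 \<or> k = -1" by linarith
    then consider "?s = t" | "?s = 2 * pi" "t = 0" | "?s = 0" "t = 2 * pi"
    proof cases
      assume "k = 0 \<or> k = 1 \<or> k = -1" "k = 0"
      then show thesis using k that(1) by simp
    next
      assume *: "k = 0 \<or> k = 1 \<or> k = -1" "k \<noteq> 0"
      show thesis
      proof (cases "k = 1")
        case True
        then have "?s = 2 * pi \<and> t = 0" using k s(1) t by auto
        then show thesis using that(2) by blast
      next
        case False
        then have "?s = 0 \<and> t = 2 * pi" using * k s(1) t by auto
        then show thesis using that(3) by blast
      qed
    qed
    then show ?thesis by cases (simp_all add: per)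
  qed
  have "continuous_on (sphere 0 1) (\<lambda>z. h (T z))"
    unfolding continuous_on_closed_vimage[OF closed_sphere]
  proof (intro allI impI)
    fix B :: "'a set" assume B: "closed B"
    have "(\<lambda>z. h (T z)) -` B \<inter> sphere 0 1 = cis ` ({0..2 * pi} \<inter> h -` B)"
    proof (intro equalityI subsetI)
      fix z assume "z \<in> (\<lambda>z. h (T z)) -` B \<inter> sphere 0 1"
      then show "z \<in> cis ` ({0..2 * pi} \<inter> h -` B)" using T[of z] by (intro image_eqI[of _ _ "T z"]) auto
    qed (auto simp: hT)
    moreover have "compact (cis ` ({0..2 * pi} \<inter> h -` B))"
    proof (intro compact_continuous_image continuous_intros)
      have "closed ({0..2 * pi} \<inter> h -` B)" by (intro continuous_closed_preimage cont B) auto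
      then show "compact ({0..2 * pi} \<inter> h -` B)"
        using compact_Int_closed[OF compact_Icc[of 0 "2 * pi"]] by (metis inf.left_idem)
    qed
    ultimately show "closed ((\<lambda>z. h (T z)) -` B \<inter> sphere 0 1)" by (simp add: compact_imp_closed)
  qed
  then show ?thesis using hT by blast
qed

lemma continuous_on_period_bounded:
  fixes f :: "real \<Rightarrow> complex"
  assumes "continuous_on {0..2 * pi} f"
  shows "\<exists>C>0. \<forall>t\<in>{0..2 * pi}. norm (f t) \<le> C"
proof -
  have "bounded (f ` {0..2 * pi})" by (intro compact_imp_bounded compact_continuous_image assms) auto
  then show ?thesis unfolding bounded_pos by auto
qed

text \<open>By the Stone--Weierstrass theorem on the circle, \<open>h\<close> is orthogonal to every continuous periodic function, in
particular to its own real and imaginary parts.\<close>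

lemma vanishing_moments_imp_zero:
  fixes h :: "real \<Rightarrow> complex"
  assumes cont: "continuous_on {0..2 * pi} h" and per: "h (2 * pi) = h 0"
    and zero: "\<And>n::int. integral {0..2 * pi} (\<lambda>t. h t * cis (of_int n * t)) = 0"
    and t: "t \<in> {0..2 * pi}"
  shows "h t = 0"
proof -
  have annih: "integral {0..2 * pi} (\<lambda>t. of_real (g t) * h t) = 0"
    if g: "continuous_on {0..2 * pi} g" "g (2 * pi) = g 0" for g :: "real \<Rightarrow> real"
  proof -
    obtain G where G: "continuous_on (sphere 0 1) G" "\<And>t. t \<in> {0..2 * pi} \<Longrightarrow> G (cis t) = g t"
      using continuous_function_on_circle[OF g] by blast
    obtain C where C: "C > 0" "\<And>t. t \<in> {0..2 * pi} \<Longrightarrow> norm (h t) \<le> C"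
      using continuous_on_period_bounded[OF cont] by blast
    let ?I = "integral {0..2 * pi} (\<lambda>t. of_real (g t) * h t)"
    have "norm ?I \<le> e * (C * (2 * pi))" if e: "e > 0" for e
    proof -
      obtain p where p: "real_polynomial_function p" "\<And>z. z \<in> sphere 0 1 \<Longrightarrow> \<bar>G z - p z\<bar> < e"
        using Stone_Weierstrass_real_polynomial_function[OF compact_sphere G(1) e] by blast
      have contp: "continuous_on {0..2 * pi} (\<lambda>t. p (cis t))"
        by (intro continuous_on_compose2[OF continuous_on_polymonial_function[OF p(1)[unfolded real_polynomial_function_eq], of UNIV]]
            continuous_intros) auto
      have "integral {0..2 * pi} (\<lambda>t. of_real (p (cis t)) * h t) = 0"
        using trig_polynomial_annihilates[OF p(1) cont zero, of 0] by simp
      then have "?I = integral {0..2 * pi} (\<lambda>t. of_real (g t) * h t) - integral {0..2 * pi} (\<lambda>t. of_real (p (cis t)) * h t)"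
        by simp
      also have "\<dots> = integral {0..2 * pi} (\<lambda>t. of_real (g t) * h t - of_real (p (cis t)) * h t)"
        by (intro Henstock_Kurzweil_Integration.integral_diff[symmetric] integrable_continuous_real
            continuous_intros g cont contp)
      also have "norm \<dots> \<le> (e * C) * (2 * pi - 0)"
      proof (rule integral_bound)
        fix t assume t: "t \<in> {0..2 * pi}"
        have "norm (of_real (g t) * h t - of_real (p (cis t)) * h t) = \<bar>g t - p (cis t)\<bar> * norm (h t)"
          by (metis left_diff_distrib norm_mult norm_of_real of_real_diff)
        also have "\<dots> \<le> e * C"
          using p(2)[of "cis t"] G(2)[OF t] C(2)[OF t] e by (intro mult_mono) auto
        finally show "norm (of_real (g t) * h t - of_real (p (cis t)) * h t) \<le> e * C" .
      qed (auto intro!: continuous_intros g cont contp)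
      finally show ?thesis by (simp add: mult_ac)
    qed
    note small = this
    have "norm ?I \<le> 0 + e" if "e > 0" for e
    proof -
      define X where "X = C * (2 * pi)"
      have X: "X > 0" using C(1) by (simp add: X_def)
      have "norm ?I \<le> e / X * X" unfolding X_def by (rule small) (use that X in \<open>simp add: X_def\<close>)
      then show ?thesis using X by simp
    qed
    then have "norm ?I \<le> 0" by (rule field_le_epsilon)
    then show ?thesis by simp
  qed
  \<comment> \<open>To be used with \<open>L\<close> the real and the imaginary part, so that \<open>L (g h) = g\<^sup>2\<close>.\<close>
  have sq_zero: "g t = 0"
    if g: "continuous_on {0..2 * pi} g" "g (2 * pi) = g 0"
      and gL: "bounded_linear L" "\<And>t. g t = L (h t)" for g and L :: "complex \<Rightarrow> real"
  proof -
    have "(\<lambda>t. of_real (g t) * h t) integrable_on {0..2 * pi}"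
      by (intro integrable_continuous_real continuous_intros g cont)
    from integral_linear[OF this gL(1)]
    have "integral {0..2 * pi} (\<lambda>t. L (of_real (g t) * h t)) = 0"
      using annih[OF g] linear_0[OF bounded_linear.linear[OF gL(1)]] by (simp add: o_def)
    moreover have "L (of_real (g t) * h t) = g t ^ 2" for t
      using linear_cmul[OF bounded_linear.linear[OF gL(1)], of "g t" "h t"] gL(2)[of t]
      by (simp add: scaleR_conv_of_real power2_eq_square)
    ultimately have "integral {0..2 * pi} (\<lambda>t. g t ^ 2) = 0" by simp
    moreover have "continuous_on {0..2 * pi} (\<lambda>t. g t ^ 2)" by (intro continuous_on_power g)
    ultimately have "g t ^ 2 = 0"
      using integral_eq_0_iff[of 0 "2 * pi" "\<lambda>t. g t ^ 2"] t by auto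
    then show ?thesis by simp
  qed
  have "Re (h t) = 0" by (rule sq_zero[OF _ _ bounded_linear_Re]) (auto intro!: continuous_intros cont simp: per)
  moreover have "Im (h t) = 0" by (rule sq_zero[OF _ _ bounded_linear_Im]) (auto intro!: continuous_intros cont simp: per)
  ultimately show ?thesis by (simp add: complex_eq_iff)
qed

text \<open>For functions with \<open>f (2 * pi) = cis (2 * pi * \<kappa>) * f 0\<close>, whose product with \<open>cis (- \<kappa> t)\<close> is periodic.\<close>

definition fourier :: "real \<Rightarrow> (real \<Rightarrow> complex) \<Rightarrow> int \<Rightarrow> complex" where
  "fourier \<kappa> f n = integral {0..2 * pi} (\<lambda>t. f t * cis (- ((of_int n + \<kappa>) * t)))"

lemma fourier_integrable:
  assumes "continuous_on {0..2 * pi} f"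
  shows "(\<lambda>t. f t * cis (- ((of_int n + \<kappa>) * t))) integrable_on {0..2 * pi}"
  by (intro integrable_continuous_real continuous_intros assms)

lemma fourier_add:
  assumes "continuous_on {0..2 * pi} f" "continuous_on {0..2 * pi} g"
  shows "fourier \<kappa> (\<lambda>t. f t + g t) n = fourier \<kappa> f n + fourier \<kappa> g n"
  using Henstock_Kurzweil_Integration.integral_add[OF fourier_integrable[OF assms(1), of n \<kappa>]
      fourier_integrable[OF assms(2), of n \<kappa>]]
  by (simp add: fourier_def distrib_right)

lemma fourier_mult: "fourier \<kappa> (\<lambda>t. c * f t) n = c * fourier \<kappa> f n"
  unfolding fourier_def mult.assoc by simp

lemma fourier_shift: "fourier \<kappa> (\<lambda>t. cis (of_int k * t) * f t) n = fourier \<kappa> f (n - k)"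
proof -
  have "cis (of_int k * t) * cis (- ((of_int n + \<kappa>) * t)) = cis (- ((of_int (n - k) + \<kappa>) * t))" for t
    by (simp add: cis_mult algebra_simps)
  then have "cis (of_int k * t) * f t * cis (- ((of_int n + \<kappa>) * t)) = f t * cis (- ((of_int (n - k) + \<kappa>) * t))" for t
    by (metis mult.assoc mult.commute)
  then show ?thesis by (simp only: fourier_def)
qed

lemma fourier_bounded:
  assumes "continuous_on {0..2 * pi} f"
  shows "\<exists>C. \<forall>n. norm (fourier \<kappa> f n) \<le> C"
proof -
  obtain C where "\<And>t. t \<in> {0..2 * pi} \<Longrightarrow> norm (f t) \<le> C"
    using continuous_on_period_bounded[OF assms] by blast
  then have "norm (fourier \<kappa> f n) \<le> C * (2 * pi)" for n
    using integral_bound[of 0 "2 * pi" "\<lambda>t. f t * cis (- ((of_int n + \<kappa>) * t))" C] assms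
    by (simp add: fourier_def norm_mult continuous_intros)
  then show ?thesis by blast
qed

lemma cis_multiplier: "cis (- ((of_int n + \<kappa>) * (2 * pi))) * cis (2 * pi * \<kappa>) = 1"
proof -
  have "cis (- ((of_int n + \<kappa>) * (2 * pi))) * cis (2 * pi * \<kappa>) = cis (2 * pi * of_int (- n))"
    by (simp add: cis_mult algebra_simps)
  also have "\<dots> = 1" by (rule cis_multiple_2pi) simp
  finally show ?thesis .
qed

text \<open>The multiplier condition makes the boundary terms of the integration by parts cancel.\<close>

lemma fourier_deriv:
  assumes f: "\<And>t. (f has_vector_derivative f' t) (at t)" and per: "f (2 * pi) = cis (2 * pi * \<kappa>) * f 0"
    and f': "continuous_on {0..2 * pi} f'"
  shows "fourier \<kappa> f' n = \<i> * (of_int n + of_real \<kappa>) * fourier \<kappa> f n"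
proof -
  let ?k = "of_int n + \<kappa>"
  let ?e = "\<lambda>t. cis (- (?k * t))"
  have cont: "continuous_on {0..2 * pi} f"
    using f by (meson continuous_at_imp_continuous_on has_vector_derivative_continuous)
  have "((\<lambda>t. f t * ?e t) has_vector_derivative f' t * ?e t + - (\<i> * of_real ?k) * (f t * ?e t)) (at t)" for t
  proof -
    have "((\<lambda>t. - (?k * t)) has_real_derivative - ?k) (at t)" by (auto intro!: derivative_eq_intros)
    from has_vector_derivative_mult[OF f has_vector_derivative_cis[OF this]]
    show ?thesis by (rule has_vector_derivative_eq_rhs) (simp add: algebra_simps)
  qed
  then have "((\<lambda>t. f' t * ?e t + - (\<i> * of_real ?k) * (f t * ?e t)) has_integral
      f (2 * pi) * ?e (2 * pi) - f 0 * ?e 0) {0..2 * pi}"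
    by (intro fundamental_theorem_of_calculus) (auto intro: has_vector_derivative_at_within)
  then have "integral {0..2 * pi} (\<lambda>t. f' t * ?e t + - (\<i> * of_real ?k) * (f t * ?e t)) =
      f (2 * pi) * ?e (2 * pi) - f 0 * ?e 0" by (rule integral_unique)
  also have "\<dots> = f 0 * (?e (2 * pi) * cis (2 * pi * \<kappa>)) - f 0" unfolding per by (simp add: mult_ac)
  also have "\<dots> = 0" unfolding cis_multiplier by simp
  also have "integral {0..2 * pi} (\<lambda>t. f' t * ?e t + - (\<i> * of_real ?k) * (f t * ?e t)) =
      fourier \<kappa> f' n + fourier \<kappa> (\<lambda>t. - (\<i> * of_real ?k) * f t) n"
    unfolding fourier_add[OF f' continuous_on_mult_left[OF cont], symmetric]
    by (simp only: fourier_def distrib_right mult.assoc)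
  also have "fourier \<kappa> (\<lambda>t. - (\<i> * of_real ?k) * f t) n = - (\<i> * of_real ?k) * fourier \<kappa> f n"
    by (rule fourier_mult)
  finally show ?thesis by (simp add: eq_neg_iff_add_eq_0 add_eq_0_iff2)
qed

lemma fourier_unique:
  assumes cont: "continuous_on {0..2 * pi} f" and per: "f (2 * pi) = cis (2 * pi * \<kappa>) * f 0"
    and zero: "\<And>n. fourier \<kappa> f n = 0" and t: "t \<in> {0..2 * pi}"
  shows "f t = 0"
proof -
  have "f t * cis (- (\<kappa> * t)) = 0"
  proof (rule vanishing_moments_imp_zero[OF _ _ _ t, of "\<lambda>t. f t * cis (- (\<kappa> * t))"])
    show "f (2 * pi) * cis (- (\<kappa> * (2 * pi))) = f 0 * cis (- (\<kappa> * 0))"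
      unfolding per using cis_multiplier[of 0 \<kappa>] by (simp add: mult_ac)
    fix n :: int
    have "cis (- (\<kappa> * t)) * cis (of_int n * t) = cis (- ((of_int (- n) + \<kappa>) * t))" for t
      by (simp add: cis_mult algebra_simps)
    then show "integral {0..2 * pi} (\<lambda>t. f t * cis (- (\<kappa> * t)) * cis (of_int n * t)) = 0"
      using zero[of "- n"] by (simp only: fourier_def mult.assoc)
  qed (intro continuous_intros cont)
  then show ?thesis by simp
qed

text \<open>The series converges uniformly on the circle, so it may be integrated term by term.\<close>

lemma fourier_power_series:
  fixes c :: "nat \<Rightarrow> complex"
  assumes cont: "continuous_on {0..2 * pi} f" and c: "summable (\<lambda>k. norm (c k))"
  shows "(\<lambda>k. c k * fourier \<kappa> f (n + int k)) sums fourier \<kappa> (\<lambda>t. f t * (\<Sum>k. c k * cis (- t) ^ k)) n"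
proof -
  let ?e = "\<lambda>t. cis (- ((of_int n + \<kappa>) * t))"
  let ?g = "\<lambda>k t. c k * (f t * cis (- ((of_int (n + int k) + \<kappa>) * t)))"
  obtain C where C: "C > 0" "\<And>t. t \<in> {0..2 * pi} \<Longrightarrow> norm (f t) \<le> C"
    using continuous_on_period_bounded[OF cont] by blast
  have g: "?g k t = f t * ?e t * (c k * cis (- t) ^ k)" for k t
  proof -
    have "cis (- ((of_int (n + int k) + \<kappa>) * t)) = ?e t * cis (- t) ^ k"
      by (simp add: Complex.DeMoivre cis_mult algebra_simps)
    then show ?thesis by (simp add: mult_ac)
  qed
  have "uniform_limit {0..2 * pi} (\<lambda>N t. \<Sum>k<N. ?g k t) (\<lambda>t. \<Sum>k. ?g k t) sequentially"
  proof (rule Weierstrass_m_test)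
    show "norm (?g k t) \<le> norm (c k) * C" if "t \<in> {0..2 * pi}" for k t
      using C(2)[OF that] by (simp add: norm_mult mult_left_mono)
    show "summable (\<lambda>k. norm (c k) * C)" by (intro summable_mult2 c)
  qed
  then obtain I J where I: "\<And>N. ((\<lambda>t. \<Sum>k<N. ?g k t) has_integral I N) {0..2 * pi}"
    and J: "((\<lambda>t. \<Sum>k. ?g k t) has_integral J) {0..2 * pi}" and lim: "I \<longlonglongrightarrow> J"
    by (rule uniform_limit_integral) (auto intro!: continuous_intros cont)
  have "I = (\<lambda>N. \<Sum>k<N. c k * fourier \<kappa> f (n + int k))"
  proof
    fix N
    have "((\<lambda>t. \<Sum>k<N. ?g k t) has_integral (\<Sum>k<N. c k * fourier \<kappa> f (n + int k))) {0..2 * pi}"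
      unfolding fourier_def
      by (intro has_integral_sum has_integral_mult_right integrable_integral fourier_integrable cont) auto
    then show "I N = (\<Sum>k<N. c k * fourier \<kappa> f (n + int k))" using I has_integral_unique by blast
  qed
  moreover have "J = fourier \<kappa> (\<lambda>t. f t * (\<Sum>k. c k * cis (- t) ^ k)) n"
  proof -
    have "summable (\<lambda>k. c k * cis (- t) ^ k)" for t
      by (rule summable_norm_cancel) (simp add: norm_mult norm_power c)
    then have "(\<Sum>k. ?g k t) = f t * (\<Sum>k. c k * cis (- t) ^ k) * ?e t" for t
      unfolding g by (subst suminf_mult) (simp_all add: mult_ac)
    then show ?thesis using integral_unique[OF J] by (simp add: fourier_def)
  qed
  ultimately show ?thesis using lim by (simp add: sums_def)
qed

section \<open>The matrix product and its non-growing solution\<close>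

lemma summable_inverse_squares_shift: "summable (\<lambda>j. 1 / (real (m + Suc j))\<^sup>2)"
proof -
  have "summable (\<lambda>n. inverse ((real n)\<^sup>2))" by (rule inverse_power_summable) simp
  from summable_ignore_initial_segment[OF this, of "Suc m"]
  show ?thesis by (simp add: inverse_eq_divide add_ac)
qed

context
  fixes l :: nat and lam \<mu> :: real
begin

text \<open>Together with \<open>row_coeff2\<close> the first row of the factor with index \<open>l + n\<close>.\<close>

definition row_coeff1 :: "nat \<Rightarrow> real" where
  "row_coeff1 n = 1 + lam / (real (l + n) * real n)"

definition row_coeff2 :: "nat \<Rightarrow> real" where
  "row_coeff2 n = \<mu>\<^sup>2 / (real (l + n) * real n)"

text \<open>A row vector \<open>r\<close> multiplied from the right by the \<open>k\<close> factors with indices \<open>l + m + 1, \<dots>, l + m + k\<close>.\<close>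

primrec row_run :: "nat \<Rightarrow> real \<times> real \<Rightarrow> nat \<Rightarrow> real \<times> real" where
  "row_run m r 0 = r"
| "row_run m r (Suc k) =
     (row_coeff1 (m + Suc k) * fst (row_run m r k) + snd (row_run m r k),
      row_coeff2 (m + Suc k) * fst (row_run m r k))"

text \<open>As the second column of the infinite product vanishes, these numbers describe the tails of the product
completely. They solve the recurrence \<open>tail_limit_recurrence\<close> and tend to \<open>1\<close>; if \<open>\<mu> \<noteq> 0\<close>, solutions that are
not multiples of them grow like the square of a factorial.\<close>

definition tail_limit :: "nat \<Rightarrow> real" where
  "tail_limit m = lim (\<lambda>k. fst (row_run m (1, 0) k))"

lemma row_run_linear:
  "row_run m (x, y) k =
     x *\<^sub>R row_run m (1, 0) k + y *\<^sub>R row_run m (0, 1) k"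
  by (induction k) (auto simp: prod_eq_iff algebra_simps)

lemma row_run_shift:
  "row_run m (x, y) (Suc k) =
     row_run (Suc m) (row_coeff1 (Suc m) * x + y, row_coeff2 (Suc m) * x) k"
  by (induction k) simp_all

lemma M_prod_rows:
  "(M_prod l lam \<mu> k $ i $ 1, M_prod l lam \<mu> k $ i $ 2) =
     row_run 0 (mat 1 $ i $ 1, mat 1 $ i $ 2) k"
proof (induction k)
  case (Suc k)
  have "fst (row_run 0 (mat 1 $ i $ 1, mat 1 $ i $ 2) k) = M_prod l lam \<mu> k $ i $ 1"
    "snd (row_run 0 (mat 1 $ i $ 1, mat 1 $ i $ 2) k) = M_prod l lam \<mu> k $ i $ 2"
    using Suc by (metis fst_conv, metis snd_conv)
  then show ?case
    by (simp add: matrix_matrix_mult_def sum_2 M_mat_def row_coeff1_def row_coeff2_def mult.commute)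
qed simp

lemma row_coeff_bounds:
  assumes "n > 0"
  shows "\<bar>row_coeff1 n - 1\<bar> \<le> \<bar>lam\<bar> / (real n)\<^sup>2" "0 \<le> row_coeff2 n"
    "row_coeff2 n \<le> \<mu>\<^sup>2 / (real n)\<^sup>2"
proof -
  have "(real n)\<^sup>2 \<le> real (l + n) * real n"
    unfolding power2_eq_square by (intro mult_right_mono) auto
  moreover have "(real n)\<^sup>2 > 0" using assms by simp
  ultimately show "\<bar>row_coeff1 n - 1\<bar> \<le> \<bar>lam\<bar> / (real n)\<^sup>2" "0 \<le> row_coeff2 n"
    "row_coeff2 n \<le> \<mu>\<^sup>2 / (real n)\<^sup>2"
    by (auto simp: row_coeff1_def row_coeff2_def abs_mult simp del: of_nat_add intro!: divide_left_mono)
qed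

definition row_bound :: real where
  "row_bound = exp ((\<bar>lam\<bar> + \<mu>\<^sup>2) * (\<Sum>j. 1 / (real (Suc j))\<^sup>2))"

text \<open>One step multiplies the sum of the absolute values of both entries by at most \<open>1 + (\<bar>\<lambda>\<bar> + \<mu>\<^sup>2) / n\<^sup>2\<close>, and the
product of these factors converges.\<close>

lemma row_run_bound:
  "\<bar>fst (row_run m (1, 0) k)\<bar> + \<bar>snd (row_run m (1, 0) k)\<bar> \<le> row_bound"
proof -
  let ?c = "\<bar>lam\<bar> + \<mu>\<^sup>2" and ?d = "\<lambda>j. 1 / (real (m + Suc j))\<^sup>2"
  define p q where "p k = fst (row_run m (1, 0) k)" and "q k = snd (row_run m (1, 0) k)" for k
  have step: "p (Suc k) = row_coeff1 (m + Suc k) * p k + q k" "q (Suc k) = row_coeff2 (m + Suc k) * p k" for k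
    by (simp_all add: p_def q_def)
  have "\<bar>p k\<bar> + \<bar>q k\<bar> \<le> exp (?c * (\<Sum>j<k. ?d j))"
  proof (induction k)
    case 0
    show ?case by (simp add: p_def q_def)
  next
    case (Suc k)
    note b = row_coeff_bounds[of "m + Suc k"]
    have 1: "\<bar>row_coeff1 (m + Suc k)\<bar> \<le> 1 + \<bar>lam\<bar> * ?d k"
      using b(1) by simp
    have 2: "\<bar>row_coeff2 (m + Suc k)\<bar> \<le> \<mu>\<^sup>2 * ?d k"
      using b(2,3) by simp
    have "\<bar>p (Suc k)\<bar> + \<bar>q (Suc k)\<bar> \<le>
        \<bar>row_coeff1 (m + Suc k)\<bar> * \<bar>p k\<bar> + \<bar>q k\<bar> + \<bar>row_coeff2 (m + Suc k)\<bar> * \<bar>p k\<bar>"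
      unfolding step abs_mult[symmetric] by linarith
    also have "\<dots> \<le> (1 + \<bar>lam\<bar> * ?d k) * \<bar>p k\<bar> + \<bar>q k\<bar> + (\<mu>\<^sup>2 * ?d k) * \<bar>p k\<bar>"
      by (intro add_mono mult_right_mono 1 2) auto
    also have "\<dots> = (1 + ?c * ?d k) * \<bar>p k\<bar> + 1 * \<bar>q k\<bar>" by (simp only: ring_distribs mult_1 add_ac mult_ac)
    also have "\<dots> \<le> (1 + ?c * ?d k) * \<bar>p k\<bar> + (1 + ?c * ?d k) * \<bar>q k\<bar>"
      by (intro add_left_mono mult_right_mono) auto
    also have "\<dots> = (1 + ?c * ?d k) * (\<bar>p k\<bar> + \<bar>q k\<bar>)" by (simp only: ring_distribs)
    also have "\<dots> \<le> exp (?c * ?d k) * exp (?c * (\<Sum>j<k. ?d j))"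
      by (intro mult_mono Suc.IH exp_ge_add_one_self) auto
    also have "\<dots> = exp (?c * (\<Sum>j<Suc k. ?d j))" by (simp only: exp_add[symmetric] sum.lessThan_Suc ring_distribs add_ac)
    finally show ?case .
  qed
  also have "\<dots> \<le> row_bound"
  proof -
    have "(\<Sum>j<k. ?d j) \<le> (\<Sum>j<k. 1 / (real (Suc j))\<^sup>2)"
      by (intro sum_mono divide_left_mono power_mono) auto
    also have "\<dots> \<le> (\<Sum>j. 1 / (real (Suc j))\<^sup>2)"
      using summable_inverse_squares_shift[of 0] by (intro sum_le_suminf) auto
    finally show ?thesis unfolding row_bound_def by (simp add: mult_left_mono)
  qed
  finally show ?thesis by (simp add: p_def q_def)
qed

text \<open>The sum of both entries changes by a summable amount in each step, and the second entry tends to \<open>0\<close>.\<close>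

lemma row_run_limits:
  shows "(\<lambda>k. fst (row_run m (1, 0) k)) \<longlonglongrightarrow> tail_limit m"
    and "(\<lambda>k. snd (row_run m (1, 0) k)) \<longlonglongrightarrow> 0"
    and "\<bar>tail_limit m - 1\<bar> \<le>
      (\<bar>lam\<bar> + \<mu>\<^sup>2) * row_bound * (\<Sum>j. 1 / (real (m + Suc j))\<^sup>2)"
proof -
  let ?K = "row_bound" and ?c = "\<bar>lam\<bar> + \<mu>\<^sup>2" and ?d = "\<lambda>j. 1 / (real (m + Suc j))\<^sup>2"
  define p q where "p k = fst (row_run m (1, 0) k)" and "q k = snd (row_run m (1, 0) k)" for k
  have step: "p (Suc k) = row_coeff1 (m + Suc k) * p k + q k" "q (Suc k) = row_coeff2 (m + Suc k) * p k" for k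
    by (simp_all add: p_def q_def)
  have pK: "\<bar>p k\<bar> \<le> ?K" for k using row_run_bound[of m k] by (simp add: p_def)
  have dlim: "?d \<longlonglongrightarrow> 0" by (rule summable_LIMSEQ_zero[OF summable_inverse_squares_shift])
  have "(\<lambda>k. q (Suc k)) \<longlonglongrightarrow> 0"
  proof (rule Lim_null_comparison)
    show "\<forall>\<^sub>F k in sequentially. norm (q (Suc k)) \<le> (\<mu>\<^sup>2 * ?K) * ?d k"
    proof (rule always_eventually, rule allI)
      fix k
      have "norm (q (Suc k)) = row_coeff2 (m + Suc k) * \<bar>p k\<bar>"
        using row_coeff_bounds(2)[of "m + Suc k"] by (simp add: step abs_mult)
      also have "\<dots> \<le> (\<mu>\<^sup>2 * ?d k) * ?K"
        using row_coeff_bounds(3)[of "m + Suc k"] pK[of k] by (intro mult_mono) auto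
      finally show "norm (q (Suc k)) \<le> (\<mu>\<^sup>2 * ?K) * ?d k" by (simp add: mult_ac)
    qed
    show "(\<lambda>k. (\<mu>\<^sup>2 * ?K) * ?d k) \<longlonglongrightarrow> 0" by (rule tendsto_mult_right_zero[OF dlim])
  qed
  then have q: "q \<longlonglongrightarrow> 0" by (simp add: filterlim_sequentially_Suc)
  \<comment> \<open>Unlike \<open>p\<close>, the sum \<open>p + q\<close> has increments that are multiples of \<open>p\<close> alone.\<close>
  define s where "s k = p k + q k" for k
  define e where "e k = (row_coeff1 (m + Suc k) - 1 + row_coeff2 (m + Suc k)) * p k" for k
  have s_step: "s (Suc k) = s k + e k" for k by (simp add: s_def e_def step algebra_simps)
  have s_sum: "s k = 1 + (\<Sum>j<k. e j)" for k
  proof (induction k)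
    case 0
    show ?case by (simp add: s_def p_def q_def)
  qed (simp add: s_step)
  have e_bound: "\<bar>e k\<bar> \<le> ?c * ?K * ?d k" for k
  proof -
    have "\<bar>e k\<bar> \<le> (?c * ?d k) * ?K" unfolding e_def abs_mult
    proof (intro mult_mono pK)
      show "\<bar>row_coeff1 (m + Suc k) - 1 + row_coeff2 (m + Suc k)\<bar> \<le> ?c * ?d k"
        using row_coeff_bounds(1)[of "m + Suc k"] row_coeff_bounds(2,3)[of "m + Suc k"]
        by (simp add: add_divide_distrib)
    qed auto
    then show ?thesis by (simp add: mult_ac)
  qed
  have summ: "summable (\<lambda>k. ?c * ?K * ?d k)" by (intro summable_mult summable_inverse_squares_shift)
  have e_summ: "summable (\<lambda>k. \<bar>e k\<bar>)" by (rule summable_comparison_test'[OF summ]) (use e_bound in simp)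
  have "s \<longlonglongrightarrow> 1 + suminf e"
    unfolding s_sum[abs_def] by (intro tendsto_intros summable_LIMSEQ summable_rabs_cancel[OF e_summ])
  from tendsto_diff[OF this q] have p: "p \<longlonglongrightarrow> 1 + suminf e" by (simp add: s_def)
  then have lim: "tail_limit m = 1 + suminf e"
    unfolding tail_limit_def p_def[symmetric] by (rule limI)
  then show "(\<lambda>k. fst (row_run m (1, 0) k)) \<longlonglongrightarrow> tail_limit m"
    and "(\<lambda>k. snd (row_run m (1, 0) k)) \<longlonglongrightarrow> 0"
    using p q by (simp_all add: p_def[abs_def] q_def[abs_def])
  have "\<bar>suminf e\<bar> \<le> (\<Sum>k. \<bar>e k\<bar>)" by (rule summable_rabs[OF e_summ])
  also have "\<dots> \<le> (\<Sum>k. ?c * ?K * ?d k)" by (intro suminf_le e_bound e_summ summ)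
  also have "\<dots> = ?c * ?K * (\<Sum>k. ?d k)" by (intro suminf_mult summable_inverse_squares_shift)
  finally show "\<bar>tail_limit m - 1\<bar> \<le> ?c * ?K * (\<Sum>k. ?d k)" by (simp add: lim)
qed

text \<open>Splitting off the first factor of the product and, from the second unit vector, one more factor.\<close>

lemma tail_limit_recurrence:
  "tail_limit m =
     row_coeff1 (Suc m) * tail_limit (Suc m) + row_coeff2 (Suc m) * tail_limit (Suc (Suc m))"
proof -
  let ?f = "\<lambda>m k. fst (row_run m (1, 0) k)"
  have "?f m (Suc (Suc k)) =
      row_coeff1 (Suc m) * ?f (Suc m) (Suc k) + row_coeff2 (Suc m) * ?f (Suc (Suc m)) k" for k
    unfolding row_run_shift[of m]
    by (subst row_run_linear, subst row_run_shift[of "Suc m" 0 1]) (simp del: row_run.simps)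
  then have "(\<lambda>k. ?f m (Suc (Suc k))) \<longlonglongrightarrow>
     row_coeff1 (Suc m) * tail_limit (Suc m) + row_coeff2 (Suc m) * tail_limit (Suc (Suc m))"
    by (simp only:) (intro tendsto_intros row_run_limits LIMSEQ_Suc)
  then show ?thesis
    using LIMSEQ_unique[OF LIMSEQ_Suc[OF LIMSEQ_Suc[OF row_run_limits(1)]]] by blast
qed

lemma tail_limit_bounded: "\<bar>tail_limit m\<bar> \<le> row_bound"
proof (rule LIMSEQ_le_const2[OF tendsto_rabs[OF row_run_limits(1)]])
  show "\<exists>N. \<forall>n\<ge>N. \<bar>fst (row_run m (1, 0) n)\<bar> \<le> row_bound"
    using row_run_bound[of m] by (metis abs_ge_zero add_increasing2 add_le_cancel_left dual_order.trans le_add_same_cancel1)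
qed

lemma tail_limit_tendsto_1: "tail_limit \<longlonglongrightarrow> 1"
proof -
  let ?d = "\<lambda>j. 1 / (real (Suc j))\<^sup>2"
  have summ: "summable ?d" using summable_inverse_squares_shift[of 0] by simp
  have "(\<lambda>m. \<Sum>j. ?d (j + m)) \<longlonglongrightarrow> 0"
  proof -
    have "(\<lambda>m. suminf ?d - (\<Sum>j<m. ?d j)) \<longlonglongrightarrow> suminf ?d - suminf ?d"
      by (intro tendsto_intros summable_LIMSEQ summ)
    then show ?thesis by (simp only: suminf_minus_initial_segment[OF summ] diff_self)
  qed
  then have "(\<lambda>m. \<Sum>j. 1 / (real (m + Suc j))\<^sup>2) \<longlonglongrightarrow> 0" by (simp add: add_ac)
  from tendsto_mult_right_zero[OF this, of "(\<bar>lam\<bar> + \<mu>\<^sup>2) * row_bound"]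
  have "(\<lambda>m. tail_limit m - 1) \<longlonglongrightarrow> 0"
    by (rule Lim_null_comparison[rotated]) (use row_run_limits(3) in \<open>simp add: always_eventually\<close>)
  then show ?thesis by (simp add: LIM_zero_iff)
qed

lemma tail_limit_ge_1:
  assumes "lam \<ge> 0"
  shows "tail_limit m \<ge> 1"
proof (rule LIMSEQ_le_const[OF row_run_limits(1)])
  have "1 \<le> fst (row_run m (1, 0) k) \<and> 0 \<le> snd (row_run m (1, 0) k)" for k
  proof (induction k)
    case (Suc k)
    have "1 \<le> row_coeff1 (m + Suc k)" "0 \<le> row_coeff2 (m + Suc k)"
      using assms by (simp_all add: row_coeff1_def row_coeff2_def)
    moreover from this have "1 * 1 \<le> row_coeff1 (m + Suc k) * fst (row_run m (1, 0) k)"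
      using Suc by (intro mult_mono) auto
    ultimately show ?case using Suc by simp
  qed simp
  then show "\<exists>N. \<forall>n\<ge>N. 1 \<le> fst (row_run m (1, 0) n)" by blast
qed

lemma xi_eq_tail_limits: "\<xi> l lam \<mu> = lam * tail_limit 0 + \<mu>\<^sup>2 * tail_limit 1"
proof -
  define R :: "real^2^2" where
    "R = vector [vector [tail_limit 0, 0], vector [tail_limit 1, 0]]"
  have shift: "row_run 0 (0, 1) (Suc k) = row_run 1 (1, 0) k" for k
    using row_run_shift[of 0 0 1 k] by simp
  have entries: "M_prod l lam \<mu> k $ i $ 1 = fst (row_run 0 (mat 1 $ i $ 1, mat 1 $ i $ 2) k)"
    "M_prod l lam \<mu> k $ i $ 2 = snd (row_run 0 (mat 1 $ i $ 1, mat 1 $ i $ 2) k)" for k i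
    using M_prod_rows[of k i] by (metis fst_conv, metis snd_conv)
  have mat: "(mat 1 :: real^2^2) $ 1 $ 1 = 1" "(mat 1 :: real^2^2) $ 1 $ 2 = 0"
    "(mat 1 :: real^2^2) $ 2 $ 1 = 0" "(mat 1 :: real^2^2) $ 2 $ 2 = 1"
    by (simp_all add: mat_def)
  have 1: "(\<lambda>k. M_prod l lam \<mu> k $ 1 $ 1) \<longlonglongrightarrow> tail_limit 0" "(\<lambda>k. M_prod l lam \<mu> k $ 1 $ 2) \<longlonglongrightarrow> 0"
    unfolding entries mat by (rule row_run_limits)+
  have 2: "(\<lambda>k. M_prod l lam \<mu> k $ 2 $ 1) \<longlonglongrightarrow> tail_limit 1" "(\<lambda>k. M_prod l lam \<mu> k $ 2 $ 2) \<longlonglongrightarrow> 0"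
    unfolding entries mat by (rule LIMSEQ_imp_Suc, unfold shift, rule row_run_limits)+
  have "\<forall>i j. (\<lambda>k. M_prod l lam \<mu> k $ i $ j) \<longlonglongrightarrow> R $ i $ j"
    unfolding forall_2 using 1 2 by (simp add: R_def)
  then have "M_prod l lam \<mu> \<longlonglongrightarrow> R" by (intro vec_tendstoI) blast
  then have "R_mat l lam \<mu> = R" unfolding R_mat_def by (rule limI)
  then show ?thesis
    by (simp add: \<xi>_def R_def vector_matrix_mult_def inner_vec_def sum_2 mult.commute)
qed

text \<open>For \<open>\<lambda> > 0\<close> all entries of the factors are nonnegative and their upper left entries are at least \<open>1\<close>.\<close>

lemma xi_pos:
  assumes "lam > 0"
  shows "\<xi> l lam \<mu> > 0"
proof -
  have "0 < lam * tail_limit 0"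
    using assms tail_limit_ge_1[of 0] by (intro mult_pos_pos) auto
  moreover have "0 \<le> \<mu>\<^sup>2 * tail_limit 1"
    using assms tail_limit_ge_1[of 1] by (intro mult_nonneg_nonneg) auto
  ultimately show ?thesis by (simp add: xi_eq_tail_limits)
qed

end

section \<open>Scalar monodromy\<close>

lemma linear_solution_continuous:
  assumes "linear_solution \<omega> q \<mu> u v"
  shows "continuous_on S u" "continuous_on S v"
  using linear_solution_deriv[OF assms]
  by (meson continuous_at_imp_continuous_on has_vector_derivative_continuous)+

text \<open>The coefficient \<open>2 \<mu> cos t\<close> is \<open>\<mu> (cis t + cis (- t))\<close>, which shifts the index in both directions.\<close>

lemma fourier_linear_solution:
  assumes \<omega>: "\<omega> > 0" and sol: "floquet_solution \<omega> q \<mu> (cis (2 * pi * \<kappa>)) u v"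
  shows "fourier \<kappa> v n = 2 * of_real \<omega> * \<i> * (of_int n + of_real \<kappa>) * fourier \<kappa> u n"
    and "\<i> * (of_int n + of_real \<kappa> - of_real q) * fourier \<kappa> v n =
      \<i> * of_real \<mu> * (fourier \<kappa> v (n - 1) + fourier \<kappa> v (n + 1)) + fourier \<kappa> u n / (2 * of_real \<omega>)"
    and "\<exists>C. \<forall>n. norm ((of_int n + of_real \<kappa>) * fourier \<kappa> v n) \<le> C"
proof -
  have lin: "linear_solution \<omega> q \<mu> u v"
    and per: "u (2 * pi) = cis (2 * pi * \<kappa>) * u 0" "v (2 * pi) = cis (2 * pi * \<kappa>) * v 0"
    using sol by (auto simp: floquet_solution_def)
  note cont = linear_solution_continuous[OF lin, where S = "{0..2 * pi}"] and d = linear_solution_deriv[OF lin]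
  have "fourier \<kappa> (\<lambda>t. v t / of_real (2 * \<omega>)) n = \<i> * (of_int n + of_real \<kappa>) * fourier \<kappa> u n"
    using \<omega> by (intro fourier_deriv d per continuous_intros cont) auto
  moreover have "fourier \<kappa> (\<lambda>t. v t / of_real (2 * \<omega>)) n = 1 / of_real (2 * \<omega>) * fourier \<kappa> v n"
    unfolding fourier_mult[symmetric] by simp
  ultimately show "fourier \<kappa> v n = 2 * of_real \<omega> * \<i> * (of_int n + of_real \<kappa>) * fourier \<kappa> u n"
    using \<omega> by (simp add: field_simps)
  let ?v' = "\<lambda>t. \<i> * of_real (q + 2 * \<mu> * cos t) * v t + u t / of_real (2 * \<omega>)"
  have cont': "continuous_on {0..2 * pi} ?v'"
    using \<omega> by (intro continuous_intros cont) auto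
  have v': "fourier \<kappa> ?v' n = \<i> * (of_int n + of_real \<kappa>) * fourier \<kappa> v n" for n
    by (intro fourier_deriv d per cont')
  have split: "?v' t = (\<i> * of_real q * v t + \<i> * of_real \<mu> * (cis (of_int 1 * t) * v t)) +
      (\<i> * of_real \<mu> * (cis (of_int (- 1) * t) * v t) + 1 / of_real (2 * \<omega>) * u t)" for t
  proof -
    have "of_real (2 * cos t) = cis t + cis (- t)" by (simp add: complex_eq_iff)
    then have "\<i> * of_real (q + 2 * \<mu> * cos t) = \<i> * of_real q + \<i> * of_real \<mu> * (cis t + cis (- t))"
      by (simp add: algebra_simps)
    then show ?thesis by (simp add: algebra_simps)
  qed
  have "fourier \<kappa> ?v' n = (\<i> * of_real q * fourier \<kappa> v n + \<i> * of_real \<mu> * fourier \<kappa> v (n - 1)) +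
      (\<i> * of_real \<mu> * fourier \<kappa> v (n - - 1) + 1 / of_real (2 * \<omega>) * fourier \<kappa> u n)"
    unfolding split fourier_mult[symmetric] fourier_shift[symmetric]
    by (subst fourier_add[symmetric], (intro continuous_intros cont)+)+ simp
  then show "\<i> * (of_int n + of_real \<kappa> - of_real q) * fourier \<kappa> v n =
      \<i> * of_real \<mu> * (fourier \<kappa> v (n - 1) + fourier \<kappa> v (n + 1)) + fourier \<kappa> u n / (2 * of_real \<omega>)"
    unfolding v' by (simp add: algebra_simps)
  obtain C where "\<And>n. norm (fourier \<kappa> ?v' n) \<le> C" using fourier_bounded[OF cont'] by blast
  then show "\<exists>C. \<forall>n. norm ((of_int n + of_real \<kappa>) * fourier \<kappa> v n) \<le> C"
    unfolding v' by (intro exI[of _ C]) (simp add: norm_mult)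
qed

lemma fourier_three_term:
  assumes \<omega>: "\<omega> > 0" and sol: "floquet_solution \<omega> q \<mu> (cis (2 * pi * \<kappa>)) u v"
    and n: "of_int n + \<kappa> \<noteq> 0"
  shows "of_real (of_int n + \<kappa> - q + 1 / (4 * \<omega>\<^sup>2 * (of_int n + \<kappa>))) * fourier \<kappa> v n =
    of_real \<mu> * (fourier \<kappa> v (n - 1) + fourier \<kappa> v (n + 1))"
proof -
  define N :: complex where "N = of_int n + of_real \<kappa>"
  have "N = of_real (of_int n + \<kappa>)" by (simp add: N_def)
  then have N: "N \<noteq> 0" using n by (simp del: of_real_add)
  have w: "complex_of_real \<omega> \<noteq> 0" using \<omega> by simp
  note 1 = fourier_linear_solution(1)[OF \<omega> sol, of n, folded N_def]
    and 2 = fourier_linear_solution(2)[OF \<omega> sol, of n, folded N_def]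
  have "fourier \<kappa> u n = fourier \<kappa> v n / (2 * of_real \<omega> * \<i> * N)" using 1 N w by simp
  with 2 have "\<i> * (N - of_real q) * fourier \<kappa> v n - fourier \<kappa> v n / (2 * of_real \<omega> * \<i> * N) / (2 * of_real \<omega>) =
      \<i> * of_real \<mu> * (fourier \<kappa> v (n - 1) + fourier \<kappa> v (n + 1))" by simp
  moreover have "fourier \<kappa> v n / (2 * of_real \<omega> * \<i> * N) / (2 * of_real \<omega>) = - \<i> * (fourier \<kappa> v n / (4 * (of_real \<omega>)\<^sup>2 * N))"
    using N w by (simp add: field_simps power2_eq_square)
  ultimately have "\<i> * ((N - of_real q + 1 / (4 * (of_real \<omega>)\<^sup>2 * N)) * fourier \<kappa> v n) =
      \<i> * (of_real \<mu> * (fourier \<kappa> v (n - 1) + fourier \<kappa> v (n + 1)))"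
    by (simp add: algebra_simps)
  then show ?thesis by (simp add: N_def)
qed

lemma fourier_decay:
  assumes \<omega>: "\<omega> > 0" and sol: "floquet_solution \<omega> q \<mu> (cis (2 * pi * \<kappa>)) u v"
  shows "(\<lambda>n. fourier \<kappa> v (int n)) \<longlonglongrightarrow> 0"
proof -
  obtain C where C: "\<And>n. norm ((of_int n + of_real \<kappa>) * fourier \<kappa> v n) \<le> C"
    using fourier_linear_solution(3)[OF \<omega> sol] by blast
  have "filterlim (\<lambda>n. real n + \<kappa>) at_top sequentially"
    using filterlim_tendsto_add_at_top[OF tendsto_const[of \<kappa>] filterlim_real_sequentially]
    by (simp add: add.commute)
  then have "(\<lambda>n. C * inverse (real n + \<kappa>)) \<longlonglongrightarrow> C * 0"
    by (intro tendsto_intros tendsto_inverse_0_at_top)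
  then have lim: "(\<lambda>n. C * inverse (real n + \<kappa>)) \<longlonglongrightarrow> 0" by simp
  have "\<forall>\<^sub>F n in sequentially. 0 < real n + \<kappa>"
    using \<open>filterlim (\<lambda>n. real n + \<kappa>) at_top sequentially\<close> by (rule eventually_compose_filterlim[OF eventually_gt_at_top])
  then have "\<forall>\<^sub>F n in sequentially. norm (fourier \<kappa> v (int n)) \<le> C * inverse (real n + \<kappa>)"
  proof eventually_elim
    case (elim n)
    have "of_int (int n) + of_real \<kappa> = complex_of_real (real n + \<kappa>)" by simp
    then have "norm (of_int (int n) + of_real \<kappa> :: complex) = real n + \<kappa>"
      using elim by (simp only: norm_of_real abs_of_pos)
    then have "(real n + \<kappa>) * norm (fourier \<kappa> v (int n)) \<le> C" using C[of "int n"] by (simp add: norm_mult)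
    then show ?case using elim by (simp add: field_simps)
  qed
  then show ?thesis by (rule Lim_null_comparison[OF _ lim])
qed

text \<open>The coefficients of the two neighbours in the recurrence are equal, so the Casoratian of two solutions
does not depend on the index; it tends to \<open>0\<close> with the solutions.\<close>

lemma three_term_decaying_casoratian:
  fixes b c s :: "int \<Rightarrow> complex"
  assumes m: "m \<noteq> 0" and b: "\<And>n. s n * b n = m * (b (n - 1) + b (n + 1))"
    and c: "\<And>n. s n * c n = m * (c (n - 1) + c (n + 1))"
    and lim: "(\<lambda>n. b (int n)) \<longlonglongrightarrow> 0" "(\<lambda>n. c (int n)) \<longlonglongrightarrow> 0"
  shows "b 0 * c 1 = b 1 * c 0"
proof -
  define W where "W n = b (int n) * c (int (Suc n)) - b (int (Suc n)) * c (int n)" for n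
  have "W (Suc n) = W n" for n
  proof -
    let ?k = "int (Suc n)"
    have "(m * (b (?k - 1) + b (?k + 1))) * c ?k = b ?k * (m * (c (?k - 1) + c (?k + 1)))"
      unfolding b[symmetric] c[symmetric] by simp
    then have "m * (W (Suc n) - W n) = 0" by (simp add: W_def algebra_simps)
    then show ?thesis using m by simp
  qed
  then have const: "W n = W 0" for n by (induction n) simp_all
  have "W \<longlonglongrightarrow> 0 * 0 - 0 * 0"
    unfolding W_def[abs_def]
    by (intro tendsto_intros lim LIMSEQ_Suc[OF lim(1)] LIMSEQ_Suc[OF lim(2)])
  moreover have "W \<longlonglongrightarrow> W 0"
    by (rule Lim_transform_eventually[OF tendsto_const], rule always_eventually, rule allI, rule const[symmetric])
  ultimately have "W 0 = 0 * 0 - 0 * 0" using LIMSEQ_unique by blast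
  then show ?thesis by (simp add: W_def)
qed

lemma three_term_zero:
  fixes b s :: "int \<Rightarrow> complex"
  assumes m: "m \<noteq> 0" and b: "\<And>n. s n * b n = m * (b (n - 1) + b (n + 1))" and 0: "b 0 = 0" "b 1 = 0"
  shows "b n = 0"
proof -
  have step: "b (n + 1) = 0" if "b n = 0" "b (n - 1) = 0" for n using b[of n] that m by simp
  have step': "b (n - 1) = 0" if "b n = 0" "b (n + 1) = 0" for n using b[of n] that m by simp
  have "b n = 0 \<and> b (n + 1) = 0"
  proof (induction n rule: int_induct[where k = 0])
    case base
    then show ?case using 0 by simp
  next
    case (step1 i)
    then show ?case using step[of "i + 1"] by simp
  next
    case (step2 i)
    then show ?case using step'[of i] by simp
  qed
  then show ?thesis by simp
qed

lemma degenerate_system_solution: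
  fixes x1 x2 y1 y2 :: complex
  assumes "x1 * y2 = x2 * y1"
  shows "\<exists>\<alpha> \<beta>. (\<alpha> \<noteq> 0 \<or> \<beta> \<noteq> 0) \<and> \<alpha> * x1 + \<beta> * x2 = 0 \<and> \<alpha> * y1 + \<beta> * y2 = 0"
proof (cases "x1 = 0 \<and> x2 = 0")
  case True
  show ?thesis
  proof (cases "y1 = 0 \<and> y2 = 0")
    case True
    then show ?thesis using \<open>x1 = 0 \<and> x2 = 0\<close> by (intro exI[of _ 1]) simp
  next
    case False
    then show ?thesis using True by (intro exI[of _ y2] exI[of _ "- y1"]) auto
  qed
next
  case False
  then show ?thesis using assms by (intro exI[of _ x2] exI[of _ "- x1"]) (auto simp: mult.commute)
qed

lemma nondegenerate_combination_nonzero: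
  fixes x1 x2 y1 y2 :: complex
  assumes "x1 * y2 \<noteq> x2 * y1" "\<alpha> * x1 + \<beta> * x2 = 0" "\<alpha> * y1 + \<beta> * y2 = 0"
  shows "\<alpha> = 0" "\<beta> = 0"
proof -
  have "\<alpha> * (x1 * y2 - x2 * y1) = (\<alpha> * x1 + \<beta> * x2) * y2 - (\<alpha> * y1 + \<beta> * y2) * x2"
    "\<beta> * (x1 * y2 - x2 * y1) = (\<alpha> * y1 + \<beta> * y2) * x1 - (\<alpha> * x1 + \<beta> * x2) * y1"
    by (simp_all add: algebra_simps)
  then have "\<alpha> * (x1 * y2 - x2 * y1) = 0" "\<beta> * (x1 * y2 - x2 * y1) = 0"
    by (simp_all only: assms(2,3) mult_zero_left diff_self)
  then show "\<alpha> = 0" "\<beta> = 0" using assms(1) by simp_all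
qed

text \<open>The common multiplier of the two independent solutions must be \<open>1\<close>: otherwise \<open>n + \<kappa>\<close> never vanishes, the
three-term recurrence for the Fourier coefficients of \<open>v\<close> is regular at every index, and its decaying
solutions form a space of dimension at most one. The square of the multiplier is \<open>exp (2\<pi>i B / \<omega>)\<close>,
so \<open>B / \<omega>\<close> is an integer.\<close>

lemma advance_const_imp_periodic_pair:
  assumes \<omega>: "\<omega> > 0" and A: "A \<noteq> 0" and D: "\<And>x. advance \<omega> (B, A) x = 2 * pi * of_int r"
  shows "\<exists>u1 v1 u2 v2.
    floquet_solution \<omega> (B / \<omega>) (A / (2 * \<omega>)) 1 u1 v1 \<and>
    floquet_solution \<omega> (B / \<omega>) (A / (2 * \<omega>)) 1 u2 v2 \<and>
    u1 0 * v2 0 \<noteq> u2 0 * v1 0"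
    and "\<exists>k::int. B = of_int k * \<omega>"
proof -
  let ?fl = "floquet_solution \<omega> (B / \<omega>) (A / (2 * \<omega>))"
  define \<mu> where "\<mu> = complex_of_real (A / (2 * \<omega>))"
  have \<mu>: "\<mu> \<noteq> 0" using A \<omega> by (simp add: \<mu>_def)
  obtain c u1 v1 u2 v2 where cc: "c * c = cis (2 * pi * (B / \<omega>))"
    and 1: "?fl c u1 v1" and 2: "?fl c u2 v2"
    and indep: "u1 0 * v2 0 \<noteq> u2 0 * v1 0"
    using advance_const_imp_common_multiplier[OF \<omega> D] by blast
  have "norm c * norm c = 1" unfolding norm_mult[symmetric] cc by simp
  then have "norm c = 1" by (metis abs_norm_cancel abs_square_eq_1 power2_eq_square)
  then have "cis (Arg c) = c" by (metis cis_Arg norm_zero sgn_eq zero_neq_one scaleR_one inverse_1 div_by_1 of_real_1)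
  define \<kappa> where "\<kappa> = Arg c / (2 * pi)"
  have c: "c = cis (2 * pi * \<kappa>)" using \<open>cis (Arg c) = c\<close> by (simp add: \<kappa>_def)
  have "c = 1"
  proof (rule ccontr)
    assume "c \<noteq> 1"
    have N: "of_int n + \<kappa> \<noteq> 0" for n
    proof
      assume "of_int n + \<kappa> = 0"
      then have "\<kappa> = of_int (- n)" by simp
      then have "c = 1" unfolding c using cis_multiple_2pi[of "of_int (- n)"] by simp
      then show False using \<open>c \<noteq> 1\<close> by simp
    qed
    define s where "s n = complex_of_real (of_int n + \<kappa> - B / \<omega> + 1 / (4 * \<omega>\<^sup>2 * (of_int n + \<kappa>)))" for n :: int
    have rec: "s n * fourier \<kappa> v n = \<mu> * (fourier \<kappa> v (n - 1) + fourier \<kappa> v (n + 1))"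
      if "?fl c u v" for u v n
      using fourier_three_term[OF \<omega> that[unfolded c] N] by (simp only: s_def \<mu>_def)
    have "fourier \<kappa> v1 0 * fourier \<kappa> v2 1 = fourier \<kappa> v1 1 * fourier \<kappa> v2 0"
      by (rule three_term_decaying_casoratian[OF \<mu> rec[OF 1] rec[OF 2]
            fourier_decay[OF \<omega> 1[unfolded c]] fourier_decay[OF \<omega> 2[unfolded c]]])
    then have "fourier \<kappa> v1 0 * fourier \<kappa> v2 1 = fourier \<kappa> v2 0 * fourier \<kappa> v1 1" by (simp add: mult.commute)
    from degenerate_system_solution[OF this]
    obtain \<alpha> \<beta> where \<alpha>\<beta>: "\<alpha> \<noteq> 0 \<or> \<beta> \<noteq> 0" "\<alpha> * fourier \<kappa> v1 0 + \<beta> * fourier \<kappa> v2 0 = 0"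
      "\<alpha> * fourier \<kappa> v1 1 + \<beta> * fourier \<kappa> v2 1 = 0" by blast
    define u v where "u t = \<alpha> * u1 t + \<beta> * u2 t" and "v t = \<alpha> * v1 t + \<beta> * v2 t" for t
    have sol: "?fl c u v" unfolding u_def v_def by (rule floquet_solution_combination[OF 1 2])
    then have lin: "linear_solution \<omega> (B / \<omega>) (A / (2 * \<omega>)) u v"
      and per: "u (2 * pi) = cis (2 * pi * \<kappa>) * u 0" "v (2 * pi) = cis (2 * pi * \<kappa>) * v 0"
      by (simp_all only: floquet_solution_def c)
    have lin12: "linear_solution \<omega> (B / \<omega>) (A / (2 * \<omega>)) u1 v1" "linear_solution \<omega> (B / \<omega>) (A / (2 * \<omega>)) u2 v2"
      using 1 2 by (simp_all add: floquet_solution_def)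
    have "fourier \<kappa> v n = \<alpha> * fourier \<kappa> v1 n + \<beta> * fourier \<kappa> v2 n" for n
      unfolding v_def fourier_mult[symmetric]
      by (intro fourier_add continuous_intros linear_solution_continuous[OF lin12(1)] linear_solution_continuous[OF lin12(2)])
    then have "fourier \<kappa> v 0 = 0" "fourier \<kappa> v 1 = 0" using \<alpha>\<beta> by simp_all
    from three_term_zero[OF \<mu> rec[OF sol] this] have V: "fourier \<kappa> v n = 0" for n .
    have U: "fourier \<kappa> u n = 0" for n
    proof -
      have "complex_of_real (of_int n + \<kappa>) \<noteq> 0" using N[of n] by (simp only: of_real_eq_0_iff not_False_eq_True)
      then show ?thesis
        using fourier_linear_solution(1)[OF \<omega> sol[unfolded c], of n] V[of n] \<omega> by simp
    qed
    have "u 0 = 0" "v 0 = 0"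
      using fourier_unique[OF linear_solution_continuous(1)[OF lin] per(1) U, of 0]
        fourier_unique[OF linear_solution_continuous(2)[OF lin] per(2) V, of 0] by simp_all
    then show False
      using nondegenerate_combination_nonzero[OF indep, of \<alpha> \<beta>] \<alpha>\<beta>(1) by (simp add: u_def v_def)
  qed
  then show "\<exists>u1 v1 u2 v2.
    floquet_solution \<omega> (B / \<omega>) (A / (2 * \<omega>)) 1 u1 v1 \<and>
    floquet_solution \<omega> (B / \<omega>) (A / (2 * \<omega>)) 1 u2 v2 \<and>
    u1 0 * v2 0 \<noteq> u2 0 * v1 0"
    using 1 2 indep by blast
  have "cis (2 * pi * (B / \<omega>)) = 1" using cc \<open>c = 1\<close> by simp
  then have "cos (2 * pi * (B / \<omega>)) = 1" by (simp add: complex_eq_iff)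
  then obtain k :: int where "2 * pi * (B / \<omega>) = of_int k * 2 * pi" using cos_one_2pi_int by blast
  then have "B = of_int k * \<omega>" using \<omega> by (simp add: field_simps)
  then show "\<exists>k::int. B = of_int k * \<omega>" by blast
qed

section \<open>A constant advance forces \<open>\<xi>\<close> to vanish\<close>

text \<open>In terms of \<open>w = exp (- i t)\<close> the factor \<open>exp (\<mu> w)\<close> turns the linear system into one whose Fourier
recurrences shift the index in one direction only. Eliminating \<open>s\<close> gives the recurrence of the double confluent
Heun equation for the coefficients of \<open>w\<^sup>n\<close>, which carry the Fourier index \<open>- n\<close>.\<close>

lemma gauge_fourier_recurrence:
  fixes \<omega> q \<mu> :: real
  assumes \<omega>: "\<omega> > 0" and sol: "linear_solution \<omega> q \<mu> u v"
    and per: "u (2 * pi) = u 0" "v (2 * pi) = v 0"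
    and y: "\<And>t. y t = exp (of_real \<mu> * cis (- t)) * u t" and s: "\<And>t. s t = exp (of_real \<mu> * cis (- t)) * v t"
  shows "fourier 0 s m = of_real (2 * \<omega>) * \<i> * (of_int m * fourier 0 y m + of_real \<mu> * fourier 0 y (m + 1))"
    and "(of_int n * (of_int n + of_real q) + of_real ((1 / (2 * \<omega>))\<^sup>2 - \<mu>\<^sup>2)) * fourier 0 y (- n) +
      of_real \<mu> * (of_int n + 1) * fourier 0 y (- (n + 1)) -
      of_real \<mu> * (of_int n + of_real q) * fourier 0 y (- (n - 1)) = 0"
proof -
  let ?g = "\<lambda>t. exp (of_real \<mu> * cis (- t))"
  have w: "complex_of_real \<omega> \<noteq> 0" using \<omega> by simp
  have g: "(?g has_vector_derivative - (\<i> * of_real \<mu> * cis (- t)) * ?g t) (at t)" for t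
  proof -
    have "((\<lambda>t. - t) has_real_derivative - 1) (at t)" by (auto intro!: derivative_eq_intros)
    note has_vector_derivative_exp[OF has_vector_derivative_mult_right[OF has_vector_derivative_cis[OF this], of "of_real \<mu>"]]
    then show ?thesis by (rule has_vector_derivative_eq_rhs) simp
  qed
  have cis_end: "cis (- (2 * pi)) = 1" by (simp add: complex_eq_iff)
  note du = linear_solution_deriv(1)[OF sol] and dv = linear_solution_deriv(2)[OF sol]
  have cont_y: "continuous_on {0..2 * pi} y" and cont_s: "continuous_on {0..2 * pi} s"
    unfolding y[abs_def] s[abs_def] by (intro continuous_intros linear_solution_continuous[OF sol])+
  have twist: "cis (of_int (- 1) * t) = cis (- t)" "cis (of_int 1 * t) = cis t" for t by simp_all
  have dy: "(y has_vector_derivative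
      1 / of_real (2 * \<omega>) * s t + - (\<i> * of_real \<mu>) * (cis (of_int (- 1) * t) * y t)) (at t)" for t
    using has_vector_derivative_mult[OF g du, of t]
    unfolding y[abs_def] s twist by (rule has_vector_derivative_eq_rhs) (simp add: mult_ac)
  have ds: "(s has_vector_derivative
      (\<i> * of_real q * s t + \<i> * of_real \<mu> * (cis (of_int 1 * t) * s t)) + 1 / of_real (2 * \<omega>) * y t) (at t)" for t
  proof -
    have "of_real (2 * cos t) = cis t + cis (- t)" by (simp add: complex_eq_iff)
    then have Q: "\<i> * of_real (q + 2 * \<mu> * cos t) = \<i> * of_real q + \<i> * of_real \<mu> * (cis t + cis (- t))"
      by (simp add: algebra_simps)
    show ?thesis
      using has_vector_derivative_mult[OF g dv, of t]
      unfolding s[abs_def] y twist Q by (rule has_vector_derivative_eq_rhs) (simp add: algebra_simps)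
  qed
  have "fourier 0 (\<lambda>t. 1 / of_real (2 * \<omega>) * s t + - (\<i> * of_real \<mu>) * (cis (of_int (- 1) * t) * y t)) m =
      \<i> * (of_int m + of_real 0) * fourier 0 y m" for m
  proof (rule fourier_deriv[OF dy])
    show "y (2 * pi) = cis (2 * pi * 0) * y 0"
      using per by (simp add: y cis_end)
  qed (intro continuous_intros cont_y cont_s)
  moreover have "fourier 0 (\<lambda>t. 1 / of_real (2 * \<omega>) * s t + - (\<i> * of_real \<mu>) * (cis (of_int (- 1) * t) * y t)) m =
      1 / of_real (2 * \<omega>) * fourier 0 s m + - (\<i> * of_real \<mu>) * fourier 0 y (m - - 1)" for m
    unfolding fourier_mult[symmetric] fourier_shift[symmetric]
    by (rule fourier_add) (intro continuous_intros cont_y cont_s)+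
  ultimately have "1 / of_real (2 * \<omega>) * fourier 0 s m + - (\<i> * of_real \<mu>) * fourier 0 y (m + 1) = \<i> * of_int m * fourier 0 y m" for m
    by simp
  then have S: "fourier 0 s m = of_real (2 * \<omega>) * \<i> * (of_int m * fourier 0 y m + of_real \<mu> * fourier 0 y (m + 1))" for m
    using w by (simp add: field_simps add_eq_0_iff)
  then show "fourier 0 s m = of_real (2 * \<omega>) * \<i> * (of_int m * fourier 0 y m + of_real \<mu> * fourier 0 y (m + 1))" .
  have "fourier 0 (\<lambda>t. (\<i> * of_real q * s t + \<i> * of_real \<mu> * (cis (of_int 1 * t) * s t)) + 1 / of_real (2 * \<omega>) * y t) m =
      \<i> * (of_int m + of_real 0) * fourier 0 s m" for m
  proof (rule fourier_deriv[OF ds])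
    show "s (2 * pi) = cis (2 * pi * 0) * s 0"
      using per by (simp add: s cis_end)
  qed (intro continuous_intros cont_y cont_s)
  moreover have "fourier 0 (\<lambda>t. (\<i> * of_real q * s t + \<i> * of_real \<mu> * (cis (of_int 1 * t) * s t)) + 1 / of_real (2 * \<omega>) * y t) m =
      (\<i> * of_real q * fourier 0 s m + \<i> * of_real \<mu> * fourier 0 s (m - 1)) + 1 / of_real (2 * \<omega>) * fourier 0 y m" for m
    unfolding fourier_mult[symmetric] fourier_shift[symmetric]
    by (subst fourier_add[symmetric], (intro continuous_intros cont_y cont_s)+)+ simp
  ultimately have T: "\<i> * of_real q * fourier 0 s m + \<i> * of_real \<mu> * fourier 0 s (m - 1) + 1 / of_real (2 * \<omega>) * fourier 0 y m =
      \<i> * of_int m * fourier 0 s m" for m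
    by simp
  define a b c where "a = fourier 0 y (- (n - 1))" and "b = fourier 0 y (- n)" and "c = fourier 0 y (- (n + 1))"
  define N Q M W where "N = complex_of_int n" and "Q = complex_of_real q" and "M = complex_of_real \<mu>"
    and "W = complex_of_real (2 * \<omega>)"
  have S1: "fourier 0 s (- n) = W * \<i> * (M * a - N * b)"
    using S[of "- n"] by (simp add: a_def b_def N_def M_def W_def)
  have idx: "- n - 1 = - (n + 1)" "- (n + 1) + 1 = - n" by simp_all
  have "fourier 0 s (- n - 1) = W * \<i> * (of_int (- (n + 1)) * c + M * b)"
    using S[of "- (n + 1)"] unfolding idx b_def[symmetric] c_def[symmetric] W_def[symmetric] M_def[symmetric] .
  also have "complex_of_int (- (n + 1)) = - (N + 1)" by (simp add: N_def)
  finally have S2: "fourier 0 s (- n - 1) = W * \<i> * (M * b - (N + 1) * c)" by (simp add: algebra_simps)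
  have W0: "W \<noteq> 0" using w by (simp add: W_def)
  have "\<i> * Q * (W * \<i> * (M * a - N * b)) + \<i> * M * (W * \<i> * (M * b - (N + 1) * c)) + 1 / W * b =
      \<i> * (- N) * (W * \<i> * (M * a - N * b))"
    using T[of "- n"] unfolding S1 S2 by (simp add: N_def Q_def M_def W_def b_def)
  moreover have "\<i> * Q * (W * \<i> * z) = - (W * (Q * z))" "\<i> * M * (W * \<i> * z) = - (W * (M * z))"
      "\<i> * (- N) * (W * \<i> * z) = W * (N * z)" for z
    by (simp_all add: algebra_simps)
  ultimately have "W * ((N + Q) * (M * a - N * b) + M * (M * b - (N + 1) * c)) = 1 / W * b"
    by (simp only: ring_distribs) (simp add: algebra_simps)
  then have "(N + Q) * (M * a - N * b) + M * (M * b - (N + 1) * c) = (1 / W)\<^sup>2 * b"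
    using W0 by (simp add: field_simps power2_eq_square)
  then have "(N * (N + Q) + ((1 / W)\<^sup>2 - M\<^sup>2)) * b + M * (N + 1) * c - M * (N + Q) * a = 0"
    by (simp add: algebra_simps power2_eq_square)
  then show "(of_int n * (of_int n + of_real q) + of_real ((1 / (2 * \<omega>))\<^sup>2 - \<mu>\<^sup>2)) * fourier 0 y (- n) +
      of_real \<mu> * (of_int n + 1) * fourier 0 y (- (n + 1)) -
      of_real \<mu> * (of_int n + of_real q) * fourier 0 y (- (n - 1)) = 0"
    by (simp add: a_def b_def c_def N_def Q_def M_def W_def)
qed

text \<open>The rescaling by \<open>\<mu>\<^sup>n / n!\<close> turns the Heun recurrence into the one solved by \<open>tail_limit\<close>.\<close>

lemma coefficient_recurrence_iff:
  fixes e f :: "nat \<Rightarrow> complex" and lam \<mu> :: real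
  assumes \<mu>: "\<mu> \<noteq> 0" and f: "\<And>n. f n = fact n * e n / of_real \<mu> ^ n"
  shows "(of_nat (Suc n) * (of_nat (Suc n) + of_nat l) + of_real lam) * e (Suc n) +
      of_real \<mu> * (of_nat (Suc n) + 1) * e (Suc (Suc n)) = of_real \<mu> * (of_nat (Suc n) + of_nat l) * e n
    \<longleftrightarrow> f n = of_real (row_coeff1 l lam (Suc n)) * f (Suc n) + of_real (row_coeff2 l \<mu> (Suc n)) * f (Suc (Suc n))"
    (is "?lhs = ?rhs \<longleftrightarrow> _")
proof -
  define N where "N = complex_of_nat (Suc n)"
  define L M P where "L = N + of_nat l" and "M = complex_of_real \<mu>" and "P = N + 1"
  have "P = of_nat (Suc (Suc n))" "L = of_nat (Suc n + l)" by (simp_all add: N_def L_def P_def)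
  then have nz: "N \<noteq> 0" "P \<noteq> 0" "L \<noteq> 0" "M \<noteq> 0"
    using \<mu> by (simp_all only: N_def M_def of_nat_eq_0_iff of_real_eq_0_iff) simp_all
  define c where "c = M ^ n / fact n"
  have fact: "fact (Suc n) = N * (fact n :: complex)" "fact (Suc (Suc n)) = P * (N * (fact n :: complex))"
    by (simp_all add: N_def P_def)
  have e: "e n = c * f n" "e (Suc n) = c * (M / N) * f (Suc n)" "e (Suc (Suc n)) = c * (M * M / (N * P)) * f (Suc (Suc n))"
    using nz unfolding f c_def fact M_def[symmetric] by (simp_all add: field_simps)
  let ?g = "(1 + of_real lam / (L * N)) * f (Suc n) + M\<^sup>2 / (L * N) * f (Suc (Suc n))"
  have "?lhs = c * M * L * ?g" "?rhs = c * M * L * f n"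
    using nz unfolding e N_def[symmetric] L_def[symmetric] M_def[symmetric] P_def[symmetric]
    by (simp_all add: field_simps power2_eq_square)
  moreover have "c * M * L \<noteq> 0" using nz by (simp add: c_def)
  ultimately have "?lhs = ?rhs \<longleftrightarrow> f n = ?g" by auto
  then show ?thesis by (simp add: row_coeff1_def row_coeff2_def N_def L_def M_def add_ac)
qed

text \<open>The Casoratian of \<open>f\<close> and \<open>tail_limit\<close> picks up the factor \<open>\<mu>\<^sup>2 / (n (l + n))\<close> in each step downwards.
Over \<open>n\<close> steps this gains \<open>(n!)\<^sup>2\<close>, whereas \<open>f\<close> grows at most like \<open>n!\<close>; so the Casoratian vanishes.\<close>

lemma bounded_coefficients_parallel_tail_limit:
  fixes e f :: "nat \<Rightarrow> complex" and lam \<mu> :: real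
  assumes \<mu>: "\<mu> \<noteq> 0" and f: "\<And>n. f n = fact n * e n / of_real \<mu> ^ n"
    and rec: "\<And>n. f n = of_real (row_coeff1 l lam (Suc n)) * f (Suc n) + of_real (row_coeff2 l \<mu> (Suc n)) * f (Suc (Suc n))"
    and bound: "\<And>n. norm (e n) \<le> C"
  shows "f 0 * of_real (tail_limit l lam \<mu> 1) = f 1 * of_real (tail_limit l lam \<mu> 0)"
proof -
  let ?h = "\<lambda>n. complex_of_real (tail_limit l lam \<mu> n)" and ?K = "row_bound lam \<mu>"
  define W where "W n = f n * ?h (Suc n) - f (Suc n) * ?h n" for n
  have W: "W n = - of_real (row_coeff2 l \<mu> (Suc n)) * W (Suc n)" for n
  proof -
    have "?h n = of_real (row_coeff1 l lam (Suc n)) * ?h (Suc n) + of_real (row_coeff2 l \<mu> (Suc n)) * ?h (Suc (Suc n))"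
      by (subst tail_limit_recurrence) simp
    then show ?thesis unfolding W_def by (subst rec[of n]) (simp add: algebra_simps)
  qed
  have K: "?K \<ge> 0" by (simp add: row_bound_def)
  have C: "C \<ge> 0" using bound[of 0] norm_ge_zero order_trans by blast
  have W0: "norm (W 0) \<le> (\<mu>\<^sup>2) ^ n / (fact n)\<^sup>2 * norm (W n)" for n
  proof (induction n)
    case (Suc n)
    have "norm (W n) = row_coeff2 l \<mu> (Suc n) * norm (W (Suc n))"
      using row_coeff_bounds(2)[of "Suc n" l \<mu>] by (subst W) (simp add: norm_mult)
    also have "\<dots> \<le> \<mu>\<^sup>2 / (real (Suc n))\<^sup>2 * norm (W (Suc n))"
      by (intro mult_right_mono row_coeff_bounds(3)) auto
    finally have "norm (W n) \<le> \<mu>\<^sup>2 / (real (Suc n))\<^sup>2 * norm (W (Suc n))" .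
    then have "(\<mu>\<^sup>2) ^ n / (fact n)\<^sup>2 * norm (W n) \<le> (\<mu>\<^sup>2) ^ n / (fact n)\<^sup>2 * (\<mu>\<^sup>2 / (real (Suc n))\<^sup>2 * norm (W (Suc n)))"
      by (intro mult_left_mono) auto
    also have "\<dots> = (\<mu>\<^sup>2) ^ Suc n / (fact (Suc n))\<^sup>2 * norm (W (Suc n))"
      by (simp add: power_mult_distrib mult_ac del: of_nat_Suc)
    finally show ?case using Suc by linarith
  qed simp
  have fb: "norm (f n) \<le> fact n * C / \<bar>\<mu>\<bar> ^ n" for n
    unfolding f by (simp add: norm_mult norm_divide norm_power divide_right_mono mult_left_mono bound)
  have Wn: "norm (W n) \<le> fact n * C * ?K / \<bar>\<mu>\<bar> ^ n * ((1 + 1 / \<bar>\<mu>\<bar>) * 2 ^ n)" for n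
  proof -
    have "norm (W n) \<le> norm (f n) * norm (?h (Suc n)) + norm (f (Suc n)) * norm (?h n)"
      unfolding W_def norm_mult[symmetric] by (rule norm_triangle_ineq4)
    also have "\<dots> \<le> fact n * C / \<bar>\<mu>\<bar> ^ n * ?K + fact (Suc n) * C / \<bar>\<mu>\<bar> ^ Suc n * ?K"
      by (intro add_mono mult_mono fb) (auto simp: tail_limit_bounded C simp del: fact_Suc power_Suc)
    also have "\<dots> = fact n * C * ?K / \<bar>\<mu>\<bar> ^ n * (1 + real (Suc n) / \<bar>\<mu>\<bar>)"
      using \<mu> by (simp add: field_simps)
    also have "\<dots> \<le> fact n * C * ?K / \<bar>\<mu>\<bar> ^ n * ((1 + 1 / \<bar>\<mu>\<bar>) * 2 ^ n)"
    proof (intro mult_left_mono)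
      have "Suc n \<le> 2 ^ n" by (induction n) auto
      then have "real (Suc n) \<le> 2 ^ n" by (metis of_nat_le_iff of_nat_numeral of_nat_power)
      then have "1 + real (Suc n) / \<bar>\<mu>\<bar> \<le> 2 ^ n + 2 ^ n / \<bar>\<mu>\<bar>"
        by (intro add_mono divide_right_mono) auto
      then show "1 + real (Suc n) / \<bar>\<mu>\<bar> \<le> (1 + 1 / \<bar>\<mu>\<bar>) * 2 ^ n" by (simp add: distrib_right)
    qed (use C K in auto)
    finally show ?thesis .
  qed
  have "norm (W 0) \<le> C * ?K * (1 + 1 / \<bar>\<mu>\<bar>) * ((2 * \<bar>\<mu>\<bar>) ^ n / fact n)" for n
  proof -
    have "norm (W 0) \<le> (\<mu>\<^sup>2) ^ n / (fact n)\<^sup>2 * (fact n * C * ?K / \<bar>\<mu>\<bar> ^ n * ((1 + 1 / \<bar>\<mu>\<bar>) * 2 ^ n))"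
      by (rule order_trans[OF W0 mult_left_mono[OF Wn]]) simp
    also have "(\<mu>\<^sup>2) ^ n = \<bar>\<mu>\<bar> ^ n * \<bar>\<mu>\<bar> ^ n" by (simp add: power2_eq_square power_mult_distrib flip: power_abs abs_mult)
    also have "\<bar>\<mu>\<bar> ^ n * \<bar>\<mu>\<bar> ^ n / (fact n)\<^sup>2 * (fact n * C * ?K / \<bar>\<mu>\<bar> ^ n * ((1 + 1 / \<bar>\<mu>\<bar>) * 2 ^ n)) =
        C * ?K * (1 + 1 / \<bar>\<mu>\<bar>) * ((2 * \<bar>\<mu>\<bar>) ^ n / fact n)"
      using \<mu> by (simp add: power2_eq_square power_mult_distrib)
    finally show ?thesis .
  qed
  moreover have "(\<lambda>n. C * ?K * (1 + 1 / \<bar>\<mu>\<bar>) * ((2 * \<bar>\<mu>\<bar>) ^ n / fact n)) \<longlonglongrightarrow> 0"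
    using summable_LIMSEQ_zero[OF summable_exp[of "2 * \<bar>\<mu>\<bar>"]]
    by (intro tendsto_mult_right_zero) (simp add: divide_inverse mult.commute)
  ultimately have "norm (W 0) \<le> 0" by (intro LIMSEQ_le_const) auto
  then show ?thesis by (simp add: W_def)
qed

text \<open>With multiplier \<open>1\<close> the recurrence for the Fourier coefficients of \<open>v\<close> splits at the index \<open>0\<close>, where the
coefficient vanishes because \<open>v\<close> is a derivative. Hence a combination of the two independent solutions
has only nonpositive modes. It is a power series in \<open>w = exp (- i t)\<close>; its rescaled coefficients are a multiple of
\<open>tail_limit\<close>, and its recurrence at \<open>w\<^sup>0\<close> reads \<open>\<xi> = 0\<close>.\<close>

lemma advance_const_imp_xi_zero:
  assumes \<omega>: "\<omega> > 0" and A: "A \<noteq> 0" and B: "B = real l * \<omega>"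
    and \<mu>_def: "\<mu> = A / (2 * \<omega>)" and lam: "lam = (1 / (2 * \<omega>))\<^sup>2 - \<mu>\<^sup>2"
    and D: "\<And>x. advance \<omega> (B, A) x = 2 * pi * of_int r"
  shows "\<xi> l lam \<mu> = 0"
proof -
  have \<mu>: "\<mu> \<noteq> 0" using A \<omega> by (simp add: \<mu>_def)
  have q: "B / \<omega> = real l" using B \<omega> by simp
  obtain u1 v1 u2 v2 where
    1: "floquet_solution \<omega> (real l) \<mu> 1 u1 v1" and 2: "floquet_solution \<omega> (real l) \<mu> 1 u2 v2" and
    indep: "u1 0 * v2 0 \<noteq> u2 0 * v1 0"
    using advance_const_imp_periodic_pair(1)[OF \<omega> A D] unfolding q \<mu>_def[symmetric] by blast
  \<comment> \<open>Mode \<open>0\<close> of \<open>v\<close> vanishes in any case; the combination also removes mode \<open>1\<close>, hence all positive modes.\<close>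
  obtain \<alpha> \<beta> where \<alpha>\<beta>: "\<alpha> \<noteq> 0 \<or> \<beta> \<noteq> 0" "\<alpha> * fourier 0 v1 1 + \<beta> * fourier 0 v2 1 = 0"
    using degenerate_system_solution[of "fourier 0 v1 1" 0 "fourier 0 v2 1" 0] by auto
  define u v where "u t = \<alpha> * u1 t + \<beta> * u2 t" and "v t = \<alpha> * v1 t + \<beta> * v2 t" for t
  have fl: "floquet_solution \<omega> (real l) \<mu> (cis (2 * pi * 0)) u v"
    using floquet_solution_combination[OF 1 2] by (simp add: u_def[abs_def] v_def[abs_def])
  then have sol: "linear_solution \<omega> (real l) \<mu> u v" and per: "u (2 * pi) = u 0" "v (2 * pi) = v 0"
    by (simp_all add: floquet_solution_def)
  have lin12: "linear_solution \<omega> (real l) \<mu> u1 v1" "linear_solution \<omega> (real l) \<mu> u2 v2"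
    using 1 2 by (simp_all add: floquet_solution_def)
  have "\<not> (u 0 = 0 \<and> v 0 = 0)"
    using nondegenerate_combination_nonzero[OF indep, of \<alpha> \<beta>] \<alpha>\<beta>(1) by (auto simp: u_def v_def)
  note cont = linear_solution_continuous[OF sol]
  have V0: "fourier 0 v 0 = 0" using fourier_linear_solution(1)[OF \<omega> fl, of 0] by simp
  have V1: "fourier 0 v 1 = 0"
  proof -
    have "fourier 0 v 1 = \<alpha> * fourier 0 v1 1 + \<beta> * fourier 0 v2 1"
      unfolding v_def fourier_mult[symmetric]
      by (intro fourier_add continuous_intros linear_solution_continuous[OF lin12(1)] linear_solution_continuous[OF lin12(2)])
    then show ?thesis using \<alpha>\<beta> by simp
  qed
  have V: "fourier 0 v (int n) = 0 \<and> fourier 0 v (int (Suc n)) = 0" for n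
  proof (induction n)
    case (Suc n)
    then have "of_real \<mu> * fourier 0 v (int (Suc n) + 1) = 0"
      using fourier_three_term[OF \<omega> fl, of "int (Suc n)"] by simp
    then show ?case using Suc \<mu> by (simp add: add.commute)
  qed (simp add: V0 V1)
  have U: "fourier 0 u (int (Suc n)) = 0" for n
  proof -
    have "of_int (int (Suc n)) + of_real 0 = (of_nat (Suc n) :: complex)" by simp
    then show ?thesis
      using fourier_linear_solution(1)[OF \<omega> fl, of "int (Suc n)"] V[of n] \<omega>
        of_nat_neq_0[of n, where ?'a = complex]
      by (simp only: mult_eq_0_iff) simp
  qed
  define y s where "y t = exp (of_real \<mu> * cis (- t)) * u t" and "s t = exp (of_real \<mu> * cis (- t)) * v t" for t
  note gauge = gauge_fourier_recurrence[OF \<omega> sol per y_def s_def]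
  have cont_y: "continuous_on S y" and cont_s: "continuous_on S s" for S
    unfolding y_def[abs_def] s_def[abs_def] by (intro continuous_intros cont)+
  \<comment> \<open>The gauge factor is a series in \<open>cis (- t)\<close> and creates no positive modes.\<close>
  have Y: "fourier 0 y (int (Suc n)) = 0" for n
  proof -
    define c :: "nat \<Rightarrow> complex" where "c k = of_real \<mu> ^ k /\<^sub>R fact k" for k
    have "(\<lambda>k. c k * fourier 0 u (int (Suc n) + int k)) sums
        fourier 0 (\<lambda>t. u t * (\<Sum>k. c k * cis (- t) ^ k)) (int (Suc n))"
      unfolding c_def by (rule fourier_power_series[OF cont(1) summable_norm_exp])
    moreover have "fourier 0 u (int (Suc n) + int k) = 0" for k
      unfolding of_nat_add[symmetric] add_Suc by (rule U)
    moreover have "(\<Sum>k. c k * cis (- t) ^ k) = exp (of_real \<mu> * cis (- t))" for t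
      unfolding exp_def c_def by (simp add: power_mult_distrib)
    ultimately have "(\<lambda>k. 0) sums fourier 0 y (int (Suc n))" by (simp add: y_def[abs_def] mult.commute)
    then show ?thesis by (metis sums_0 sums_unique2)
  qed
  define e where "e n = fourier 0 y (- int n)" for n
  obtain C where C: "\<And>n. norm (e n) \<le> C" using fourier_bounded[OF cont_y] unfolding e_def by blast
  have e0: "of_real lam * e 0 + of_real \<mu> * e 1 = 0"
    using gauge(2)[of 0] Y[of 0] by (simp add: e_def lam)
  have erec: "(of_nat (Suc n) * (of_nat (Suc n) + of_nat l) + of_real lam) * e (Suc n) +
      of_real \<mu> * (of_nat (Suc n) + 1) * e (Suc (Suc n)) = of_real \<mu> * (of_nat (Suc n) + of_nat l) * e n" for n
  proof -
    have "- (int (Suc n) + 1) = - int (Suc (Suc n))" "- (int (Suc n) - 1) = - int n" by simp_all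
    then show ?thesis
      using gauge(2)[of "int (Suc n)"]
      unfolding e_def lam of_int_of_nat_eq of_real_of_nat_eq by (simp only: right_minus_eq)
  qed
  define f where "f n = fact n * e n / of_real \<mu> ^ n" for n
  note frec = erec[unfolded coefficient_recurrence_iff[OF \<mu> f_def]]
  note par = bounded_coefficients_parallel_tail_limit[OF \<mu> f_def frec C]
  have f0: "of_real lam * f 0 + of_real (\<mu>\<^sup>2) * f 1 = 0"
    using e0 \<mu> by (simp add: f_def power2_eq_square)
  let ?h0 = "complex_of_real (tail_limit l lam \<mu> 0)" and ?h1 = "complex_of_real (tail_limit l lam \<mu> 1)"
  have xi: "complex_of_real (\<xi> l lam \<mu>) = of_real lam * ?h0 + of_real (\<mu>\<^sup>2) * ?h1"
    by (simp add: xi_eq_tail_limits)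
  \<comment> \<open>\<open>(f 0, f 1)\<close> is parallel to \<open>(?h0, ?h1)\<close> and annihilated by \<open>(\<lambda>, \<mu>\<^sup>2)\<close>.\<close>
  have "of_real (\<xi> l lam \<mu>) * f 0 = ?h0 * (of_real lam * f 0) + of_real (\<mu>\<^sup>2) * (f 0 * ?h1)"
    unfolding xi by (simp add: algebra_simps)
  also have "\<dots> = ?h0 * (of_real lam * f 0 + of_real (\<mu>\<^sup>2) * f 1)" unfolding par by (simp add: algebra_simps)
  finally have xf0: "of_real (\<xi> l lam \<mu>) * f 0 = 0" unfolding f0 by simp
  have "of_real (\<xi> l lam \<mu>) * f 1 = of_real lam * (f 1 * ?h0) + of_real (\<mu>\<^sup>2) * f 1 * ?h1"
    unfolding xi by (simp add: algebra_simps)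
  also have "\<dots> = ?h1 * (of_real lam * f 0 + of_real (\<mu>\<^sup>2) * f 1)" unfolding par[symmetric] by (simp add: algebra_simps)
  finally have xf1: "of_real (\<xi> l lam \<mu>) * f 1 = 0" unfolding f0 by simp
  show ?thesis
  proof (rule ccontr)
    assume "\<xi> l lam \<mu> \<noteq> 0"
    then have f01: "f 0 = 0" "f 1 = 0" using xf0 xf1 by simp_all
    have "f n = 0 \<and> f (Suc n) = 0" for n
    proof (induction n)
      case (Suc n)
      have "row_coeff2 l \<mu> (Suc n) \<noteq> 0" using \<mu> by (simp add: row_coeff2_def)
      then show ?case using frec[of n] Suc by simp
    qed (use f01 in simp)
    then have e_zero: "e n = 0" for n using \<mu> by (simp add: f_def)
    have y_zero: "fourier 0 y m = 0" for m
    proof (cases "m \<le> 0")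
      case True
      then show ?thesis using e_zero[of "nat (- m)"] by (simp add: e_def)
    next
      case False
      then show ?thesis using Y[of "nat (m - 1)"] by simp
    qed
    then have s_zero: "fourier 0 s m = 0" for m using gauge(1)[of m] by simp
    have cis_end: "cis (- (2 * pi)) = 1" by (simp add: complex_eq_iff)
    have "y 0 = 0" by (rule fourier_unique[OF cont_y _ y_zero]) (simp_all add: y_def per cis_end)
    moreover have "s 0 = 0" by (rule fourier_unique[OF cont_s _ s_zero]) (simp_all add: s_def per cis_end)
    ultimately show False using \<open>\<not> (u 0 = 0 \<and> v 0 = 0)\<close> by (simp add: y_def s_def)
  qed
qed

section \<open>A zero of \<open>\<xi>\<close> forces a constant advance\<close>

lemma fourier_cnj: "fourier 0 (\<lambda>t. cnj (f t)) n = cnj (fourier 0 f (- n))"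
  unfolding fourier_def integral_cnj by (simp add: cis_cnj)

lemma fourier_one: "fourier 0 (\<lambda>t. 1) n = (if n = 0 then of_real (2 * pi) else 0)"
proof (cases "n = 0")
  case True
  then show ?thesis by (simp add: fourier_def scaleR_conv_of_real)
next
  case False
  have "fourier 0 (\<lambda>t. 0) n = \<i> * (of_int n + of_real 0) * fourier 0 (\<lambda>t. 1) n"
    by (rule fourier_deriv) auto
  then show ?thesis using False by (simp add: fourier_def)
qed

lemma fourier_coefficient_power_series:
  fixes c :: "nat \<Rightarrow> complex"
  assumes c: "summable (\<lambda>k. norm (c k))"
  shows "fourier 0 (\<lambda>t. \<Sum>k. c k * cis (- t) ^ k) (- int m) = of_real (2 * pi) * c m"
    and "n > 0 \<Longrightarrow> fourier 0 (\<lambda>t. \<Sum>k. c k * cis (- t) ^ k) n = 0"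
proof -
  have sums: "(\<lambda>k. c k * fourier 0 (\<lambda>t. 1) (n + int k)) sums fourier 0 (\<lambda>t. \<Sum>k. c k * cis (- t) ^ k) n" for n
    using fourier_power_series[OF _ c, of "\<lambda>t. 1" 0 n] by simp
  have "(\<lambda>k. c k * fourier 0 (\<lambda>t. 1) (- int m + int k)) = (\<lambda>k. if k = m then c k * of_real (2 * pi) else 0)"
    by (auto simp: fourier_one)
  then have "(\<lambda>k. if k = m then c k * of_real (2 * pi) else 0) sums
      fourier 0 (\<lambda>t. \<Sum>k. c k * cis (- t) ^ k) (- int m)"
    using sums[of "- int m"] by (simp only:)
  from sums_unique2[OF this sums_single]
  show "fourier 0 (\<lambda>t. \<Sum>k. c k * cis (- t) ^ k) (- int m) = of_real (2 * pi) * c m"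
    by (simp only: mult.commute)
  assume "n > 0"
  then have "(\<lambda>k. c k * fourier 0 (\<lambda>t. 1) (n + int k)) = (\<lambda>k. 0)" by (auto simp: fourier_one)
  then have "(\<lambda>k. 0) sums fourier 0 (\<lambda>t. \<Sum>k. c k * cis (- t) ^ k) n"
    using sums[of n] by (simp only:)
  from sums_unique2[OF this sums_zero] show "fourier 0 (\<lambda>t. \<Sum>k. c k * cis (- t) ^ k) n = 0" .
qed

text \<open>The coefficients \<open>e n\<close> are the rescaled \<open>tail_limit\<close>, so their power series is entire; for \<open>n > 0\<close> they satisfy the
Heun recurrence, and \<open>\<xi> = 0\<close> supplies it at \<open>n = 0\<close>. The solution is analytic at \<open>w = 0\<close>, i.e. where
\<open>exp (i t)\<close>, continued to complex \<open>t\<close>, becomes infinite.\<close>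

lemma xi_zero_imp_solution_analytic_at_infinity:
  fixes \<omega> \<mu> lam :: real
  assumes \<omega>: "\<omega> > 0" and \<mu>: "\<mu> \<noteq> 0" and lam: "lam = (1 / (2 * \<omega>))\<^sup>2 - \<mu>\<^sup>2" and xi: "\<xi> l lam \<mu> = 0"
  shows "\<exists>e d :: nat \<Rightarrow> complex. summable (\<lambda>n. norm (e n)) \<and> summable (\<lambda>n. norm (d n)) \<and> (\<exists>n. e n \<noteq> 0) \<and>
    linear_solution \<omega> (real l) \<mu> (\<lambda>t. exp (- of_real \<mu> * cis (- t)) * (\<Sum>n. e n * cis (- t) ^ n))
      (\<lambda>t. - (of_real (2 * \<omega>) * \<i>) * cis (- t) * exp (- of_real \<mu> * cis (- t)) * (\<Sum>n. d n * cis (- t) ^ n))"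
proof -
  let ?K = "row_bound lam \<mu>"
  define M where "M = complex_of_real \<mu>"
  define W where "W = complex_of_real (2 * \<omega>)"
  have W: "W \<noteq> 0" using \<omega> by (simp add: W_def)
  have M: "M \<noteq> 0" using \<mu> by (simp add: M_def)
  define e where "e n = complex_of_real \<mu> ^ n / fact n * of_real (tail_limit l lam \<mu> n)" for n
  \<comment> \<open>The coefficients of \<open>Y' - \<mu> Y\<close>, which is \<open>exp (\<mu> w)\<close> times the derivative of \<open>exp (- \<mu> w) Y\<close>.\<close>
  define d where "d n = of_nat (Suc n) * e (Suc n) - M * e n" for n
  have e_summ: "summable (\<lambda>n. e n * z ^ n)" for z
  proof (rule summable_comparison_test')
    show "summable (\<lambda>n. ?K * ((norm (M * z)) ^ n / fact n))"
      using summable_exp[of "norm (M * z)"] by (intro summable_mult) (simp add: divide_inverse mult.commute)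
    fix n
    have "norm (e n * z ^ n) = \<bar>tail_limit l lam \<mu> n\<bar> * (norm (M * z) ^ n / fact n)"
      by (simp add: e_def M_def norm_mult norm_divide norm_power power_mult_distrib)
    also have "\<dots> \<le> ?K * (norm (M * z) ^ n / fact n)"
      by (intro mult_right_mono tail_limit_bounded) auto
    finally show "norm (e n * z ^ n) \<le> ?K * (norm (M * z) ^ n / fact n)" .
  qed
  have d_eq: "d n * z ^ n = diffs e n * z ^ n - M * (e n * z ^ n)" for n z
    by (simp add: d_def diffs_def algebra_simps)
  note de_summ = termdiff_converges_all[OF e_summ]
  have d_summ: "summable (\<lambda>n. d n * z ^ n)" for z
    unfolding d_eq by (intro summable_diff summable_mult e_summ de_summ)
  note dd_summ = termdiff_converges_all[OF d_summ]
  define Y where "Y z = (\<Sum>n. e n * z ^ n)" for z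
  define T where "T z = (\<Sum>n. d n * z ^ n)" for z
  define T' where "T' z = (\<Sum>n. diffs d n * z ^ n)" for z
  have Y_deriv: "(Y has_field_derivative M * Y z + T z) (at z)" for z
  proof -
    have "T z = (\<Sum>n. diffs e n * z ^ n) - M * Y z"
      unfolding T_def Y_def d_eq by (simp add: suminf_diff[symmetric] suminf_mult summable_mult e_summ de_summ)
    then have "M * Y z + T z = (\<Sum>n. diffs e n * z ^ n)" by simp
    then show ?thesis unfolding Y_def[abs_def] using termdiffs_strong_converges_everywhere[OF e_summ] by simp
  qed
  have T_deriv: "(T has_field_derivative T' z) (at z)" for z
    unfolding T_def[abs_def] T'_def by (rule termdiffs_strong_converges_everywhere[OF d_summ])
  have lamW: "of_real lam = (1 / W)\<^sup>2 - M\<^sup>2" by (simp add: lam W_def M_def)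
  have e0: "of_real lam * e 0 + M * e 1 = 0"
  proof -
    have "of_real lam * e 0 + M * e 1 = of_real (\<xi> l lam \<mu>)"
      by (simp add: xi_eq_tail_limits e_def M_def power2_eq_square)
    then show ?thesis by (simp add: xi)
  qed
  \<comment> \<open>The coefficients of \<open>z ((l + 1) T + z T')\<close>.\<close>
  define r where "r n = (case n of 0 \<Rightarrow> 0 | Suc k \<Rightarrow> (of_nat (Suc k) + of_nat l) * d k)" for n
  have rec: "r n + M * d n + (1 / W)\<^sup>2 * e n = 0" for n
  proof (cases n)
    case 0
    then show ?thesis using e0 by (simp add: r_def d_def lamW algebra_simps power2_eq_square)
  next
    case (Suc k)
    have h: "complex_of_real (tail_limit l lam \<mu> n) = fact n * e n / of_real \<mu> ^ n" for n
      using \<mu> by (simp add: e_def)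
    have "complex_of_real (tail_limit l lam \<mu> k) = of_real (row_coeff1 l lam (Suc k)) * of_real (tail_limit l lam \<mu> (Suc k)) +
        of_real (row_coeff2 l \<mu> (Suc k)) * of_real (tail_limit l lam \<mu> (Suc (Suc k)))"
      by (subst tail_limit_recurrence) simp
    then have "(of_nat (Suc k) * (of_nat (Suc k) + of_nat l) + ((1 / W)\<^sup>2 - M\<^sup>2)) * e (Suc k) +
      M * (of_nat (Suc k) + 1) * e (Suc (Suc k)) = M * (of_nat (Suc k) + of_nat l) * e k"
      unfolding coefficient_recurrence_iff[OF \<mu> h, symmetric] lamW M_def .
    then show ?thesis by (simp add: Suc r_def d_def algebra_simps power2_eq_square)
  qed
  have ode: "z * ((of_nat l + 1) * T z + z * T' z) + M * T z + (1 / W)\<^sup>2 * Y z = 0" for z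
  proof -
    have T: "(\<lambda>n. d n * z ^ n) sums T z" and Y: "(\<lambda>n. e n * z ^ n) sums Y z"
      unfolding T_def Y_def by (intro summable_sums d_summ e_summ)+
    have "(\<lambda>n. z * (of_nat n * d n * z ^ (n - Suc 0))) sums (z * T' z)"
      unfolding T'_def by (intro sums_mult diffs_equiv dd_summ)
    moreover have "z * (of_nat n * d n * z ^ (n - Suc 0)) = of_nat n * (d n * z ^ n)" for n
      by (cases n) (simp_all add: mult_ac)
    ultimately have "(\<lambda>n. of_nat n * (d n * z ^ n)) sums (z * T' z)" by simp
    from sums_mult[OF sums_add[OF sums_mult[OF T, of "of_nat l + 1"] this], of z]
    have "(\<lambda>n. z * ((of_nat l + 1) * (d n * z ^ n) + of_nat n * (d n * z ^ n))) sums
        (z * ((of_nat l + 1) * T z + z * T' z))" .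
    moreover have "z * ((of_nat l + 1) * (d n * z ^ n) + of_nat n * (d n * z ^ n)) = r (Suc n) * z ^ Suc n" for n
      by (simp add: r_def algebra_simps)
    ultimately have "(\<lambda>n. r (Suc n) * z ^ Suc n) sums (z * ((of_nat l + 1) * T z + z * T' z))" by simp
    then have "(\<lambda>n. r n * z ^ n) sums (z * ((of_nat l + 1) * T z + z * T' z) + r 0 * z ^ 0)"
      by (subst (asm) sums_Suc_iff) simp
    then have "(\<lambda>n. r n * z ^ n) sums (z * ((of_nat l + 1) * T z + z * T' z))" by (simp add: r_def)
    from sums_add[OF sums_add[OF this sums_mult[OF T, of M]] sums_mult[OF Y, of "(1 / W)\<^sup>2"]]
    have "(\<lambda>n. r n * z ^ n + M * (d n * z ^ n) + (1 / W)\<^sup>2 * (e n * z ^ n)) sums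
      (z * ((of_nat l + 1) * T z + z * T' z) + M * T z + (1 / W)\<^sup>2 * Y z)" .
    moreover have "r n * z ^ n + M * (d n * z ^ n) + (1 / W)\<^sup>2 * (e n * z ^ n) = 0" for n
    proof -
      have "r n * z ^ n + M * (d n * z ^ n) + (1 / W)\<^sup>2 * (e n * z ^ n) = (r n + M * d n + (1 / W)\<^sup>2 * e n) * z ^ n"
        by (simp only: ring_distribs mult_ac)
      then show ?thesis by (simp only: rec mult_zero_left)
    qed
    ultimately have "(\<lambda>n. 0) sums (z * ((of_nat l + 1) * T z + z * T' z) + M * T z + (1 / W)\<^sup>2 * Y z)" by simp
    from sums_unique2[OF this sums_zero] show ?thesis .
  qed
  define u where "u t = exp (- M * cis (- t)) * Y (cis (- t))" for t
  define v where "v t = - (W * \<i>) * cis (- t) * exp (- M * cis (- t)) * T (cis (- t))" for t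
  have w: "((\<lambda>t. cis (- t)) has_vector_derivative - (\<i> * cis (- t))) (at t)" for t
  proof -
    have "((\<lambda>t. - t) has_real_derivative - 1) (at t)" by (auto intro!: derivative_eq_intros)
    from has_vector_derivative_cis[OF this] show ?thesis by simp
  qed
  have E: "((\<lambda>t. exp (- M * cis (- t))) has_vector_derivative (\<i> * M * cis (- t)) * exp (- M * cis (- t))) (at t)" for t
    using has_vector_derivative_exp[OF has_vector_derivative_mult_right[OF w, of "- M"]]
    by (rule has_vector_derivative_eq_rhs) (simp add: mult_ac)
  have Yw: "((\<lambda>t. Y (cis (- t))) has_vector_derivative - (\<i> * cis (- t)) * (M * Y (cis (- t)) + T (cis (- t)))) (at t)" for t
    using field_vector_diff_chain_at[OF w Y_deriv] by (simp add: o_def)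
  have Tw: "((\<lambda>t. T (cis (- t))) has_vector_derivative - (\<i> * cis (- t)) * T' (cis (- t))) (at t)" for t
    using field_vector_diff_chain_at[OF w T_deriv] by (simp add: o_def)
  have "linear_solution \<omega> (real l) \<mu> u v"
    unfolding linear_solution_def
  proof (intro allI conjI)
    fix t
    define x E0 where "x = cis (- t)" and "E0 = exp (- M * cis (- t))"
    have E0x: "exp (- M * x) = E0" by (simp add: x_def E0_def)
    have xz: "x * cis t = 1" by (simp add: x_def cis_mult)
    show "(u has_vector_derivative v t / of_real (2 * \<omega>)) (at t)"
      using has_vector_derivative_mult[OF E Yw, of t] unfolding u_def[abs_def] W_def[symmetric]
      by (rule has_vector_derivative_eq_rhs) (use W in \<open>simp add: v_def algebra_simps\<close>)
    have "(v has_vector_derivative - (W * \<i>) *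
        (x * (E0 * (- (\<i> * x) * T' x) + (\<i> * M * x) * E0 * T x) + (- (\<i> * x)) * (E0 * T x))) (at t)"
      using has_vector_derivative_mult_right[OF has_vector_derivative_mult[OF w[of t] has_vector_derivative_mult[OF E[of t] Tw[of t]]], of "- (W * \<i>)"]
      unfolding v_def[abs_def] x_def E0_def by (simp only: mult.assoc)
    then show "(v has_vector_derivative
        \<i> * of_real (real l + 2 * \<mu> * cos t) * v t + u t / of_real (2 * \<omega>)) (at t)"
    proof (rule has_vector_derivative_eq_rhs)
      have "of_real (2 * cos t) = cis t + x" by (simp add: complex_eq_iff x_def)
      then have Q: "of_real (real l + 2 * \<mu> * cos t) = of_nat l + M * (cis t + x)"
        by (simp add: M_def algebra_simps)
      have "\<i> * (of_nat l + M * (cis t + x)) * v t = W * E0 * (of_nat l * x * T x + M * (x * cis t) * T x + M * x * x * T x)"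
        unfolding v_def x_def[symmetric] E0x by (simp add: algebra_simps)
      then have R: "\<i> * of_real (real l + 2 * \<mu> * cos t) * v t = W * E0 * (of_nat l * x * T x + M * T x + M * x * x * T x)"
        unfolding Q xz by simp
      have "x * (x * T' x) = - ((of_nat l + 1) * x * T x + M * T x + (1 / W)\<^sup>2 * Y x)"
        using ode[of x] by (simp add: algebra_simps add_eq_0_iff)
      note xT' = this
      have "- (W * \<i>) * (x * (E0 * (- (\<i> * x) * T' x) + (\<i> * M * x) * E0 * T x) + (- (\<i> * x)) * (E0 * T x)) =
          W * E0 * (- (x * (x * T' x)) + M * x * x * T x - x * T x)"
        by (simp add: algebra_simps)
      also have "\<dots> = W * E0 * (of_nat l * x * T x + M * T x + M * x * x * T x) + E0 * Y x / W"
        using W unfolding xT' by (simp add: algebra_simps power2_eq_square)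
      finally show "- (W * \<i>) * (x * (E0 * (- (\<i> * x) * T' x) + (\<i> * M * x) * E0 * T x) + (- (\<i> * x)) * (E0 * T x)) =
          \<i> * of_real (real l + 2 * \<mu> * cos t) * v t + u t / of_real (2 * \<omega>)"
        unfolding R by (simp add: u_def x_def E0_def W_def)
    qed
  qed
  moreover have "summable (\<lambda>n. norm (e n))" "summable (\<lambda>n. norm (d n))"
    using powser_insidea[OF e_summ[of 2], of 1] powser_insidea[OF d_summ[of 2], of 1] by simp_all
  moreover have "\<exists>n. e n \<noteq> 0"
  proof -
    have "\<forall>\<^sub>F n in sequentially. tail_limit l lam \<mu> n > 0"
      using tail_limit_tendsto_1 by (rule order_tendstoD(1)) simp
    then obtain n where "tail_limit l lam \<mu> n > 0" unfolding eventually_sequentially by blast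
    then show ?thesis using \<mu> by (intro exI[of _ n]) (simp add: e_def)
  qed
  ultimately show ?thesis
    unfolding u_def[abs_def] v_def[abs_def] Y_def T_def M_def W_def by blast
qed

text \<open>The image of the solution under \<open>linear_solution_involution\<close> is also periodic, since \<open>l\<close> is an integer. If both were
dependent, then \<open>Y\<close>, a series in the powers \<open>cis (- t) ^ n\<close>, would be a multiple of \<open>cis ((l + 1) t)\<close> times
the conjugate of another such series; the first has no positive modes, the second only positive ones.\<close>

lemma xi_zero_imp_advance_const:
  assumes \<omega>: "\<omega> > 0" and A: "A \<noteq> 0" and B: "B = real l * \<omega>"
    and \<mu>_def: "\<mu> = A / (2 * \<omega>)" and lam: "lam = (1 / (2 * \<omega>))\<^sup>2 - \<mu>\<^sup>2" and xi: "\<xi> l lam \<mu> = 0"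
  shows "\<exists>r::int. \<forall>x. advance \<omega> (B, A) x = 2 * pi * of_int r"
proof -
  have \<mu>: "\<mu> \<noteq> 0" using A \<omega> by (simp add: \<mu>_def)
  have q: "B / \<omega> = real l" using B \<omega> by simp
  obtain e d :: "nat \<Rightarrow> complex" where e: "summable (\<lambda>n. norm (e n))" and d: "summable (\<lambda>n. norm (d n))"
    and e_nz: "\<exists>n. e n \<noteq> 0"
    and sol0: "linear_solution \<omega> (real l) \<mu> (\<lambda>t. exp (- of_real \<mu> * cis (- t)) * (\<Sum>n. e n * cis (- t) ^ n))
      (\<lambda>t. - (of_real (2 * \<omega>) * \<i>) * cis (- t) * exp (- of_real \<mu> * cis (- t)) * (\<Sum>n. d n * cis (- t) ^ n))"
    using xi_zero_imp_solution_analytic_at_infinity[OF \<omega> \<mu> lam xi] by blast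
  define Y T where "Y t = (\<Sum>n. e n * cis (- t) ^ n)" and "T t = (\<Sum>n. d n * cis (- t) ^ n)" for t
  define u v where "u t = exp (- of_real \<mu> * cis (- t)) * Y t"
    and "v t = - (of_real (2 * \<omega>) * \<i>) * cis (- t) * exp (- of_real \<mu> * cis (- t)) * T t" for t
  define U V where "U t = trace_phase (real l) \<mu> t * cnj (v t)" and "V t = trace_phase (real l) \<mu> t * cnj (u t)" for t
  have sol: "linear_solution \<omega> (real l) \<mu> u v"
    using sol0 unfolding u_def[abs_def] v_def[abs_def] Y_def T_def .
  have solUV: "linear_solution \<omega> (real l) \<mu> U V"
    unfolding U_def V_def by (rule linear_solution_involution[OF sol])
  have end1: "cis (- (2 * pi)) = 1" by (simp add: complex_eq_iff)
  have per: "u (2 * pi) = u 0" "v (2 * pi) = v 0" by (simp_all add: u_def v_def Y_def T_def end1)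
  have "trace_phase (real l) \<mu> (2 * pi) = 1"
    using cis_multiple_2pi[of "real l"] by (simp add: trace_phase_def mult_ac)
  moreover have "trace_phase (real l) \<mu> 0 = 1" by (simp add: trace_phase_def)
  ultimately have perUV: "U (2 * pi) = U 0" "V (2 * pi) = V 0" by (simp_all add: U_def V_def per)
  have Y_coeff: "fourier 0 Y (- int n) = of_real (2 * pi) * e n" for n
    unfolding Y_def[abs_def] by (rule fourier_coefficient_power_series(1)[OF e])
  have Y_nz: False if "\<And>n. fourier 0 Y (- int n) = 0"
    using that e_nz by (simp add: Y_coeff)
  have indep: "u 0 * V 0 \<noteq> U 0 * v 0"
  proof
    assume "u 0 * V 0 = U 0 * v 0"
    from degenerate_system_solution[OF this]
    obtain \<alpha> \<beta> where \<alpha>\<beta>: "\<alpha> \<noteq> 0 \<or> \<beta> \<noteq> 0" "\<alpha> * u 0 + \<beta> * U 0 = 0" "\<alpha> * v 0 + \<beta> * V 0 = 0" by blast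
    have dep: "\<alpha> * u t + \<beta> * U t = 0" "\<alpha> * v t + \<beta> * V t = 0" if "t \<ge> 0" for t
      using linear_solution_unique[OF \<omega> linear_solution_combination[OF sol solUV], of \<alpha> \<beta> t] \<alpha>\<beta> that by blast+
    have "\<alpha> \<noteq> 0"
    proof
      assume "\<alpha> = 0"
      then have "V t = 0" if "t \<ge> 0" for t using dep(2)[OF that] \<alpha>\<beta>(1) by simp
      then have "Y t = 0" if "t \<ge> 0" for t using that by (simp add: V_def u_def trace_phase_def)
      then have "fourier 0 Y n = 0" for n
        unfolding fourier_def by (subst integral_cong[where g = "\<lambda>_. 0"]) auto
      then show False using Y_nz by blast
    qed
    define k where "k = - \<beta> * (of_real (2 * \<omega>) * \<i>) / \<alpha>"
    have "Y t = k * (cis (of_int (int l + 1) * t) * cnj (T t))" if t: "t \<ge> 0" for t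
    proof -
      have g: "trace_phase (real l) \<mu> t = cis (real l * t) * exp (of_real \<mu> * cis t) * exp (- of_real \<mu> * cis (- t))"
      proof -
        have "\<i> * of_real (real l * t + 2 * \<mu> * sin t) =
            \<i> * of_real (real l * t) + of_real \<mu> * cis t + - of_real \<mu> * cis (- t)"
          by (simp add: complex_eq_iff)
        then show ?thesis unfolding trace_phase_def cis_conv_exp[of "real l * t + 2 * \<mu> * sin t"]
          by (simp only: exp_add cis_conv_exp[of "real l * t"])
      qed
      have "cnj (v t) = of_real (2 * \<omega>) * \<i> * cis t * exp (- of_real \<mu> * cis t) * cnj (T t)"
        by (simp add: v_def cis_cnj exp_cnj)
      then have "U t = exp (- of_real \<mu> * cis (- t)) * (of_real (2 * \<omega>) * \<i> * (cis (real l * t) * cis t) *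
          (exp (of_real \<mu> * cis t) * exp (- of_real \<mu> * cis t)) * cnj (T t))"
        unfolding U_def g by (simp only: mult_ac)
      also have "exp (of_real \<mu> * cis t) * exp (- of_real \<mu> * cis t) = 1" by (simp add: exp_minus)
      also have "cis (real l * t) * cis t = cis (of_int (int l + 1) * t)"
        by (simp add: cis_mult algebra_simps)
      finally have "exp (- of_real \<mu> * cis (- t)) * (\<alpha> * Y t +
          \<beta> * (of_real (2 * \<omega>) * \<i> * cis (of_int (int l + 1) * t) * 1 * cnj (T t))) = 0"
        using dep(1)[OF t] unfolding u_def by (simp add: algebra_simps)
      then have "\<alpha> * Y t = - (\<beta> * (of_real (2 * \<omega>) * \<i> * cis (of_int (int l + 1) * t) * 1 * cnj (T t)))"
        by (simp add: eq_neg_iff_add_eq_0)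
      then have "\<alpha> * Y t / \<alpha> = - (\<beta> * (of_real (2 * \<omega>) * \<i> * cis (of_int (int l + 1) * t) * 1 * cnj (T t))) / \<alpha>"
        by (simp only:)
      then have "Y t = - (\<beta> * (of_real (2 * \<omega>) * \<i> * cis (of_int (int l + 1) * t) * 1 * cnj (T t))) / \<alpha>"
        unfolding nonzero_mult_div_cancel_left[OF \<open>\<alpha> \<noteq> 0\<close>] .
      then show ?thesis by (simp add: k_def mult_ac)
    qed
    then have "fourier 0 Y n = fourier 0 (\<lambda>t. k * (cis (of_int (int l + 1) * t) * cnj (T t))) n" for n
      unfolding fourier_def by (intro integral_cong) auto
    then have "fourier 0 Y n = k * cnj (fourier 0 T (- (n - (int l + 1))))" for n
      by (simp only: fourier_mult fourier_shift fourier_cnj)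
    moreover have "fourier 0 T (- (- int n - (int l + 1))) = 0" for n
      unfolding T_def[abs_def] by (rule fourier_coefficient_power_series(2)[OF d]) simp
    ultimately show False using Y_nz by simp
  qed
  show ?thesis
    by (rule periodic_pair_imp_advance_const[of \<omega> B A u v U V, OF \<omega> _ _ indep])
      (simp_all add: floquet_solution_def q \<mu>_def[symmetric] sol solUV per perUV)
qed

section \<open>Adjacency points\<close>

text \<open>Were the interior empty, then for every \<open>s > 0\<close> there would be a unique \<open>B'\<close> with constant advance \<open>2\<pi>r\<close> at
\<open>(B', s A)\<close>, and \<open>B' / \<omega>\<close> would be an integer. Starting from \<open>B' = l \<omega>\<close> at \<open>s = 1\<close> it cannot
cross \<open>(l \<plusminus> 1/2) \<omega>\<close> as \<open>s\<close> decreases, so it stays equal to \<open>l \<omega>\<close>. For small \<open>s\<close> this contradicts \<open>xi_pos\<close>.\<close>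

lemma interior_level_set_nonempty:
  assumes \<omega>: "\<omega> > 0" and A: "A \<noteq> 0" and B: "B = real l * \<omega>"
    and D: "\<And>x. advance \<omega> (B, A) x = 2 * pi * of_int r"
  shows "interior (level_set \<omega> (of_int r)) \<noteq> {}"
proof
  assume empty: "interior (level_set \<omega> (of_int r)) = {}"
  let ?c = "2 * pi * of_int r :: real"
  define f where "f b s = min_advance \<omega> (b, s * A)" for b s
  have const: "\<exists>k::int. \<forall>x. advance \<omega> (of_int k * \<omega>, s * A) x = ?c" if s: "s > 0" for s
  proof -
    obtain B' where B': "\<And>x. advance \<omega> (B', s * A) x = ?c"
      using empty_interior_imp_advance_const[OF \<omega> empty] by blast
    obtain k :: int where "B' = of_int k * \<omega>"
      using advance_const_imp_periodic_pair(2)[OF \<omega> _ B'] A s by auto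
    then show ?thesis using B' by blast
  qed
  have f_inj: "b = b'" if "f b s = f b' s" for b b' s
    using extreme_advances_strict_mono(1)[OF \<omega>, of b b' "s * A"]
      extreme_advances_strict_mono(1)[OF \<omega>, of b' b "s * A"] that
    unfolding f_def by (cases b b' rule: linorder_cases) simp_all
  have k_eq: "f (of_int k * \<omega>) s = ?c" if "\<forall>x. advance \<omega> (of_int k * \<omega>, s * A) x = ?c" for k :: int and s
    using that advance_const_iff[OF \<omega>] unfolding f_def by blast
  have avoid: "f (B + \<sigma> * \<omega> / 2) s \<noteq> ?c" if s: "s > 0" and \<sigma>: "\<sigma> = 1 \<or> \<sigma> = -1" for s \<sigma>
  proof
    assume eq: "f (B + \<sigma> * \<omega> / 2) s = ?c"
    obtain k :: int where "f (of_int k * \<omega>) s = ?c" using const[OF s] k_eq by blast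
    then have "B + \<sigma> * \<omega> / 2 = of_int k * \<omega>" using f_inj[of "B + \<sigma> * \<omega> / 2" s "of_int k * \<omega>"] eq by simp
    then have "\<omega> * (2 * of_int (int l) + \<sigma>) = \<omega> * (2 * of_int k)" using B by (simp add: algebra_simps)
    then have *: "2 * of_int (int l) + \<sigma> = 2 * real_of_int k" using \<omega> by simp
    show False
      using \<sigma>
    proof
      assume "\<sigma> = 1"
      then have "real_of_int (2 * int l + 1) = of_int (2 * k)" using * by simp
      then have "2 * int l + 1 = 2 * k" by (simp only: of_int_eq_iff)
      then show False by presburger
    next
      assume "\<sigma> = -1"
      then have "real_of_int (2 * int l - 1) = of_int (2 * k)" using * by simp
      then have "2 * int l - 1 = 2 * k" by (simp only: of_int_eq_iff)
      then show False by presburger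
    qed
  qed
  \<comment> \<open>Small enough for \<open>\<mu>\<^sup>2 < (1 / (2 \<omega>))\<^sup>2\<close> at the ordinate \<open>s0 A\<close>.\<close>
  define s0 where "s0 = 1 / (1 + \<bar>A\<bar>)"
  have s0: "0 < s0" "s0 \<le> 1" "s0 * \<bar>A\<bar> < 1" by (simp_all add: s0_def field_simps)
  have cont: "continuous_on {s0..1} (f b)" for b
    unfolding f_def[abs_def]
    by (rule continuous_on_compose2[OF extreme_advances_continuous(1)[OF \<omega>]]) (auto intro!: continuous_intros)
  have "min_advance \<omega> (B, A) = ?c" using D advance_const_iff[OF \<omega>, of "(B, A)" ?c] by blast
  then have fB: "f B 1 = ?c" by (simp add: f_def)
  have "?c < f (B + 1 * \<omega> / 2) 1" "f (B + - 1 * \<omega> / 2) 1 < ?c"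
    using extreme_advances_strict_mono(1)[OF \<omega>, of B "B + \<omega> / 2" A]
      extreme_advances_strict_mono(1)[OF \<omega>, of "B - \<omega> / 2" B A] fB \<omega> by (simp_all add: f_def)
  have upper: "?c < f (B + 1 * \<omega> / 2) s0"
  proof (rule ccontr)
    assume "\<not> ?c < f (B + 1 * \<omega> / 2) s0"
    then obtain s where "s0 \<le> s" "f (B + 1 * \<omega> / 2) s = ?c"
      using IVT'[OF _ _ s0(2) cont, of "B + 1 * \<omega> / 2" ?c] \<open>?c < f (B + 1 * \<omega> / 2) 1\<close> by auto
    then show False using avoid[of s 1] s0 by simp
  qed
  have lower: "f (B + - 1 * \<omega> / 2) s0 < ?c"
  proof (rule ccontr)
    assume "\<not> f (B + - 1 * \<omega> / 2) s0 < ?c"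
    then obtain s where "s0 \<le> s" "f (B + - 1 * \<omega> / 2) s = ?c"
      using IVT2'[OF _ _ s0(2) cont, of "B + - 1 * \<omega> / 2" ?c] \<open>f (B + - 1 * \<omega> / 2) 1 < ?c\<close> by auto
    then show False using avoid[of s "-1"] s0 by simp
  qed
  obtain k :: int where k: "\<And>x. advance \<omega> (of_int k * \<omega>, s0 * A) x = ?c" using const[OF s0(1)] by blast
  then have fk: "f (of_int k * \<omega>) s0 = ?c" using k_eq by blast
  have mono: "b < b'" if "f b s < f b' s" for b b' s
    using extreme_advances_strict_mono(1)[OF \<omega>, of b' b "s * A"] that
    unfolding f_def by (cases b b' rule: linorder_cases) simp_all
  have "of_int k * \<omega> < B + 1 * \<omega> / 2" "B + - 1 * \<omega> / 2 < of_int k * \<omega>"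
    by (rule mono[where s = s0]; use upper lower fk in simp)+
  then have "\<omega> * real_of_int k < \<omega> * (real_of_int (int l) + 1 / 2)" "\<omega> * (real_of_int (int l) - 1 / 2) < \<omega> * real_of_int k"
    using B by (simp_all add: algebra_simps)
  then have "real_of_int k < real_of_int (int l) + 1 / 2" "real_of_int (int l) - 1 / 2 < real_of_int k"
    using \<omega> by (simp_all only: mult_less_cancel_left_pos)
  then have "k = int l" by linarith
  then have D0: "advance \<omega> (real l * \<omega>, s0 * A) x = ?c" for x using k by simp
  define \<mu> where "\<mu> = s0 * A / (2 * \<omega>)"
  have "\<xi> l ((1 / (2 * \<omega>))\<^sup>2 - \<mu>\<^sup>2) \<mu> = 0"
    using advance_const_imp_xi_zero[OF \<omega> _ refl \<mu>_def refl D0] s0(1) A by simp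
  moreover have "\<mu>\<^sup>2 < (1 / (2 * \<omega>))\<^sup>2"
  proof -
    have "\<bar>\<mu>\<bar> = s0 * \<bar>A\<bar> / (2 * \<omega>)" using s0(1) \<omega> by (simp add: \<mu>_def abs_mult)
    also have "\<dots> < 1 / (2 * \<omega>)" using s0(3) \<omega> by (intro divide_strict_right_mono) auto
    finally have "\<bar>\<mu>\<bar>\<^sup>2 < (1 / (2 * \<omega>))\<^sup>2" by (intro power_strict_mono) auto
    then show ?thesis by simp
  qed
  ultimately show False using xi_pos[of "(1 / (2 * \<omega>))\<^sup>2 - \<mu>\<^sup>2" l \<mu>] by simp
qed

theorem theorem3p12:
  fixes \<omega> A B \<mu> lam :: real and l :: nat
  assumes "\<omega> > 0"
    and "B = real l * \<omega>"
    and "A \<noteq> 0"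
    and "\<mu> = A / (2 * \<omega>)"
    and "lam = (1 / (2 * \<omega>))\<^sup>2 - \<mu>\<^sup>2"
  shows "adjacency_point \<omega> (B, A) \<longleftrightarrow> \<xi> l lam \<mu> = 0"
proof
  assume "adjacency_point \<omega> (B, A)"
  then obtain r :: int where "\<And>x. advance \<omega> (B, A) x = 2 * pi * of_int r"
    using adjacency_point_iff[OF assms(1)] by blast
  then show "\<xi> l lam \<mu> = 0" by (rule advance_const_imp_xi_zero[OF assms(1,3,2,4,5)])
next
  assume "\<xi> l lam \<mu> = 0"
  then obtain r :: int where r: "\<And>x. advance \<omega> (B, A) x = 2 * pi * of_int r"
    using xi_zero_imp_advance_const[OF assms(1,3,2,4,5)] by blast
  then have "interior (level_set \<omega> (of_int r)) \<noteq> {}"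
    by (rule interior_level_set_nonempty[OF assms(1,3,2)])
  then show "adjacency_point \<omega> (B, A)"
    using adjacency_point_iff[OF assms(1)] assms(3) r by blast
qed

end
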